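(* Let $d\ge2$ be an integer, $p\in[0,1)$, and let $\mathbb{P}_{d,p}$ be the weak limit as $n\to\infty$ (which exists) of the arboreal gas measures $\mathbb{P}_{n,d,p}$ on the wired trees $T^{\mathsf w}_{n,d}$. The limiting law $\mathbb{P}_{d,p}$ undergoes a phase transition as follows. (1) For $p\le 1/d$, $\mathbb{P}_{d,p}$ is i.i.d. Bernoulli bond percolation on $T_d$ with parameter $p$. (2) If $p\in(1/d,1)$, then under $\mathbb{P}_{d,p}$ there are almost surely infinitely many infinite components. Furthermore, each infinite component is one-ended and can be described as follows. (a) Let $e=(u,v)$ be an edge of $T_d$ with $u$ closer to the root than $v$. Conditioned on $e$ being closed, $v$ has probability $q=\frac{dp-1}{p(d-1)}$ of being in an infinite component, and this infinite component can be sampled as follows. Declare a child edge $(v,v_1)$ of $v$, chosen uniformly at random, to be open; then inductively, having defined $v_i$, declare a child edge $(v_i,v_{i+1})$ of $v_i$, chosen uniformly at random, to be open. This defines an infinite path $P$. (b) Each vertex in such a path $P$ has an independent $\mathrm{Bin}(d-1,1/d)$ number of open edges attached to it which do not belong to $P$, obtained by performing Bernoulli percolation with parameter $1/d$ on the $d-1$ child edges of that vertex not in $P$. The other endpoints of these open edges are attached to almost surely finite trees, which are distributed as independent critical branching processes with offspring distribution $\mathrm{Bin}(d,1/d)$, obtained by sampling Bernoulli bond percolation with parameter $1/d$. (c) Furthermore, all the finite components are also distributed as independent critical branching processes with offspring distribution $\mathrm{Bin}(d,1/d)$.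
   Context: Trees. $T_d$ is the infinite rooted tree with root $\rho$ in which every vertex has exactly $d$ children. $T_{n,d}$ is the rooted subtree of $T_d$ spanned by the vertices at distance at most $n$ from $\rho$. $T^{\mathsf w}_{n,d}$ is the (multi)graph obtained from $T_{n,d}$ by identifying all leaves into one vertex $\partial$; its edge set is identified with the edge set of $T_{n,d}$, a subset of the edge set of $T_d$. The child edges of a vertex are the $d$ edges joining it to its children. Arboreal gas. For a finite graph $G=(V,E)$ and $p\in[0,1)$, $\mathbb{P}_{G,p}$ is the probability measure on $\{0,1\}^E$ with $\mathbb{P}_{G,p}(f)\propto p^{o(f)}(1-p)^{c(f)}\mathbf 1\{f\text{ is a forest}\}$, where $o(f)$ and $c(f)$ are the numbers of open ($f(e)=1$) and closed ($f(e)=0$) edges, and $f$ is a forest if its open edges contain no cycle (two parallel open edges form a cycle). Write $\mathbb{P}_{n,d,p}=\mathbb{P}_{T^{\mathsf w}_{n,d},p}$. Weak convergence means convergence of the joint law of the states of any finite set of edges of $T_d$. Components are connected components of the subgraph of open edges. An infinite tree is one-ended if from any vertex there is exactly one infinite self-avoiding path. *)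

theory Defs
  imports "HOL-Probability.Probability" "HOL-Library.Sublist"
begin

text \<open>The set \<open>ends G e\<close> has one element if \<open>e\<close> is a loop and two otherwise.\<close>

record ('v, 'e) multigraph =
  verts :: "'v set"
  edges :: "'e set"
  ends :: "'e \<Rightarrow> 'v set"

text \<open>
  A cycle of length \<open>k\<close> has \<open>k\<close> distinct vertices and \<open>k\<close> distinct edges, so that a loop is a cycle
  of length 1 and two parallel edges form a cycle of length 2.
\<close>

definition is_cycle :: "('v, 'e) multigraph \<Rightarrow> 'v list \<Rightarrow> 'e list \<Rightarrow> bool" where
  "is_cycle G vs es \<longleftrightarrow>
     vs \<noteq> [] \<and> length es = length vs \<and> distinct vs \<and> distinct es \<and>
     set vs \<subseteq> verts G \<and> set es \<subseteq> edges G \<and>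
     (\<forall>i < length vs. ends G (es ! i) = {vs ! i, vs ! (Suc i mod length vs)})"

definition is_forest :: "('v, 'e) multigraph \<Rightarrow> bool" where
  "is_forest G \<longleftrightarrow> (\<nexists>vs es. is_cycle G vs es)"

definition adjacent :: "('v, 'e) multigraph \<Rightarrow> 'v \<Rightarrow> 'v \<Rightarrow> bool" where
  "adjacent G u v \<longleftrightarrow> (\<exists>e \<in> edges G. ends G e = {u, v})"

definition component_of :: "('v, 'e) multigraph \<Rightarrow> 'v \<Rightarrow> 'v set" where
  "component_of G v = {w. (adjacent G)\<^sup>*\<^sup>* v w}"

definition graph_components :: "('v, 'e) multigraph \<Rightarrow> 'v set set" where
  "graph_components G = component_of G ` verts G"

definition infinite_sa_path :: "('v, 'e) multigraph \<Rightarrow> 'v \<Rightarrow> (nat \<Rightarrow> 'v) \<Rightarrow> bool" where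
  "infinite_sa_path G v \<gamma> \<longleftrightarrow> \<gamma> 0 = v \<and> inj \<gamma> \<and> (\<forall>i. adjacent G (\<gamma> i) (\<gamma> (Suc i)))"

definition one_ended :: "('v, 'e) multigraph \<Rightarrow> 'v set \<Rightarrow> bool" where
  "one_ended G C \<longleftrightarrow> (\<forall>v \<in> C. \<exists>!\<gamma>. infinite_sa_path G v \<gamma>)"

definition open_subgraph :: "('v, 'e) multigraph \<Rightarrow> ('e \<Rightarrow> bool) \<Rightarrow> ('v, 'e) multigraph" where
  "open_subgraph G f = G\<lparr>edges := {e \<in> edges G. f e}\<rparr>"

text \<open>
  A vertex of the \<open>d\<close>-ary tree is the word of child indices leading to it from the root \<open>[]\<close>;
  the children of \<open>v\<close> are \<open>v @ [i]\<close> with \<open>i < d\<close>.  Every edge is named by its endpoint further from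
  the root, so the edge joining \<open>butlast e\<close> to \<open>e\<close> is called \<open>e\<close>.
\<close>

type_synonym vertex = "nat list"

definition tree_verts :: "nat \<Rightarrow> vertex set" where
  "tree_verts d = lists {..<d}"

definition tree_edges :: "nat \<Rightarrow> vertex set" where
  "tree_edges d = tree_verts d - {[]}"

definition tree :: "nat \<Rightarrow> (vertex, vertex) multigraph" where
  "tree d = \<lparr>verts = tree_verts d, edges = tree_edges d, ends = (\<lambda>e. {butlast e, e})\<rparr>"

text \<open>\<open>None\<close> is the boundary vertex to which all the vertices at distance \<open>n\<close> are identified.\<close>

definition wire :: "nat \<Rightarrow> vertex \<Rightarrow> vertex option" where
  "wire n v = (if length v = n then None else Some v)"

definition wired_tree :: "nat \<Rightarrow> nat \<Rightarrow> (vertex option, vertex) multigraph" where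
  "wired_tree n d =
     \<lparr>verts = wire n ` {v \<in> tree_verts d. length v \<le> n},
      edges = {e \<in> tree_edges d. length e \<le> n},
      ends = (\<lambda>e. wire n ` ends (tree d) e)\<rparr>"

definition config_space :: "'e set \<Rightarrow> ('e \<Rightarrow> bool) measure" where
  "config_space E = (\<Pi>\<^sub>M e\<in>E. count_space UNIV)"

definition gas_weight :: "('v, 'e) multigraph \<Rightarrow> real \<Rightarrow> ('e \<Rightarrow> bool) \<Rightarrow> real" where
  "gas_weight G p f =
     (if is_forest (open_subgraph G f)
      then p ^ card {e \<in> edges G. f e} * (1 - p) ^ card {e \<in> edges G. \<not> f e} else 0)"

definition arboreal_gas :: "('v, 'e) multigraph \<Rightarrow> real \<Rightarrow> ('e \<Rightarrow> bool) measure" where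
  "arboreal_gas G p =
     point_measure (edges G \<rightarrow>\<^sub>E UNIV)
       (\<lambda>f. ennreal (gas_weight G p f / (\<Sum>g \<in> edges G \<rightarrow>\<^sub>E UNIV. gas_weight G p g)))"

text \<open>
  The convergence of the joint law of the states of every finite set of edges.  A given finite \<open>F\<close>
  is contained in the edge set of the wired tree only for large \<open>n\<close>, which is all that matters.
\<close>

definition arboreal_gas_weak_limit :: "nat \<Rightarrow> real \<Rightarrow> (vertex \<Rightarrow> bool) measure \<Rightarrow> bool" where
  "arboreal_gas_weak_limit d p P \<longleftrightarrow>
     prob_space P \<and> sets P = sets (config_space (tree_edges d)) \<and>
     (\<forall>F \<eta>. finite F \<and> F \<subseteq> tree_edges d \<longrightarrow>
        (\<lambda>n. \<P>(f in arboreal_gas (wired_tree n d) p. \<forall>e\<in>F. f e = \<eta> e))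
          \<longlonglongrightarrow> \<P>(\<omega> in P. \<forall>e\<in>F. \<omega> e = \<eta> e))"

definition bernoulli_percolation :: "nat \<Rightarrow> real \<Rightarrow> (vertex \<Rightarrow> bool) measure" where
  "bernoulli_percolation d r = (\<Pi>\<^sub>M e\<in>tree_edges d. measure_pmf (bernoulli_pmf r))"

definition cluster :: "nat \<Rightarrow> (vertex \<Rightarrow> bool) \<Rightarrow> vertex \<Rightarrow> vertex set" where
  "cluster d \<omega> v = component_of (open_subgraph (tree d) \<omega>) v"

text \<open>
  The edge from \<open>v\<close> to its parent, if there is one, is closed; equivalently, \<open>v\<close> is the vertex of its
  cluster closest to the root.
\<close>

definition parent_closed :: "(vertex \<Rightarrow> bool) \<Rightarrow> vertex \<Rightarrow> bool" where
  "parent_closed \<omega> v \<longleftrightarrow> (v \<noteq> [] \<longrightarrow> \<not> \<omega> v)"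

text \<open>
  The part of the cluster of \<open>v\<close> below \<open>v\<close>, moved to the root by the isomorphism \<open>x \<mapsto> v @ x\<close> from the
  whole tree onto the subtree below \<open>v\<close> and given by its indicator function.  If
  \<open>parent_closed \<omega> v\<close> this is the whole cluster.  The open edges of a cluster are exactly the tree
  edges joining two of its vertices, so nothing is lost by recording vertices only.
\<close>

definition rooted_cluster :: "nat \<Rightarrow> vertex \<Rightarrow> (vertex \<Rightarrow> bool) \<Rightarrow> vertex \<Rightarrow> bool" where
  "rooted_cluster d v \<omega> = (\<lambda>x\<in>tree_verts d. v @ x \<in> cluster d \<omega> v)"

definition percolation_tree :: "nat \<Rightarrow> real \<Rightarrow> (vertex \<Rightarrow> bool) measure" where
  "percolation_tree d r =
     distr (bernoulli_percolation d r) (config_space (tree_verts d)) (rooted_cluster d [])"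

definition generations :: "nat \<Rightarrow> nat \<Rightarrow> (vertex \<Rightarrow> bool) \<Rightarrow> vertex set" where
  "generations d n T = {x \<in> tree_verts d. length x \<le> n \<and> T x}"

definition offspring :: "nat \<Rightarrow> (vertex \<Rightarrow> bool) \<Rightarrow> vertex \<Rightarrow> nat" where
  "offspring d T x = card {i. i < d \<and> T (x @ [i])}"

text \<open>
  The law of the genealogical tree of a branching process with offspring distribution \<open>\<mu>\<close>, as a random
  subtree of the \<open>d\<close>-ary tree: given generations \<open>0, \<dots>, n\<close>, the numbers of children of the
  individuals of generation \<open>n\<close> are independent with law \<open>\<mu>\<close>.
\<close>

definition branching_process :: "nat \<Rightarrow> nat pmf \<Rightarrow> (vertex \<Rightarrow> bool) measure \<Rightarrow> bool" where
  "branching_process d \<mu> M \<longleftrightarrow>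
     prob_space M \<and> sets M = sets (config_space (tree_verts d)) \<and>
     (AE T in M. T [] \<and> (\<forall>x \<in> tree_verts d. \<forall>i < d. T (x @ [i]) \<longrightarrow> T x)) \<and>
     (\<forall>n S \<kappa>.
        \<P>(T in M. generations d n T = S \<and> (\<forall>x\<in>S. length x = n \<longrightarrow> offspring d T x = \<kappa> x)) =
        \<P>(T in M. generations d n T = S) * (\<Prod>x | x \<in> S \<and> length x = n. pmf \<mu> (\<kappa> x)))"

text \<open>
  The random input \<open>(\<xi>, \<eta>, \<tau>)\<close>: \<open>\<xi> k\<close> is the uniform child chosen at the \<open>k\<close>-th vertex of the path, \<open>\<eta>\<close>
  tells which child edges of the path vertices are opened, and the \<open>\<tau> w\<close> are the independent trees to
  be attached.  Only the \<open>\<eta> w\<close> and \<open>\<tau> w\<close> with \<open>w\<close> a child of the path outside the path are used.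
\<close>

type_synonym spine_sample = "(nat \<Rightarrow> nat) \<times> (vertex \<Rightarrow> bool) \<times> (vertex \<Rightarrow> vertex \<Rightarrow> bool)"

definition spine_space :: "nat \<Rightarrow> spine_sample measure" where
  "spine_space d =
     (\<Pi>\<^sub>M k\<in>UNIV. measure_pmf (pmf_of_set {..<d})) \<Otimes>\<^sub>M
     (bernoulli_percolation d (1 / real d) \<Otimes>\<^sub>M
      (\<Pi>\<^sub>M w\<in>tree_edges d. percolation_tree d (1 / real d)))"

definition spine :: "(nat \<Rightarrow> nat) \<Rightarrow> nat \<Rightarrow> vertex" where
  "spine \<xi> k = map \<xi> [0..<k]"

definition open_side_edges :: "nat \<Rightarrow> (nat \<Rightarrow> nat) \<Rightarrow> (vertex \<Rightarrow> bool) \<Rightarrow> nat \<Rightarrow> vertex set" where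
  "open_side_edges d \<xi> \<eta> k = {spine \<xi> k @ [i] | i. i < d \<and> i \<noteq> \<xi> k \<and> \<eta> (spine \<xi> k @ [i])}"

definition spine_cluster :: "nat \<Rightarrow> spine_sample \<Rightarrow> vertex \<Rightarrow> bool" where
  "spine_cluster d = (\<lambda>(\<xi>, \<eta>, \<tau>). \<lambda>x\<in>tree_verts d.
     (\<exists>k. x = spine \<xi> k) \<or>
     (\<exists>k. \<exists>w \<in> open_side_edges d \<xi> \<eta> k. \<exists>y. x = w @ y \<and> \<tau> w y))"

definition finite_cluster_top :: "nat \<Rightarrow> (vertex \<Rightarrow> bool) \<Rightarrow> vertex \<Rightarrow> bool" where
  "finite_cluster_top d \<omega> v \<longleftrightarrow> parent_closed \<omega> v \<and> finite (cluster d \<omega> v)"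

definition exploration_order :: "nat \<Rightarrow> (nat \<Rightarrow> vertex) \<Rightarrow> bool" where
  "exploration_order d x \<longleftrightarrow>
     bij_betw x UNIV (tree_verts d) \<and> (\<forall>i j. strict_prefix (x i) (x j) \<longrightarrow> i < j)"

text \<open>
  The finite clusters, each moved to the root, listed in the order in which their vertices closest
  to the root appear in \<open>x\<close>.
\<close>

definition finite_cluster_seq ::
    "nat \<Rightarrow> (nat \<Rightarrow> vertex) \<Rightarrow> (vertex \<Rightarrow> bool) \<Rightarrow> nat \<Rightarrow> vertex \<Rightarrow> bool" where
  "finite_cluster_seq d x \<omega> k =
     rooted_cluster d (x (Infinite_Set.enumerate {i. finite_cluster_top d \<omega> (x i)} k)) \<omega>"

end

theory Submission
  imports Defs
begin

text \<open>
  In the wired tree every cycle passes through the boundary vertex: it climbs from the boundary to some vertex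
  and descends to the boundary through another child. So an edge set is a forest iff no vertex has two
  children that are joined to the boundary by open descending paths (\<open>is_forest_wired_tree\<close>).
  Hence the branches at the root interact only through the bit that tells for each child whether it is so
  joined, and the gas is Bernoulli(\<open>p\<close>) percolation conditioned on a recursive event. Given the
  forest condition, the root of the tree of height \<open>n\<close> is joined to the boundary with a
  probability \<open>r n\<close> satisfying \<open>r (n + 1) = d p r / (1 + (d - 1) p r)\<close> with
  \<open>r = r n\<close>, and \<open>r 0 = 1\<close>. This sequence decreases to
  \<open>q = survival_prob d p\<close>, which is \<open>0\<close> for \<open>p \<le> 1 / d\<close> and
  \<open>(d p - 1) / (p (d - 1))\<close> otherwise. The weights of cylinder events satisfy a recursion with
  coefficients continuous in \<open>r n\<close>, so they converge too (\<open>arboreal_gas_limit\<close>).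

  The limit recursion is that of a random growth process, read downwards from the root. Each vertex has a
  type, surviving (joined to infinity below) or not; the root survives with probability \<open>q\<close>. A
  surviving vertex has exactly one child through which it survives, uniformly chosen and joined to it by an
  open edge. Any other child edge is open with a non-surviving child below it (weight
  \<open>p (1 - q)\<close>) or closed (weight \<open>1 - p\<close>), in which case the child has the type of a
  fresh root. So these edges are open with probability \<open>s = p (1 - q) / (1 - p q)\<close>, which is
  \<open>p\<close> if \<open>q = 0\<close> and exactly \<open>1 / d\<close> if \<open>p > 1 / d\<close>. The
  process is a function \<open>config\<close> of independent labels attached to the vertices, and its law is
  the weak limit (\<open>config_law_weak_limit\<close>).

  Everything is read off from this process. If \<open>q = 0\<close>, no vertex survives and all edges are
  independent. If \<open>p > 1 / d\<close>, the open paths below a non-surviving vertex are those of critical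
  percolation, hence almost surely finitely many, and so a vertex has infinitely many descendants in its
  cluster iff it survives (\<open>regular_infinite_below\<close>). A surviving vertex has only one surviving
  child joined to it, which makes every infinite cluster one-ended. Infinitely many disjoint blocks of labels
  each produce, with the same positive probability, the top of an infinite cluster and the top of a finite
  one, so there are infinitely many of both. The cluster of a vertex below a closed edge depends, given the
  type of the vertex, only on the labels below it (\<open>top_cluster_factor\<close>); the type is a fresh
  one, which gives the probability \<open>q\<close>, and the cluster of a surviving vertex follows the choices
  along a uniform ray and carries critical percolation on the remaining child edges, which is the law of the
  spine (\<open>survivor_cluster_law\<close>). Finally, the clusters explored before a finite cluster are
  determined by the edges that are not below its top, so the finite clusters in order of exploration are
  independent (\<open>finite_cluster_seq_law\<close>).
\<close>

section \<open>Product fields and disjoint blocks\<close>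

definition product_field :: "('i \<Rightarrow> 'a pmf) \<Rightarrow> ('i \<Rightarrow> 'a) measure" where
  "product_field \<mu> = (\<Pi>\<^sub>M i\<in>UNIV. measure_pmf (\<mu> i))"

text \<open>
  The form in which independence is verified throughout: two functions of a product field that are determined
  by disjoint sets of coordinates are independent.
\<close>

definition determined_by :: "'i set \<Rightarrow> (('i \<Rightarrow> 'a) \<Rightarrow> 'b) \<Rightarrow> bool" where
  "determined_by J f \<longleftrightarrow> (\<forall>X Y. (\<forall>j\<in>J. X j = Y j) \<longrightarrow> f X = f Y)"

lemma determined_byI:
  "(\<And>X Y. (\<And>j. j \<in> J \<Longrightarrow> X j = Y j) \<Longrightarrow> f X = f Y) \<Longrightarrow> determined_by J f"
  unfolding determined_by_def by blast

lemma determined_byD: "determined_by J f \<Longrightarrow> (\<And>j. j \<in> J \<Longrightarrow> X j = Y j) \<Longrightarrow> f X = f Y"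
  unfolding determined_by_def by blast

lemma determined_by_mono: "determined_by J f \<Longrightarrow> J \<subseteq> K \<Longrightarrow> determined_by K f"
  unfolding determined_by_def by blast

lemma space_product_field [simp]: "space (product_field \<mu>) = UNIV"
  by (simp add: product_field_def space_PiM)

lemma prob_space_product_field [simp]: "prob_space (product_field \<mu>)"
  unfolding product_field_def by (intro prob_space_PiM measure_pmf.prob_space_axioms)

lemma measurable_product_field_component [measurable]:
  "(\<lambda>X. X i) \<in> product_field \<mu> \<rightarrow>\<^sub>M count_space UNIV"
proof -
  have "(\<lambda>X. X i) \<in> product_field \<mu> \<rightarrow>\<^sub>M measure_pmf (\<mu> i)"
    unfolding product_field_def by (rule measurable_component_singleton) simp
  then show ?thesis by simp
qed

lemma sets_product_field [measurable_cong]: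
  "sets (product_field \<mu>) = sets (\<Pi>\<^sub>M i\<in>UNIV. count_space UNIV)"
  unfolding product_field_def by (rule sets_PiM_cong) auto

lemma sets_Collect_product_field [intro]:
  "Measurable.pred (product_field \<mu>) E \<Longrightarrow> {X. E X} \<in> sets (product_field \<mu>)"
  by (drule predE) (simp only: space_product_field UNIV_I simp_thms)

text \<open>
  The restrictions of the field to disjoint blocks of coordinates are independent, and an event determined by
  a block is an event for the restriction: the coordinates outside the block may be filled with an arbitrary
  constant.
\<close>

lemma prob_disjoint_blocks:
  assumes "finite K"
    and disj: "\<And>k l. k \<in> K \<Longrightarrow> l \<in> K \<Longrightarrow> k \<noteq> l \<Longrightarrow> J k \<inter> J l = {}"
    and det: "\<And>k. k \<in> K \<Longrightarrow> determined_by (J k) (E k)"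
    and meas: "\<And>k. k \<in> K \<Longrightarrow> Measurable.pred (product_field \<mu>) (E k)"
  shows "measure (product_field \<mu>) {X. \<forall>k\<in>K. E k X} = (\<Prod>k\<in>K. measure (product_field \<mu>) {X. E k X})"
proof (cases "K = {}")
  case True
  then show ?thesis
    using prob_space.prob_space[OF prob_space_product_field[of \<mu>]] by simp
next
  case False
  let ?M = "product_field \<mu>" and ?N = "\<lambda>i. measure_pmf (\<mu> i)"
  interpret prob_space ?M by simp
  have "distr ?M (PiM UNIV ?N) (\<lambda>X. \<lambda>i\<in>UNIV. X i) = ?M"
    by (simp add: product_field_def distr_id2 restrict_UNIV)
  moreover have "distr ?M (?N i) (\<lambda>X. X i) = ?N i" for i
    unfolding product_field_def
    by (rule distr_PiM_component) (auto intro: measure_pmf.prob_space_axioms)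
  ultimately have "indep_vars ?N (\<lambda>i X. X i) UNIV"
    by (subst indep_vars_iff_distr_eq_PiM') (auto simp: product_field_def)
  then have ind: "indep_vars (\<lambda>k. PiM (J k) ?N) (\<lambda>k X. restrict (\<lambda>i. X i) (J k)) K"
    by (rule indep_vars_restrict) (auto simp: disjoint_family_on_def disj)
  define A where "A k = {Y \<in> space (PiM (J k) ?N). E k (\<lambda>i. if i \<in> J k then Y i else undefined)}" for k
  have A: "A k \<in> sets (PiM (J k) ?N)" if "k \<in> K" for k
  proof -
    have "(\<lambda>Y i. if i \<in> J k then Y i else undefined) \<in> PiM (J k) ?N \<rightarrow>\<^sub>M ?M"
      unfolding product_field_def
    proof (rule measurable_PiM_single')
      show "(\<lambda>Y. if i \<in> J k then Y i else undefined) \<in> PiM (J k) ?N \<rightarrow>\<^sub>M ?N i" for i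
        using measurable_component_singleton[of i "J k" ?N] by (cases "i \<in> J k") simp_all
    qed (auto simp: space_PiM)
    from measurable_compose[OF this meas[OF that]] show ?thesis
      unfolding A_def by (rule predE)
  qed
  have eq: "(\<lambda>X. restrict (\<lambda>i. X i) (J k)) -` A k \<inter> space ?M = {X. E k X}" if "k \<in> K" for k
  proof -
    have "E k (\<lambda>i. if i \<in> J k then restrict X (J k) i else undefined) = E k X" for X
      by (rule determined_byD[OF det[OF that]]) simp
    then show ?thesis
      unfolding A_def by (simp add: vimage_def space_PiM)
  qed
  have "prob (\<Inter>k\<in>K. (\<lambda>X. restrict (\<lambda>i. X i) (J k)) -` A k \<inter> space ?M) =
    (\<Prod>k\<in>K. prob ((\<lambda>X. restrict (\<lambda>i. X i) (J k)) -` A k \<inter> space ?M))"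
    using False assms(1) A by (intro indep_varsD[OF ind]) auto
  moreover have "(\<Inter>k\<in>K. (\<lambda>X. restrict (\<lambda>i. X i) (J k)) -` A k \<inter> space ?M) = {X. \<forall>k\<in>K. E k X}"
    using eq False by auto
  ultimately show ?thesis using eq by simp
qed

lemma prob_two_blocks:
  assumes "I \<inter> J = {}" and "determined_by I E" and "determined_by J F"
    and "Measurable.pred (product_field \<mu>) E" and "Measurable.pred (product_field \<mu>) F"
  shows "measure (product_field \<mu>) {X. E X \<and> F X} =
    measure (product_field \<mu>) {X. E X} * measure (product_field \<mu>) {X. F X}"
proof -
  have "{X. E X \<and> F X} = {X. \<forall>k\<in>UNIV. case_bool E F k X}"
    by (auto simp: UNIV_bool)
  also have "measure (product_field \<mu>) \<dots> = (\<Prod>k\<in>UNIV. measure (product_field \<mu>) {X. case_bool E F k X})"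
    using assms by (intro prob_disjoint_blocks[where J = "case_bool I J"]) (auto split: bool.split)
  finally show ?thesis by (simp add: UNIV_bool)
qed

lemma prob_product_field_component:
  "measure (product_field \<mu>) {X. X i \<in> A} = measure_pmf.prob (\<mu> i) A"
proof -
  have "distr (product_field \<mu>) (measure_pmf (\<mu> i)) (\<lambda>X. X i) = measure_pmf (\<mu> i)"
    unfolding product_field_def
    by (rule distr_PiM_component) (auto intro: measure_pmf.prob_space_axioms)
  then have "measure_pmf.prob (\<mu> i) A = measure (distr (product_field \<mu>) (measure_pmf (\<mu> i)) (\<lambda>X. X i)) A"
    by simp
  also have "\<dots> = measure (product_field \<mu>) {X. X i \<in> A}"
    by (subst measure_distr) (auto simp: vimage_def)
  finally show ?thesis by simp
qed

lemma distr_product_field_reindex: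
  assumes "inj t"
  shows "distr (product_field \<mu>) (product_field (\<lambda>i. \<mu> (t i))) (\<lambda>X i. X (t i)) = product_field (\<lambda>i. \<mu> (t i))"
  using distr_PiM_reindex[of UNIV "\<lambda>i. measure_pmf (\<mu> i)" t UNIV] assms
  unfolding product_field_def by (simp add: measure_pmf.prob_space_axioms restrict_UNIV)

text \<open>
  Relabelling along an injection. With \<open>t\<close> prefixing a vertex to the name of an edge, this is the
  self-similarity of the tree: what happens below a vertex has the law of what happens below the root.
\<close>

lemma prob_product_field_reindex:
  assumes "inj t" and "\<And>i. \<nu> i = \<mu> (t i)" and "Measurable.pred (product_field \<nu>) E"
  shows "measure (product_field \<mu>) {X. E (\<lambda>i. X (t i))} = measure (product_field \<nu>) {X. E X}"
proof -
  have \<nu>: "\<nu> = (\<lambda>i. \<mu> (t i))" using assms(2) by auto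
  have m: "(\<lambda>X i. X (t i)) \<in> product_field \<mu> \<rightarrow>\<^sub>M product_field \<nu>"
    unfolding product_field_def by (rule measurable_PiM_single') auto
  have "measure (product_field \<nu>) {X. E X} =
      measure (distr (product_field \<mu>) (product_field \<nu>) (\<lambda>X i. X (t i))) {X. E X}"
    using distr_product_field_reindex[OF assms(1), of \<mu>] by (simp add: \<nu>)
  also have "\<dots> = measure (product_field \<mu>) {X. E (\<lambda>i. X (t i))}"
    using sets_Collect_product_field[OF assms(3)] m by (subst measure_distr) (simp_all add: vimage_def)
  finally show ?thesis by simp
qed


section \<open>Forests in the wired tree\<close>

text \<open>
  An edge bears the name of its lower endpoint, so the edges of the descending path from \<open>v\<close> to
  \<open>v @ x\<close> are the \<open>v @ y\<close> with \<open>y\<close> a nonempty prefix of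
  \<open>x\<close>.
\<close>

definition open_below :: "(vertex \<Rightarrow> bool) \<Rightarrow> vertex \<Rightarrow> vertex \<Rightarrow> bool" where
  "open_below \<omega> v x \<longleftrightarrow> (\<forall>y. prefix y x \<longrightarrow> y \<noteq> [] \<longrightarrow> \<omega> (v @ y))"

lemma open_below_Nil [simp]: "open_below \<omega> v []"
  by (simp add: open_below_def)

lemma open_below_Cons: "open_below \<omega> v (i # x) \<longleftrightarrow> \<omega> (v @ [i]) \<and> open_below \<omega> (v @ [i]) x"
proof -
  have "open_below \<omega> v (i # x) \<longleftrightarrow> (\<forall>y. prefix y x \<longrightarrow> \<omega> (v @ i # y))"
    by (auto simp: open_below_def prefix_Cons)
  also have "\<dots> \<longleftrightarrow> \<omega> (v @ [i]) \<and> (\<forall>y. prefix y x \<longrightarrow> y \<noteq> [] \<longrightarrow> \<omega> (v @ i # y))"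
    using Nil_prefix by metis
  finally show ?thesis by (simp add: open_below_def)
qed

lemma open_below_append: "open_below \<omega> v (x @ y) \<longleftrightarrow> open_below \<omega> v x \<and> open_below \<omega> (v @ x) y"
  by (induction x arbitrary: v) (auto simp: open_below_Cons)

lemma open_below_shift: "open_below \<omega> (u @ v) x = open_below (\<lambda>e. \<omega> (u @ e)) v x"
  by (simp add: open_below_def)

lemma open_below_cong:
  "(\<And>y. prefix y x \<Longrightarrow> y \<noteq> [] \<Longrightarrow> \<omega> (v @ y) = \<omega>' (v @ y)) \<Longrightarrow> open_below \<omega> v x = open_below \<omega>' v x"
  unfolding open_below_def by blast

lemma tree_verts_simps [simp]:
  "[] \<in> tree_verts d" "i # v \<in> tree_verts d \<longleftrightarrow> i < d \<and> v \<in> tree_verts d"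
  "v @ w \<in> tree_verts d \<longleftrightarrow> v \<in> tree_verts d \<and> w \<in> tree_verts d"
  by (auto simp: tree_verts_def)

lemma tree_verts_prefix: "v \<in> tree_verts d \<Longrightarrow> prefix u v \<Longrightarrow> u \<in> tree_verts d"
  by (auto simp: prefix_def)

lemma in_tree_edges [simp]: "e \<in> tree_edges d \<longleftrightarrow> e \<in> tree_verts d \<and> e \<noteq> []"
  by (auto simp: tree_edges_def)

text \<open>
  The root is joined to distance \<open>n\<close> by an open descending path. The configuration in the branch
  behind the child \<open>i\<close> is \<open>\<lambda>e. f (i # e)\<close> (its value at \<open>[]\<close> is
  the state of the edge to the root).
\<close>

primrec hits_boundary :: "nat \<Rightarrow> nat \<Rightarrow> (vertex \<Rightarrow> bool) \<Rightarrow> bool" where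
  "hits_boundary d 0 f \<longleftrightarrow> True"
| "hits_boundary d (Suc n) f \<longleftrightarrow> (\<exists>i<d. f [i] \<and> hits_boundary d n (\<lambda>e. f (i # e)))"

primrec fork_free :: "nat \<Rightarrow> nat \<Rightarrow> (vertex \<Rightarrow> bool) \<Rightarrow> bool" where
  "fork_free d 0 f \<longleftrightarrow> True"
| "fork_free d (Suc n) f \<longleftrightarrow> (\<forall>i<d. fork_free d n (\<lambda>e. f (i # e))) \<and>
     (\<forall>i<d. \<forall>j<d. f [i] \<and> hits_boundary d n (\<lambda>e. f (i # e)) \<and>
                  f [j] \<and> hits_boundary d n (\<lambda>e. f (j # e)) \<longrightarrow> i = j)"

lemma hits_boundary_iff:
  "hits_boundary d n f \<longleftrightarrow> (\<exists>x\<in>tree_verts d. length x = n \<and> open_below f [] x)"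
proof (induction n arbitrary: f)
  case (Suc n)
  have "(\<exists>x\<in>tree_verts d. length x = Suc n \<and> open_below f [] x) \<longleftrightarrow>
      (\<exists>i x. i < d \<and> x \<in> tree_verts d \<and> length x = n \<and> f [i] \<and> open_below f [i] x)"
    (is "?L \<longleftrightarrow> ?R")
  proof
    assume ?L
    then obtain x where "x \<in> tree_verts d" "length x = Suc n" "open_below f [] x" by auto
    then show ?R by (cases x) (auto simp: open_below_Cons)
  next
    assume ?R
    then obtain i x where "i < d \<and> x \<in> tree_verts d \<and> length x = n \<and> f [i] \<and> open_below f [i] x" by auto
    then show ?L by (intro bexI[of _ "i # x"]) (auto simp: open_below_Cons)
  qed
  then show ?case
    using open_below_shift[of f "[i]" "[]" for i] by (auto simp: Suc)
qed auto

definition fork :: "nat \<Rightarrow> nat \<Rightarrow> (vertex \<Rightarrow> bool) \<Rightarrow> vertex \<Rightarrow> nat \<Rightarrow> vertex \<Rightarrow> nat \<Rightarrow> vertex \<Rightarrow> bool" where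
  "fork d n f z i x j y \<longleftrightarrow> z @ i # x \<in> tree_verts d \<and> z @ j # y \<in> tree_verts d \<and> i \<noteq> j \<and>
     length (z @ i # x) = n \<and> length (z @ j # y) = n \<and>
     open_below f z (i # x) \<and> open_below f z (j # y)"

lemma fork_Cons:
  "fork d (Suc n) f (k # z) i x j y \<longleftrightarrow> k < d \<and> fork d n (\<lambda>e. f (k # e)) z i x j y"
  using open_below_shift[of f "[k]" z] by (auto simp: fork_def)

lemma fork_Nil:
  "fork d (Suc n) f [] i x j y \<longleftrightarrow> i \<noteq> j \<and> i < d \<and> j < d \<and> x \<in> tree_verts d \<and> y \<in> tree_verts d \<and>
     length x = n \<and> length y = n \<and> f [i] \<and> f [j] \<and>
     open_below (\<lambda>e. f (i # e)) [] x \<and> open_below (\<lambda>e. f (j # e)) [] y"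
  using open_below_shift[of f "[i]" "[]"] open_below_shift[of f "[j]" "[]"]
  by (auto simp: fork_def open_below_Cons)

lemma fork_free_iff: "fork_free d n f \<longleftrightarrow> (\<nexists>z i x j y. fork d n f z i x j y)"
proof (induction n arbitrary: f)
  case 0
  show ?case by (simp add: fork_def)
next
  case (Suc n)
  have "(\<exists>z i x j y. fork d (Suc n) f z i x j y) \<longleftrightarrow>
     (\<exists>i x j y. fork d (Suc n) f [] i x j y) \<or> (\<exists>k z i x j y. fork d (Suc n) f (k # z) i x j y)"
    by (metis list.exhaust)
  also have "(\<exists>k z i x j y. fork d (Suc n) f (k # z) i x j y) \<longleftrightarrow>
      \<not> (\<forall>k<d. fork_free d n (\<lambda>e. f (k # e)))"
    unfolding fork_Cons Suc by blast
  also have "(\<exists>i x j y. fork d (Suc n) f [] i x j y) \<longleftrightarrow> \<not> (\<forall>i<d. \<forall>j<d. f [i] \<and>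
      hits_boundary d n (\<lambda>e. f (i # e)) \<and> f [j] \<and> hits_boundary d n (\<lambda>e. f (j # e)) \<longrightarrow> i = j)"
    unfolding fork_Nil hits_boundary_iff by blast
  finally show ?case by auto
qed

lemma wired_open_subgraph [simp]:
  "verts (open_subgraph (wired_tree n d) f) = wire n ` {v \<in> tree_verts d. length v \<le> n}"
  "edges (open_subgraph (wired_tree n d) f) = {e \<in> tree_edges d. length e \<le> n \<and> f e}"
  "ends (open_subgraph (wired_tree n d) f) e = {wire n (butlast e), wire n e}"
  by (auto simp: open_subgraph_def wired_tree_def tree_def)

text \<open>
  Both paths end at the boundary vertex, so together they close up: the cycle climbs from the boundary along
  one path to \<open>z\<close> and descends along the other.
\<close>

lemma fork_imp_cycle:
  assumes "fork d n f z i x j y"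
  shows "\<not> is_forest (open_subgraph (wired_tree n d) f)"
proof -
  define u where "u = z @ i # x"
  define w where "w = z @ j # y"
  define m where "m = length z"
  define L where "L = n - m"
  have uw: "u \<in> tree_verts d" "w \<in> tree_verts d" "length u = n" "length w = n" "i \<noteq> j"
    "open_below f z (i # x)" "open_below f z (j # y)"
    using assms by (auto simp: fork_def u_def w_def)
  have mn: "m < n" "0 < L" "n = m + L"
    using assms by (auto simp: fork_def m_def L_def)
  have take_m: "take m u = z" "take m w = z"
    by (auto simp: u_def w_def m_def)
  have diverge: "take l u \<noteq> take l w" if "m < l" for l
  proof
    assume "take l u = take l w"
    then have "take l u ! m = take l w ! m" by simp
    then show False using that \<open>i \<noteq> j\<close> by (simp add: u_def w_def m_def nth_append)
  qed
  have open_u: "f (take l u)" if "m < l" for l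
  proof -
    have "f (z @ take (l - m) (i # x))"
      using uw(6) that unfolding open_below_def by (auto simp: take_is_prefix)
    then show ?thesis using that by (simp add: u_def m_def)
  qed
  have open_w: "f (take l w)" if "m < l" for l
  proof -
    have "f (z @ take (l - m) (j # y))"
      using uw(7) that unfolding open_below_def by (auto simp: take_is_prefix)
    then show ?thesis using that by (simp add: w_def m_def)
  qed
  \<comment> \<open>the vertices and edges of the cycle: \<open>k < L\<close> climbs from \<open>u\<close> to \<open>z\<close>,
    the other \<open>k\<close> descend to \<open>w\<close>; positions \<open>0\<close> and \<open>2 * L\<close> are both at the boundary\<close>
  define V where "V k = (if k \<le> L then take (n - k) u else take (m + k - L) w)" for k
  define E where "E k = (if k < L then take (n - k) u else take (m + k - L + 1) w)" for k
  have verts_taken: "take l u \<in> tree_verts d" "take l w \<in> tree_verts d" for l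
    using uw by (auto intro: tree_verts_prefix take_is_prefix)
  have lenV: "length (V k) = (if k \<le> L then n - k else m + k - L)" if "k \<le> 2 * L" for k
    using uw mn that by (auto simp: V_def)
  have lenE: "length (E k) = (if k < L then n - k else Suc (m + k - L))" if "k < 2 * L" for k
    using uw mn that by (auto simp: E_def)
  have inj_E: "inj_on E {..<2 * L}"
  proof (rule inj_onI)
    fix a b assume ab: "a \<in> {..<2 * L}" "b \<in> {..<2 * L}" "E a = E b"
    then have len: "length (E a) = length (E b)" by simp
    show "a = b"
    proof (cases "a < L \<longleftrightarrow> b < L")
      case True
      then show ?thesis using len ab lenE[of a] lenE[of b] mn by (auto split: if_splits)
    next
      case False
      have False if ab: "a < L" "\<not> b < L" "b < 2 * L" "E a = E b" for a b
      proof -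
        have "length (E a) = length (E b)" using ab by simp
        then have "n - a = m + b - L + 1"
          using ab lenE[of a] lenE[of b] by simp
        then have "take (n - a) u = take (n - a) w"
          using ab by (simp add: E_def)
        moreover have "m < n - a" using ab mn by linarith
        ultimately show False using diverge by blast
      qed
      then show ?thesis using False ab by (metis lessThan_iff)
    qed
  qed
  have inj_V: "inj_on (\<lambda>k. wire n (V k)) {..<2 * L}"
  proof (rule inj_onI)
    fix a b assume ab: "a \<in> {..<2 * L}" "b \<in> {..<2 * L}" "wire n (V a) = wire n (V b)"
    have len_n: "length (V k) = n \<longleftrightarrow> k = 0" if "k < 2 * L" for k
      using lenV[of k] that mn by (auto split: if_splits)
    show "a = b"
    proof (cases "a = 0 \<or> b = 0")
      case True
      then show ?thesis using ab len_n[of a] len_n[of b] by (auto simp: wire_def split: if_splits)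
    next
      case False
      then have eq: "V a = V b"
        using ab len_n[of a] len_n[of b] by (auto simp: wire_def split: if_splits)
      then have len: "length (V a) = length (V b)" by simp
      show ?thesis
      proof (cases "a \<le> L \<longleftrightarrow> b \<le> L")
        case True
        then show ?thesis using len ab lenV[of a] lenV[of b] mn by (auto split: if_splits)
      next
        case False
        have False if ab: "a \<le> L" "\<not> b \<le> L" "b < 2 * L" "V a = V b" for a b
        proof -
          have "length (V a) = length (V b)" using ab by simp
          then have l: "n - a = m + b - L"
            using ab lenV[of a] lenV[of b] by simp
          then have "take (n - a) u = take (n - a) w"
            using ab by (simp add: V_def)
          moreover have "m < n - a" using l ab mn by linarith
          ultimately show False using diverge by blast
        qed
        then show ?thesis using False ab eq by (metis lessThan_iff)
      qed
    qed
  qed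
  have butlast_take: "butlast (take (Suc l) v) = take l v" if "l < length v" for l and v :: vertex
    using that by (simp add: butlast_take)
  have ends_E: "{wire n (butlast (E k)), wire n (E k)} = {wire n (V k), wire n (V (Suc k mod (2 * L)))}"
    if k: "k < 2 * L" for k
  proof (cases "k < L")
    case True
    then have "Suc k mod (2 * L) = Suc k" using mn by simp
    moreover have "E k = V k" using True by (simp add: E_def V_def)
    moreover have "butlast (E k) = V (Suc k)"
      using True mn uw butlast_take[of "n - Suc k" u] by (simp add: E_def V_def Suc_diff_Suc)
    ultimately show ?thesis by auto
  next
    case False
    have "butlast (E k) = take (m + k - L) w"
      using False k mn uw butlast_take[of "m + k - L" w] by (simp add: E_def)
    also have "\<dots> = V k"
    proof (cases "k = L")
      case True
      then have "m + k - L = m" "n - k = m" using mn by auto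
      then show ?thesis using True take_m by (simp add: V_def)
    qed (use False in \<open>simp add: V_def\<close>)
    finally have 1: "butlast (E k) = V k" .
    have "wire n (E k) = wire n (V (Suc k mod (2 * L)))"
    proof (cases "Suc k = 2 * L")
      case True
      then have "m + k - L + 1 = n" using False mn by linarith
      then have "length (E k) = n" using False uw by (simp add: E_def)
      moreover have "V 0 = u" using uw by (simp add: V_def)
      ultimately show ?thesis using True uw by (simp add: wire_def)
    next
      case False2: False
      then have "Suc k mod (2 * L) = Suc k" using k by simp
      then show ?thesis using False by (simp add: E_def V_def Suc_diff_le)
    qed
    with 1 show ?thesis by simp
  qed
  have "is_cycle (open_subgraph (wired_tree n d) f)
      (map (\<lambda>k. wire n (V k)) [0..<2 * L]) (map E [0..<2 * L])"
    unfolding is_cycle_def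
  proof (intro conjI)
    show "set (map (\<lambda>k. wire n (V k)) [0..<2 * L]) \<subseteq> verts (open_subgraph (wired_tree n d) f)"
      using verts_taken uw by (auto simp: V_def)
    have "E k \<noteq> []" "length (E k) \<le> n" "f (E k)" "E k \<in> tree_verts d" if "k < 2 * L" for k
    proof -
      show "f (E k)"
        unfolding E_def using mn that
        by (auto intro!: open_u open_w)
      have "length (E k) > 0" using lenE[OF that] mn that by auto
      then show "E k \<noteq> []" by auto
      show "length (E k) \<le> n" "E k \<in> tree_verts d"
        using uw verts_taken by (auto simp: E_def)
    qed
    then show "set (map E [0..<2 * L]) \<subseteq> edges (open_subgraph (wired_tree n d) f)"
      by auto
  qed (use mn inj_E inj_V ends_E in \<open>auto simp: distinct_map lessThan_atLeast0\<close>)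
  then show ?thesis by (auto simp: is_forest_def)
qed

text \<open>
  Where a cycle passes a vertex it uses two edges; without loops these are different.
\<close>

lemma cycle_second_edge:
  assumes c: "is_cycle G vs es" and e: "e \<in> set es" and v: "v \<in> ends G e"
    and noloop: "\<And>e. e \<in> edges G \<Longrightarrow> card (ends G e) = 2"
  obtains e' where "e' \<in> set es" "e' \<noteq> e" "v \<in> ends G e'"
proof -
  let ?k = "length vs"
  have len: "length es = ?k" and dist: "distinct es" and ne: "vs \<noteq> []" "es \<noteq> []"
    and ends: "\<And>i. i < ?k \<Longrightarrow> ends G (es ! i) = {vs ! i, vs ! (Suc i mod ?k)}"
    and sub: "set es \<subseteq> edges G"
    using c unfolding is_cycle_def by auto
  obtain i where i: "i < ?k" "e = es ! i" using e len by (metis in_set_conv_nth)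
  have k2: "2 \<le> ?k"
  proof (rule ccontr)
    assume "\<not> 2 \<le> ?k"
    then have "?k = 1" using ne by (cases ?k) auto
    then have "ends G (es ! 0) = {vs ! 0}" using ends[of 0] by simp
    moreover have "es ! 0 \<in> edges G" using sub ne by auto
    ultimately show False using noloop[of "es ! 0"] by simp
  qed
  obtain j where j: "j < ?k" "v = vs ! j" "j = i \<or> j = Suc i mod ?k"
  proof -
    have "Suc i mod ?k < ?k" using ne by simp
    then show ?thesis using v ends[OF i(1)] i that[of i] that[of "Suc i mod ?k"] by auto
  qed
  show ?thesis
  proof (cases "j = i")
    case True
    define h where "h = (if i = 0 then ?k - 1 else i - 1)"
    have h: "h < ?k" "h \<noteq> i" "Suc h mod ?k = i"
      using i k2 by (auto simp: h_def)
    then have "v \<in> ends G (es ! h)" using ends[of h] j True by simp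
    moreover have "es ! h \<noteq> e" using h i dist len by (simp add: nth_eq_iff_index_eq)
    ultimately show ?thesis using h len by (intro that[of "es ! h"]) auto
  next
    case False
    then have "v \<in> ends G (es ! j)" using ends[of j] j by simp
    moreover have "es ! j \<noteq> e" using False j i dist len by (simp add: nth_eq_iff_index_eq)
    ultimately show ?thesis using j len by (intro that[of "es ! j"]) auto
  qed
qed

text \<open>
  At the lower endpoint of any edge of the cycle, unless this is the boundary, the second edge of the cycle
  leads further down; so the cycle contains a descending path from each of its edges to the boundary. At the
  upper endpoint of a highest edge of the cycle the second edge leads downwards as well, and the two descents
  form a fork.
\<close>

lemma cycle_imp_fork:
  assumes "\<not> is_forest (open_subgraph (wired_tree n d) f)"
  shows "\<exists>z i x j y. fork d n f z i x j y"
proof -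
  let ?G = "open_subgraph (wired_tree n d) f"
  obtain vs es where c: "is_cycle ?G vs es"
    using assms by (auto simp: is_forest_def)
  have sub: "\<And>e. e \<in> set es \<Longrightarrow> e \<in> tree_verts d \<and> e \<noteq> [] \<and> length e \<le> n \<and> f e"
    using c by (auto simp: is_cycle_def)
  have ne: "es \<noteq> []" using c by (auto simp: is_cycle_def)
  have noloop: "card (ends ?G e) = 2" if "e \<in> edges ?G" for e
  proof -
    have "length (butlast e) < length e" "length e \<le> n" using that by (auto simp: wire_def)
    then have "wire n (butlast e) \<noteq> wire n e" by (auto simp: wire_def dest: arg_cong[where f = length])
    then show ?thesis by simp
  qed
  \<comment> \<open>the cycle leaves an inner vertex by an edge other than the one by which it arrives\<close>
  have other: "\<exists>e'\<in>set es. e' \<noteq> e \<and> (e' = v \<or> (\<exists>k. e' = v @ [k]))"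
    if e: "e \<in> set es" and v: "v = e \<or> v = butlast e" and "length v < n" for e v
  proof -
    have "Some v \<in> ends ?G e" using v \<open>length v < n\<close> by (auto simp: wire_def)
    from cycle_second_edge[OF c e this noloop] obtain e' where
      e': "e' \<in> set es" "e' \<noteq> e" "Some v \<in> ends ?G e'" by metis
    then have "v = e' \<or> v = butlast e'" by (auto simp: wire_def split: if_splits)
    moreover have "e' \<noteq> []" using sub e' by auto
    ultimately have "e' = v \<or> (\<exists>k. e' = v @ [k])"
      by (metis append_butlast_last_id)
    with e' show ?thesis by blast
  qed
  have down: "\<exists>x. e @ x \<in> tree_verts d \<and> length (e @ x) = n \<and> open_below f e x" if "e \<in> set es" for e
    using that
  proof (induction "n - length e" arbitrary: e)
    case 0
    then show ?case using sub[of e] by (intro exI[of _ "[]"]) auto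
  next
    case (Suc m)
    then have "length e < n" by simp
    from other[OF Suc.prems _ this, of] obtain k where k: "e @ [k] \<in> set es" by auto
    have "m = n - length (e @ [k])" using Suc by simp
    from Suc.hyps(1)[OF this k] obtain x where
      "(e @ [k]) @ x \<in> tree_verts d" "length ((e @ [k]) @ x) = n" "open_below f (e @ [k]) x" by blast
    then show ?case using sub[OF k] by (intro exI[of _ "k # x"]) (auto simp: open_below_Cons)
  qed
  \<comment> \<open>the fork is at the upper endpoint of an edge of the cycle that is closest to the root\<close>
  obtain e where e: "e \<in> set es" "\<And>e'. e' \<in> set es \<Longrightarrow> length e \<le> length e'"
    using ex_has_least_nat[of "\<lambda>e. e \<in> set es" "hd es" length] ne by auto
  define z where "z = butlast e"
  define i where "i = last e"
  have ez: "e = z @ [i]" using sub[OF e(1)] by (simp add: z_def i_def)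
  then have "length z < n" using sub[OF e(1)] by simp
  from other[OF e(1) _ this] obtain e' where
    e': "e' \<in> set es" "e' \<noteq> e" "e' = z \<or> (\<exists>k. e' = z @ [k])" by (auto simp: z_def)
  then obtain j where j: "e' = z @ [j]" using e(2)[OF e'(1)] ez by auto
  obtain x where "e @ x \<in> tree_verts d" "length (e @ x) = n" "open_below f e x"
    using down[OF e(1)] by blast
  moreover obtain y where "e' @ y \<in> tree_verts d" "length (e' @ y) = n" "open_below f e' y"
    using down[OF e'(1)] by blast
  ultimately have "fork d n f z i x j y"
    using sub[OF e(1)] sub[OF e'(1)] e'(2) unfolding fork_def ez j by (auto simp: open_below_Cons)
  then show ?thesis by blast
qed

lemma is_forest_wired_tree: "is_forest (open_subgraph (wired_tree n d) f) \<longleftrightarrow> fork_free d n f"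
  unfolding fork_free_iff using fork_imp_cycle cycle_imp_fork by metis


section \<open>A recursion for the weights of the gas\<close>

lemma measurable_product_field_reindex:
  "(\<lambda>X i. X (t i)) \<in> product_field \<mu> \<rightarrow>\<^sub>M product_field \<nu>"
  unfolding product_field_def[of \<nu>] by (rule measurable_PiM_single') auto

lemma pred_product_field_reindex:
  "Measurable.pred (product_field \<nu>) E \<Longrightarrow> Measurable.pred (product_field \<mu>) (\<lambda>X. E (\<lambda>i. X (t i)))"
  by (rule measurable_compose[OF measurable_product_field_reindex])

lemma determined_by_reindex:
  assumes "determined_by J E"
  shows "determined_by (t ` J) (\<lambda>X. E (\<lambda>i. X (t i)))"
  by (rule determined_byI, rule determined_byD[OF assms]) blast

lemma prob_product_field_eq: "measure (product_field \<mu>) {X. X i = a} = pmf (\<mu> i) a"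
  using prob_product_field_component[of \<mu> i "{a}"] by (simp add: measure_pmf_single)

lemma prob_finite_partition:
  assumes "finite S" and "\<And>i. i \<in> S \<Longrightarrow> Measurable.pred (product_field \<mu>) (E i)"
    and "\<And>i j X. i \<in> S \<Longrightarrow> j \<in> S \<Longrightarrow> E i X \<Longrightarrow> E j X \<Longrightarrow> i = j"
  shows "measure (product_field \<mu>) {X. \<exists>i\<in>S. E i X} = (\<Sum>i\<in>S. measure (product_field \<mu>) {X. E i X})"
proof -
  interpret prob_space "product_field \<mu>" by simp
  have "{X. \<exists>i\<in>S. E i X} = (\<Union>i\<in>S. {X. E i X})" by auto
  then show ?thesis
    using assms by (simp only:) (rule finite_measure_finite_Union; auto simp: disjoint_family_on_def)
qed

lemma prob_bool_partition:
  assumes [measurable]: "Measurable.pred (product_field \<mu>) E" "Measurable.pred (product_field \<mu>) B"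
  shows "measure (product_field \<mu>) {X. E X} =
    measure (product_field \<mu>) {X. B X \<and> E X} + measure (product_field \<mu>) {X. \<not> B X \<and> E X}"
proof -
  have "{X. E X} = {X. \<exists>b\<in>UNIV. B X = b \<and> E X}" by auto
  also have "measure (product_field \<mu>) \<dots> = (\<Sum>b\<in>UNIV. measure (product_field \<mu>) {X. B X = b \<and> E X})"
    by (rule prob_finite_partition) auto
  finally show ?thesis by (simp add: UNIV_bool)
qed

abbreviation bernoulli_field :: "real \<Rightarrow> (vertex \<Rightarrow> bool) measure" where
  "bernoulli_field p \<equiv> product_field (\<lambda>_. bernoulli_pmf p)"

text \<open>
  The link between the finite sums that define the gas and probabilities in the infinite product field.
\<close>

lemma prob_finite_determined:
  assumes "finite E" and "determined_by E Q"
  shows "measure (product_field \<mu>) {X. Q X} =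
    (\<Sum>f\<in>E \<rightarrow>\<^sub>E (UNIV :: bool set). if Q f then \<Prod>e\<in>E. pmf (\<mu> e) (f e) else 0)"
proof -
  have *: "{X. Q X} = {X. \<exists>f\<in>{f \<in> E \<rightarrow>\<^sub>E UNIV. Q f}. \<forall>e\<in>E. X e = f e}"
  proof safe
    fix X assume "Q X"
    moreover have "Q (restrict X E) = Q X" by (rule determined_byD[OF assms(2)]) simp
    ultimately show "\<exists>f\<in>{f \<in> E \<rightarrow>\<^sub>E UNIV. Q f}. \<forall>e\<in>E. X e = f e"
      by (intro bexI[of _ "restrict X E"]) auto
  next
    fix X f assume "Q f" "\<forall>e\<in>E. X e = f e"
    then show "Q X" using determined_byD[OF assms(2), of X f] by auto
  qed
  have "measure (product_field \<mu>) {X. Q X} =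
      (\<Sum>f\<in>{f \<in> E \<rightarrow>\<^sub>E UNIV. Q f}. measure (product_field \<mu>) {X. \<forall>e\<in>E. X e = f e})"
    unfolding *
  proof (rule prob_finite_partition)
    show "finite {f \<in> E \<rightarrow>\<^sub>E (UNIV :: bool set). Q f}" using assms by (simp add: finite_PiE)
    show "Measurable.pred (product_field \<mu>) (\<lambda>X. \<forall>e\<in>E. X e = f e)" for f
      using assms by measurable
    show "f = g" if "f \<in> {f \<in> E \<rightarrow>\<^sub>E UNIV. Q f}" "g \<in> {f \<in> E \<rightarrow>\<^sub>E UNIV. Q f}"
      "\<forall>e\<in>E. X e = f e" "\<forall>e\<in>E. X e = g e" for f g X
      using that by (intro PiE_ext[of f E "\<lambda>_. UNIV" g]) auto
  qed
  also have "\<dots> = (\<Sum>f\<in>{f \<in> E \<rightarrow>\<^sub>E UNIV. Q f}. \<Prod>e\<in>E. pmf (\<mu> e) (f e))"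
  proof (rule sum.cong)
    fix f
    have "measure (product_field \<mu>) {X. \<forall>e\<in>E. X e = f e} =
        (\<Prod>e\<in>E. measure (product_field \<mu>) {X. X e = f e})"
      using assms by (intro prob_disjoint_blocks[where J = "\<lambda>e. {e}"]) (auto simp: determined_by_def)
    then show "measure (product_field \<mu>) {X. \<forall>e\<in>E. X e = f e} = (\<Prod>e\<in>E. pmf (\<mu> e) (f e))"
      by (simp add: prob_product_field_eq)
  qed simp
  also have "\<dots> = (\<Sum>f\<in>E \<rightarrow>\<^sub>E UNIV. if Q f then \<Prod>e\<in>E. pmf (\<mu> e) (f e) else 0)"
    using assms by (intro sum.mono_neutral_cong_left) (auto simp: finite_PiE)
  finally show ?thesis .
qed

text \<open>
  Cylinder events \<open>agrees F \<eta>\<close> split along the branches at the root into a condition on each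
  child edge (\<open>edge_allows\<close>) and a cylinder event in each branch
  (\<open>agrees_iff_branches\<close>).
\<close>

definition agrees :: "vertex set \<Rightarrow> (vertex \<Rightarrow> bool) \<Rightarrow> (vertex \<Rightarrow> bool) \<Rightarrow> bool" where
  "agrees F \<eta> f \<longleftrightarrow> (\<forall>e\<in>F. f e = \<eta> e)"

definition branch :: "vertex set \<Rightarrow> nat \<Rightarrow> vertex set" where
  "branch F i = {e. e \<noteq> [] \<and> i # e \<in> F}"

definition edge_allows :: "vertex set \<Rightarrow> (vertex \<Rightarrow> bool) \<Rightarrow> nat \<Rightarrow> bool \<Rightarrow> bool" where
  "edge_allows F \<eta> i b \<longleftrightarrow> ([i] \<in> F \<longrightarrow> b = \<eta> [i])"

lemma agrees_empty [simp]: "agrees {} \<eta> f"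
  by (simp add: agrees_def)

lemma branch_empty [simp]: "branch {} i = {}"
  by (simp add: branch_def)

lemma edge_allows_empty [simp]: "edge_allows {} \<eta> i b"
  by (simp add: edge_allows_def)

lemma branch_tree_edges: "F \<subseteq> tree_edges d \<Longrightarrow> branch F i \<subseteq> tree_edges d"
  by (auto simp: branch_def)

lemma agrees_iff_branches:
  assumes "F \<subseteq> tree_edges d"
  shows "agrees F \<eta> f \<longleftrightarrow>
    (\<forall>i<d. edge_allows F \<eta> i (f [i]) \<and> agrees (branch F i) (\<lambda>e. \<eta> (i # e)) (\<lambda>e. f (i # e)))"
proof
  assume R: "\<forall>i<d. edge_allows F \<eta> i (f [i]) \<and> agrees (branch F i) (\<lambda>e. \<eta> (i # e)) (\<lambda>e. f (i # e))"
  show "agrees F \<eta> f"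
    unfolding agrees_def
  proof
    fix e assume e: "e \<in> F"
    then obtain i e' where "e = i # e'" "i < d" using assms by (cases e) auto
    then show "f e = \<eta> e"
      using R e by (cases "e' = []") (auto simp: edge_allows_def agrees_def branch_def)
  qed
qed (auto simp: agrees_def edge_allows_def branch_def)

lemma determined_by_agrees: "[] \<notin> F \<Longrightarrow> determined_by {e. e \<noteq> []} (agrees F \<eta>)"
  unfolding determined_by_def agrees_def by (metis mem_Collect_eq)

lemma pred_agrees [measurable]: "Measurable.pred (product_field \<mu>) (agrees F \<eta>)"
  unfolding agrees_def by measurable

lemma hits_boundary_cong:
  "(\<And>e. e \<in> tree_edges d \<Longrightarrow> length e \<le> n \<Longrightarrow> f e = g e) \<Longrightarrow> hits_boundary d n f = hits_boundary d n g"
proof (induction n arbitrary: f g)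
  case (Suc n)
  have "hits_boundary d n (\<lambda>e. f (i # e)) = hits_boundary d n (\<lambda>e. g (i # e))" if "i < d" for i
    using that by (intro Suc.IH Suc.prems) auto
  moreover have "f [i] = g [i]" if "i < d" for i
    using that by (intro Suc.prems) auto
  ultimately show ?case by (auto simp: hits_boundary.simps)
qed simp

lemma fork_free_cong:
  "(\<And>e. e \<in> tree_edges d \<Longrightarrow> length e \<le> n \<Longrightarrow> f e = g e) \<Longrightarrow> fork_free d n f = fork_free d n g"
proof (induction n arbitrary: f g)
  case (Suc n)
  have "fork_free d n (\<lambda>e. f (i # e)) = fork_free d n (\<lambda>e. g (i # e))" if "i < d" for i
    using that by (intro Suc.IH Suc.prems) auto
  moreover have "hits_boundary d n (\<lambda>e. f (i # e)) = hits_boundary d n (\<lambda>e. g (i # e))" if "i < d" for i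
    using that by (intro hits_boundary_cong Suc.prems) auto
  moreover have "f [i] = g [i]" if "i < d" for i
    using that by (intro Suc.prems) auto
  ultimately show ?case by (auto simp: fork_free.simps)
qed simp

lemma pred_hits_boundary:
  "(\<And>e. Measurable.pred M (\<lambda>X. f X e)) \<Longrightarrow> Measurable.pred M (\<lambda>X. hits_boundary d n (f X))"
proof (induction n arbitrary: f)
  case (Suc n)
  note [measurable] = Suc.prems Suc.IH[OF Suc.prems]
  show ?case unfolding hits_boundary.simps by measurable
qed simp

lemma pred_fork_free:
  "(\<And>e. Measurable.pred M (\<lambda>X. f X e)) \<Longrightarrow> Measurable.pred M (\<lambda>X. fork_free d n (f X))"
proof (induction n arbitrary: f)
  case (Suc n)
  note [measurable] = Suc.prems Suc.IH[OF Suc.prems] pred_hits_boundary[OF Suc.prems]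
  show ?case unfolding fork_free.simps by measurable
qed simp

lemmas [measurable] = pred_hits_boundary[where f = "\<lambda>X. X", OF measurable_product_field_component]
  pred_fork_free[where f = "\<lambda>X. X", OF measurable_product_field_component]

text \<open>
  The weight of a cylinder event of forests, split by the bit that the rest of the tree can see. It is taken
  in the Bernoulli field on all words, so that the configurations in the branches are shifts of the whole one.
\<close>

definition wired_weight :: "nat \<Rightarrow> real \<Rightarrow> nat \<Rightarrow> bool \<Rightarrow> vertex set \<Rightarrow> (vertex \<Rightarrow> bool) \<Rightarrow> real" where
  "wired_weight d p n b F \<eta> =
     measure (bernoulli_field p) {f. fork_free d n f \<and> hits_boundary d n f = b \<and> agrees F \<eta> f}"

lemma gas_weight_wired_tree:
  fixes n d :: nat
  assumes "0 \<le> p" "p \<le> 1"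
  defines "E \<equiv> {e \<in> tree_edges d. length e \<le> n}"
  shows "gas_weight (wired_tree n d) p f =
    (if fork_free d n f then \<Prod>e\<in>E. pmf (bernoulli_pmf p) (f e) else 0)"
proof -
  have fin: "finite E"
    unfolding E_def by (rule finite_subset[OF _ finite_lists_length_le[of "{..<d}" n]])
      (auto simp: tree_verts_def)
  have "(\<Prod>e\<in>E. pmf (bernoulli_pmf p) (f e)) = (\<Prod>e\<in>E. if f e then p else 1 - p)"
    using assms by (intro prod.cong) auto
  also have "\<dots> = p ^ card {e \<in> E. f e} * (1 - p) ^ card {e \<in> E. \<not> f e}"
    using fin by (simp add: prod.If_cases Int_def Collect_neg_eq)
  finally show ?thesis
    unfolding gas_weight_def is_forest_wired_tree
    by (simp add: wired_tree_def E_def conj_assoc)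
qed

lemma wired_weight_add:
  "wired_weight d p n True F \<eta> + wired_weight d p n False F \<eta> =
    measure (bernoulli_field p) {f. fork_free d n f \<and> agrees F \<eta> f}"
proof -
  have "measure (bernoulli_field p) {f. fork_free d n f \<and> agrees F \<eta> f} =
    measure (bernoulli_field p) {f. hits_boundary d n f \<and> (fork_free d n f \<and> agrees F \<eta> f)} +
    measure (bernoulli_field p) {f. \<not> hits_boundary d n f \<and> (fork_free d n f \<and> agrees F \<eta> f)}"
    by (rule prob_bool_partition) measurable
  then show ?thesis
    unfolding wired_weight_def
    by (simp add: conj_ac)
qed

text \<open>
  The weight \<open>p ^ o * (1 - p) ^ c\<close> is the Bernoulli probability of a configuration, so the gas is
  Bernoulli percolation conditioned to be a forest.
\<close>

lemma prob_arboreal_gas_wired: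
  assumes "0 \<le> p" "p \<le> 1" and F: "F \<subseteq> tree_edges d" "\<And>e. e \<in> F \<Longrightarrow> length e \<le> n"
  shows "\<P>(f in arboreal_gas (wired_tree n d) p. \<forall>e\<in>F. f e = \<eta> e) =
    (wired_weight d p n True F \<eta> + wired_weight d p n False F \<eta>) /
    (wired_weight d p n True {} \<eta> + wired_weight d p n False {} \<eta>)"
proof -
  define E where "E = {e \<in> tree_edges d. length e \<le> n}"
  have fin: "finite E"
    unfolding E_def by (rule finite_subset[OF _ finite_lists_length_le[of "{..<d}" n]])
      (auto simp: tree_verts_def)
  have E: "edges (wired_tree n d) = E" by (simp add: wired_tree_def E_def)
  let ?w = "gas_weight (wired_tree n d) p"
  have w: "?w f = (if fork_free d n f then \<Prod>e\<in>E. pmf (bernoulli_pmf p) (f e) else 0)" for f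
    using gas_weight_wired_tree[OF assms(1,2)] by (simp add: E_def)
  have w0: "0 \<le> ?w f" for f by (simp add: w prod_nonneg)
  have sum_w: "(\<Sum>f\<in>E \<rightarrow>\<^sub>E UNIV. if agrees F' \<eta> f then ?w f else 0) =
      wired_weight d p n True F' \<eta> + wired_weight d p n False F' \<eta>" if "F' \<subseteq> F" for F'
  proof -
    have "determined_by E (\<lambda>f. fork_free d n f \<and> agrees F' \<eta> f)"
    proof (rule determined_byI)
      fix X Y :: "vertex \<Rightarrow> bool" assume XY: "\<And>j. j \<in> E \<Longrightarrow> X j = Y j"
      then have "fork_free d n X = fork_free d n Y"
        by (intro fork_free_cong) (auto simp: E_def)
      moreover have "agrees F' \<eta> X = agrees F' \<eta> Y"
      proof -
        have "X e = Y e" if "e \<in> F'" for e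
          using that F \<open>F' \<subseteq> F\<close> by (intro XY) (auto simp: E_def)
        then show ?thesis by (simp add: agrees_def)
      qed
      ultimately show "(fork_free d n X \<and> agrees F' \<eta> X) = (fork_free d n Y \<and> agrees F' \<eta> Y)"
        by simp
    qed
    from prob_finite_determined[OF fin this, of "\<lambda>_. bernoulli_pmf p"] show ?thesis
      unfolding wired_weight_add by (auto simp: w intro!: sum.cong)
  qed
  define Z where "Z = (\<Sum>g\<in>E \<rightarrow>\<^sub>E UNIV. ?w g)"
  have Z: "Z = wired_weight d p n True {} \<eta> + wired_weight d p n False {} \<eta>"
    using sum_w[of "{}"] by (simp add: Z_def)
  have Z0: "0 \<le> Z" unfolding Z_def by (intro sum_nonneg w0)
  let ?A = "{f \<in> E \<rightarrow>\<^sub>E UNIV. agrees F \<eta> f}"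
  have "\<P>(f in arboreal_gas (wired_tree n d) p. \<forall>e\<in>F. f e = \<eta> e) =
      measure (point_measure (E \<rightarrow>\<^sub>E UNIV) (\<lambda>f. ennreal (?w f / Z))) ?A"
    unfolding arboreal_gas_def E Z_def by (simp add: space_point_measure agrees_def)
  also have "\<dots> = (\<Sum>f\<in>?A. ?w f / Z)"
    using fin w0 Z0
    by (simp add: Sigma_Algebra.measure_def emeasure_point_measure_finite finite_PiE sum_nonneg)
  also have "\<dots> = (\<Sum>f\<in>?A. ?w f) / Z"
    by (simp add: sum_divide_distrib)
  also have "(\<Sum>f\<in>?A. ?w f) = (\<Sum>f\<in>E \<rightarrow>\<^sub>E UNIV. if agrees F \<eta> f then ?w f else 0)"
    using fin by (intro sum.mono_neutral_cong_left) (auto simp: finite_PiE)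
  finally show ?thesis using sum_w[of F] Z by simp
qed

lemma prob_child:
  assumes "0 \<le> p" "p \<le> 1"
    and det: "determined_by {e. e \<noteq> []} Q" and m: "Measurable.pred (bernoulli_field p) Q"
  shows "measure (bernoulli_field p) {f. f [i] = b \<and> Q (\<lambda>e. f (i # e))} =
    (if b then p else 1 - p) * measure (bernoulli_field p) {f. Q f}"
proof -
  have "measure (bernoulli_field p) {f. f [i] = b \<and> Q (\<lambda>e. f (i # e))} =
      measure (bernoulli_field p) {f. f [i] = b} * measure (bernoulli_field p) {f. Q (\<lambda>e. f (i # e))}"
  proof (rule prob_two_blocks)
    show "{[i]} \<inter> (#) i ` {e. e \<noteq> []} = {}" by auto
    show "determined_by {[i]} (\<lambda>f. f [i] = b)" by (auto simp: determined_by_def)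
    show "determined_by ((#) i ` {e. e \<noteq> []}) (\<lambda>f. Q (\<lambda>e. f (i # e)))"
      by (rule determined_by_reindex[OF det])
    show "Measurable.pred (bernoulli_field p) (\<lambda>f. Q (\<lambda>e. f (i # e)))"
      by (rule pred_product_field_reindex[OF m])
  qed measurable
  moreover have "measure (bernoulli_field p) {f. Q (\<lambda>e. f (i # e))} = measure (bernoulli_field p) {f. Q f}"
    by (rule prob_product_field_reindex[OF _ _ m]) (auto simp: inj_def)
  ultimately show ?thesis using assms by (simp add: prob_product_field_eq)
qed

text \<open>
  The weight of a branch whose child is not joined to the boundary through its edge: either the edge is open
  and the child itself is not joined, or the edge is closed and the branch is an arbitrary forest.
\<close>

definition loose_factor :: "real \<Rightarrow> (bool \<Rightarrow> real) \<Rightarrow> (bool \<Rightarrow> bool) \<Rightarrow> real" where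
  "loose_factor p w allows =
     of_bool (allows True) * (p * w False) + of_bool (allows False) * ((1 - p) * (w True + w False))"

text \<open>
  The root is not joined to the boundary iff no child is joined through its edge; in a forest it is joined iff
  exactly one child is. The branches are independent.
\<close>

lemma wired_weight_Suc:
  fixes \<eta> :: "vertex \<Rightarrow> bool" and n d :: nat
  assumes p: "0 \<le> p" "p \<le> 1" and F: "F \<subseteq> tree_edges d"
  defines "w \<equiv> \<lambda>i b. wired_weight d p n b (branch F i) (\<lambda>e. \<eta> (i # e))"
  shows "wired_weight d p (Suc n) False F \<eta> = (\<Prod>i<d. loose_factor p (w i) (edge_allows F \<eta> i))" (is ?A)
    and "wired_weight d p (Suc n) True F \<eta> =
      (\<Sum>i<d. of_bool (edge_allows F \<eta> i True) * (p * w i True) *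
         (\<Prod>j\<in>{..<d} - {i}. loose_factor p (w j) (edge_allows F \<eta> j)))" (is ?B)
proof -
  define Q where "Q i f \<longleftrightarrow> fork_free d n f \<and> agrees (branch F i) (\<lambda>e. \<eta> (i # e)) f" for i f
  define H where "H i f \<longleftrightarrow> edge_allows F \<eta> i (f [i]) \<and> Q i (\<lambda>e. f (i # e)) \<and>
      \<not> (f [i] \<and> hits_boundary d n (\<lambda>e. f (i # e)))" for i and f :: "vertex \<Rightarrow> bool"
  define K where "K i f \<longleftrightarrow> edge_allows F \<eta> i (f [i]) \<and> Q i (\<lambda>e. f (i # e)) \<and>
      f [i] \<and> hits_boundary d n (\<lambda>e. f (i # e))" for i and f :: "vertex \<Rightarrow> bool"
  let ?M = "bernoulli_field p"
  have detQ: "determined_by {e. e \<noteq> []} (Q i)" "determined_by {e. e \<noteq> []} (hits_boundary d n)" for i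
  proof -
    have *: "X e = Y e" if "\<And>j. j \<in> {e. e \<noteq> []} \<Longrightarrow> X j = Y j" "e \<in> tree_edges d" for e and X Y :: "vertex \<Rightarrow> bool"
      using that by auto
    show "determined_by {e. e \<noteq> []} (hits_boundary d n)"
      by (rule determined_byI, rule hits_boundary_cong) (rule *)
    have "determined_by {e. e \<noteq> []} (fork_free d n)"
      by (rule determined_byI, rule fork_free_cong) (rule *)
    moreover have "determined_by {e. e \<noteq> []} (agrees (branch F i) (\<lambda>e. \<eta> (i # e)))"
      by (rule determined_by_agrees) (simp add: branch_def)
    ultimately show "determined_by {e. e \<noteq> []} (Q i)"
      unfolding Q_def determined_by_def by metis
  qed
  have mQ [measurable]: "Measurable.pred (product_field \<mu>) (Q i)" for i and \<mu> :: "vertex \<Rightarrow> bool pmf"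
    unfolding Q_def by measurable
  have mQ' [measurable]: "Measurable.pred ?M (\<lambda>f. Q i (\<lambda>e. f (i # e)))" for i
    by (rule pred_product_field_reindex[OF mQ])
  have mh' [measurable]: "Measurable.pred ?M (\<lambda>f. hits_boundary d n (\<lambda>e. f (i # e)))" for i
    by (rule pred_hits_boundary) measurable
  have ma' [measurable]: "Measurable.pred ?M (\<lambda>f. edge_allows F \<eta> i (f [i]))" for i
    unfolding edge_allows_def by measurable
  have mH [measurable]: "Measurable.pred ?M (H i)" "Measurable.pred ?M (K i)" for i
    unfolding H_def K_def by measurable
  have dH: "determined_by (range ((#) i)) (H i)" "determined_by (range ((#) i)) (K i)" for i
    unfolding H_def K_def determined_by_def by simp_all
  have w: "w i b = measure ?M {f. Q i f \<and> hits_boundary d n f = b}" for i b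
    unfolding w_def wired_weight_def Q_def by (simp add: conj_ac)
  have detQh: "determined_by {e. e \<noteq> []} (\<lambda>f. Q i f \<and> hits_boundary d n f = b)" for i b
    using detQ(1)[of i] detQ(2) unfolding determined_by_def by metis
  have PK: "measure ?M {f. K i f} = of_bool (edge_allows F \<eta> i True) * (p * w i True)" for i
  proof (cases "edge_allows F \<eta> i True")
    case True
    then have "{f. K i f} = {f. f [i] = True \<and> (Q i (\<lambda>e. f (i # e)) \<and> hits_boundary d n (\<lambda>e. f (i # e)) = True)}"
      unfolding K_def by auto
    also have "measure ?M \<dots> = p * w i True"
      unfolding w by (subst prob_child[OF p detQh]) simp_all
    finally show ?thesis using True by simp
  next
    case False
    then have e: "{f. K i f} = {}" unfolding K_def by auto
    show ?thesis using False unfolding e by simp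
  qed
  have PH: "measure ?M {f. H i f} = loose_factor p (w i) (edge_allows F \<eta> i)" for i
  proof -
    have "measure ?M {f. H i f} = measure ?M {f. f [i] \<and> H i f} + measure ?M {f. \<not> f [i] \<and> H i f}"
      by (rule prob_bool_partition) measurable
    also have "measure ?M {f. f [i] \<and> H i f} = of_bool (edge_allows F \<eta> i True) * (p * w i False)"
    proof (cases "edge_allows F \<eta> i True")
      case True
      then have "{f. f [i] \<and> H i f} = {f. f [i] = True \<and> (Q i (\<lambda>e. f (i # e)) \<and> hits_boundary d n (\<lambda>e. f (i # e)) = False)}"
        unfolding H_def by auto
      also have "measure ?M \<dots> = p * w i False"
        unfolding w by (subst prob_child[OF p detQh]) simp_all
      finally show ?thesis using True by simp
    next
      case False
      then have e: "{f. f [i] \<and> H i f} = {}" unfolding H_def by auto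
      show ?thesis using False unfolding e by simp
    qed
    also have "measure ?M {f. \<not> f [i] \<and> H i f} =
        of_bool (edge_allows F \<eta> i False) * ((1 - p) * (w i True + w i False))"
    proof (cases "edge_allows F \<eta> i False")
      case True
      then have "{f. \<not> f [i] \<and> H i f} = {f. f [i] = False \<and> Q i (\<lambda>e. f (i # e))}"
        unfolding H_def by auto
      also have "measure ?M \<dots> = (1 - p) * measure ?M {f. Q i f}"
        by (subst prob_child[OF p detQ(1)]) simp_all
      also have "measure ?M {f. Q i f} = w i True + w i False"
        unfolding w by (subst prob_bool_partition[where B = "hits_boundary d n"]) (auto simp: conj_ac)
      finally show ?thesis using True by simp
    next
      case False
      then have e: "{f. \<not> f [i] \<and> H i f} = {}" unfolding H_def by auto
      show ?thesis using False unfolding e by simp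
    qed
    finally show ?thesis by (simp add: loose_factor_def)
  qed
  have "{f. fork_free d (Suc n) f \<and> hits_boundary d (Suc n) f = False \<and> agrees F \<eta> f} = {f. \<forall>i\<in>{..<d}. H i f}"
    unfolding agrees_iff_branches[OF F] H_def Q_def by auto
  then have "wired_weight d p (Suc n) False F \<eta> = measure ?M {f. \<forall>i\<in>{..<d}. H i f}"
    by (simp add: wired_weight_def)
  also have "\<dots> = (\<Prod>i<d. measure ?M {f. H i f})"
    by (rule prob_disjoint_blocks[where J = "\<lambda>i. range ((#) i)"]) (use dH mH in auto)
  finally show ?A by (simp add: PH)
  have "{f. fork_free d (Suc n) f \<and> hits_boundary d (Suc n) f = True \<and> agrees F \<eta> f} =
      {f. \<exists>i\<in>{..<d}. \<forall>j\<in>{..<d}. if j = i then K j f else H j f}"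
  proof (rule Collect_cong)
    fix f :: "vertex \<Rightarrow> bool"
    define c where "c i \<longleftrightarrow> f [i] \<and> hits_boundary d n (\<lambda>e. f (i # e))" for i
    define a where "a i \<longleftrightarrow> edge_allows F \<eta> i (f [i]) \<and> Q i (\<lambda>e. f (i # e))" for i
    have "(fork_free d (Suc n) f \<and> hits_boundary d (Suc n) f = True \<and> agrees F \<eta> f) \<longleftrightarrow>
        (\<forall>i<d. a i) \<and> (\<forall>i<d. \<forall>j<d. c i \<and> c j \<longrightarrow> i = j) \<and> (\<exists>i<d. c i)"
      unfolding agrees_iff_branches[OF F] a_def c_def Q_def fork_free.simps hits_boundary.simps by blast
    also have "\<dots> \<longleftrightarrow> (\<exists>i<d. \<forall>j<d. a j \<and> (c j \<longleftrightarrow> j = i))" (is "?L \<longleftrightarrow> ?R")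
    proof
      assume L: ?L
      then obtain i where i: "i < d" "c i" by blast
      have "a j \<and> (c j \<longleftrightarrow> j = i)" if "j < d" for j
        using L that i by blast
      then show ?R using i by blast
    next
      assume ?R
      then obtain i where i: "i < d" "\<And>j. j < d \<Longrightarrow> a j" "\<And>j. j < d \<Longrightarrow> c j \<longleftrightarrow> j = i" by blast
      then have "\<exists>i<d. c i" by (intro exI[of _ i]) simp
      with i show ?L by simp
    qed
    also have "\<dots> \<longleftrightarrow> (\<exists>i<d. \<forall>j<d. if j = i then K j f else H j f)"
      unfolding a_def c_def H_def K_def by (intro ex_cong1 conj_cong all_cong1 imp_cong refl) auto
    finally show "(fork_free d (Suc n) f \<and> hits_boundary d (Suc n) f = True \<and> agrees F \<eta> f) \<longleftrightarrow>
        (\<exists>i\<in>{..<d}. \<forall>j\<in>{..<d}. if j = i then K j f else H j f)"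
      by (simp only: Bex_def Ball_def lessThan_iff)
  qed
  then have "wired_weight d p (Suc n) True F \<eta> =
      measure ?M {f. \<exists>i\<in>{..<d}. \<forall>j\<in>{..<d}. if j = i then K j f else H j f}"
    by (simp add: wired_weight_def)
  also have "\<dots> = (\<Sum>i<d. measure ?M {f. \<forall>j\<in>{..<d}. if j = i then K j f else H j f})"
  proof (rule prob_finite_partition)
    show "i = j" if "i \<in> {..<d}" "j \<in> {..<d}" "\<forall>k\<in>{..<d}. if k = i then K k X else H k X"
      "\<forall>k\<in>{..<d}. if k = j then K k X else H k X" for i j X
      using that unfolding H_def K_def by (auto split: if_splits)
  qed auto
  also have "\<dots> = (\<Sum>i<d. (measure ?M {f. K i f}) * (\<Prod>j\<in>{..<d} - {i}. measure ?M {f. H j f}))"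
  proof (rule sum.cong)
    fix i assume i: "i \<in> {..<d}"
    have "measure ?M {f. \<forall>j\<in>{..<d}. if j = i then K j f else H j f} =
        (\<Prod>j<d. measure ?M {f. if j = i then K j f else H j f})"
    proof (rule prob_disjoint_blocks[where J = "\<lambda>i. range ((#) i)"])
      show "determined_by (range ((#) j)) (\<lambda>f. if j = i then K j f else H j f)" for j
        using dH by (cases "j = i") simp_all
    qed auto
    also have "\<dots> = measure ?M {f. K i f} * (\<Prod>j\<in>{..<d} - {i}. measure ?M {f. H j f})"
      using i by (subst prod.remove[of _ i]) (auto intro!: prod.cong)
    finally show "measure ?M {f. \<forall>j\<in>{..<d}. if j = i then K j f else H j f} =
        measure ?M {f. K i f} * (\<Prod>j\<in>{..<d} - {i}. measure ?M {f. H j f})" .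
  qed simp
  finally show ?B by (simp add: PK PH)
qed


section \<open>Limits of the cylinder probabilities\<close>

text \<open>
  The limit of the iteration of \<open>r \<mapsto> d p r / (1 + (d - 1) p r)\<close> from \<open>1\<close>,
  that is, the largest fixed point of this map in the unit interval.
\<close>

definition survival_prob :: "nat \<Rightarrow> real \<Rightarrow> real" where
  "survival_prob d p = (if p \<le> 1 / real d then 0 else (real d * p - 1) / (p * (real d - 1)))"

lemma survival_prob_fixed_point:
  assumes "2 \<le> d" "0 \<le> p" "p < 1"
  defines "q \<equiv> survival_prob d p"
  shows "0 \<le> q" "q < 1" "q * (1 + (real d - 1) * p * q) = real d * p * q"
    and "p \<le> 1 / real d \<Longrightarrow> q = 0" and "1 / real d < p \<Longrightarrow> (real d - 1) * p * q = real d * p - 1"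
    and "1 / real d < p \<Longrightarrow> 0 < q"
proof -
  have d: "real d \<ge> 2" using assms by simp
  have super: "0 < p" "1 < real d * p" if "1 / real d < p"
  proof -
    have "0 < 1 / real d" using d by simp
    with that show "0 < p" by linarith
    show "1 < real d * p" using that d by (simp add: field_simps)
  qed
  show *: "p \<le> 1 / real d \<Longrightarrow> q = 0" by (simp add: q_def survival_prob_def)
  show **: "(real d - 1) * p * q = real d * p - 1" if "1 / real d < p"
    using super[OF that] that d by (simp add: q_def survival_prob_def)
  show pos: "0 < q" if "1 / real d < p"
    using super[OF that] that d by (simp add: q_def survival_prob_def)
  show "0 \<le> q" using * pos by (cases "p \<le> 1 / real d") auto
  show "q < 1"
  proof (cases "p \<le> 1 / real d")
    case False
    then have "p > 0" using super by simp
    moreover have "real d * p - 1 < p * (real d - 1)" using assms(3) by (simp add: algebra_simps)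
    ultimately show ?thesis using False d by (simp add: q_def survival_prob_def)
  qed (use * in simp)
  show "q * (1 + (real d - 1) * p * q) = real d * p * q"
    using * ** by (cases "p \<le> 1 / real d") auto
qed

text \<open>
  The sequence decreases and stays above the fixed point, so it converges to a fixed point that is not below
  it; there is no larger one.
\<close>

lemma mobius_iteration_limit:
  fixes r :: "nat \<Rightarrow> real"
  assumes d: "2 \<le> d" and p: "0 \<le> p" "p < 1"
    and r0: "r 0 = 1" and r_Suc: "\<And>n. r (Suc n) = real d * p * r n / (1 + (real d - 1) * p * r n)"
  shows "r \<longlonglongrightarrow> survival_prob d p" and "\<And>n. 0 \<le> r n" and "\<And>n. r n \<le> 1"
proof -
  define q where "q = survival_prob d p"
  note q = survival_prob_fixed_point[OF d p, folded q_def]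
  have d2: "real d \<ge> 2" using d by simp
  let ?D = "\<lambda>x. 1 + (real d - 1) * p * x"
  have D: "?D x \<ge> 1" if "0 \<le> x" for x using that d2 p by simp
  have inv: "q \<le> r n \<and> r (Suc n) \<le> r n" for n
  proof (induction n)
    case 0
    have "real d * p \<le> ?D 1" using p by (simp add: algebra_simps)
    then show ?case using q r0 D[of 1] by (simp add: r_Suc)
  next
    case (Suc n)
    then have rn: "q \<le> r n" "0 \<le> r n" using q(1) by auto
    have "real d * p * q = q * ?D q" using q(3) by metis
    have "q * ?D (r n) \<le> real d * p * r n"
    proof -
      have "real d * p - (real d - 1) * p * q \<ge> 0"
      proof (cases "p \<le> 1 / real d")
        case False
        then show ?thesis using q(5) by simp
      qed (use q(4) p d2 in simp)
      then have "(real d * p - (real d - 1) * p * q) * (r n - q) \<ge> 0"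
        using rn by simp
      then show ?thesis using q(3) by (simp add: algebra_simps)
    qed
    then have 1: "q \<le> r (Suc n)"
      using D[OF rn(2)] by (simp add: r_Suc pos_le_divide_eq)
    then have rS: "0 \<le> r (Suc n)" using q(1) by simp
    have "real d * p \<le> ?D (r (Suc n))"
    proof (cases "p \<le> 1 / real d")
      case True
      then have "real d * p \<le> 1" using d2 by (simp add: field_simps)
      then show ?thesis using D[OF rS] by linarith
    next
      case False
      then have "real d * p = ?D q" using q(5) by simp
      also have "\<dots> \<le> ?D (r (Suc n))" using 1 d2 p by (simp add: mult_left_mono)
      finally show ?thesis .
    qed
    then have "real d * p * r (Suc n) \<le> ?D (r (Suc n)) * r (Suc n)"
      using rS by (rule mult_right_mono)
    then have "r (Suc (Suc n)) \<le> r (Suc n)"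
      using D[OF rS] by (simp add: r_Suc[of "Suc n"] pos_divide_le_eq mult.commute)
    with 1 show ?case by simp
  qed
  have dec: "decseq r" using inv by (intro decseq_SucI) auto
  show nonneg: "\<And>n. 0 \<le> r n" using inv q(1) by (meson order_trans)
  show "\<And>n. r n \<le> 1" using decseqD[OF dec, of 0] r0 by simp
  obtain L where L: "r \<longlonglongrightarrow> L" "\<And>n. L \<le> r n"
    using decseq_convergent[OF dec, of q] inv by auto
  have Lq: "q \<le> L" using inv by (intro LIMSEQ_le_const[OF L(1)]) auto
  then have L0: "0 \<le> L" using q(1) by simp
  have "(\<lambda>n. r (Suc n)) \<longlonglongrightarrow> real d * p * L / ?D L"
    unfolding r_Suc using D[OF L0] by (intro tendsto_intros L) auto
  then have "L = real d * p * L / ?D L"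
    using LIMSEQ_unique LIMSEQ_Suc[OF L(1)] by blast
  then have fix_L: "L * ?D L = real d * p * L" using D[OF L0] by (simp add: field_simps)
  have "L = q"
  proof (cases "L = 0")
    case False
    then have DL: "?D L = real d * p" using fix_L by simp
    have "1 / real d < p"
    proof (rule ccontr)
      assume "\<not> 1 / real d < p"
      then have "real d * p \<le> 1" using d2 by (simp add: field_simps)
      then have "(real d - 1) * p * L \<le> 0" using DL by simp
      moreover have "(real d - 1) * p * L \<ge> 0" using d2 p L0 by simp
      ultimately have "p = 0" using d2 False by simp
      then show False using DL by simp
    qed
    then have "(real d - 1) * p * L = (real d - 1) * p * q" using q(5) DL by simp
    moreover have "p \<noteq> 0" using \<open>?D L = real d * p\<close> by auto
    ultimately show ?thesis using d2 by simp
  qed (use Lq q(1) in simp)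
  then show "r \<longlonglongrightarrow> survival_prob d p" using L by (simp add: q_def)
qed

text \<open>
  The ratio of the total weight at height \<open>n + 1\<close> to the \<open>d\<close>-th power of the total
  weight at height \<open>n\<close>, as a function of the probability \<open>r\<close> of being joined to the
  boundary at height \<open>n\<close>.
\<close>

definition gas_normalizer :: "nat \<Rightarrow> real \<Rightarrow> real \<Rightarrow> real" where
  "gas_normalizer d p r = (1 - p * r) ^ (d - 1) * (1 + (real d - 1) * p * r)"

definition wired_ratio :: "nat \<Rightarrow> real \<Rightarrow> nat \<Rightarrow> bool \<Rightarrow> vertex set \<Rightarrow> (vertex \<Rightarrow> bool) \<Rightarrow> real" where
  "wired_ratio d p n b F \<eta> = wired_weight d p n b F \<eta> /
     (wired_weight d p n True {} \<eta> + wired_weight d p n False {} \<eta>)"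

lemma wired_weight_empty: "wired_weight d p n b {} \<eta> = wired_weight d p n b {} (\<lambda>_. False)"
  by (simp add: wired_weight_def)

lemma wired_weight_0:
  "wired_weight d p 0 True {} \<eta> = 1" "wired_weight d p 0 False {} \<eta> = 0"
  using prob_space.prob_space[OF prob_space_product_field[of "\<lambda>_::vertex. bernoulli_pmf p"]]
  by (simp_all add: wired_weight_def)

lemma loose_factor_scale: "loose_factor p (\<lambda>b. c * w b) a = c * loose_factor p w a"
  by (simp add: loose_factor_def algebra_simps)

text \<open>
  Dividing the recursion for the weights by the \<open>d\<close>-th power of the total weight leaves
  coefficients that depend on the height only through \<open>r n\<close>.
\<close>

lemma wired_ratio_Suc:
  assumes d: "2 \<le> d" and p: "0 \<le> p" "p < 1"
  defines "r \<equiv> \<lambda>n. wired_ratio d p n True {} (\<lambda>_. False)"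
  shows "0 < wired_weight d p n True {} \<eta> + wired_weight d p n False {} \<eta>"
    and "r (Suc n) = real d * p * r n / (1 + (real d - 1) * p * r n)"
    and "\<And>F \<eta>. F \<subseteq> tree_edges d \<Longrightarrow> wired_ratio d p (Suc n) False F \<eta> =
      (\<Prod>i<d. loose_factor p (\<lambda>b. wired_ratio d p n b (branch F i) (\<lambda>e. \<eta> (i # e))) (edge_allows F \<eta> i)) /
      gas_normalizer d p (r n)"
    and "\<And>F \<eta>. F \<subseteq> tree_edges d \<Longrightarrow> wired_ratio d p (Suc n) True F \<eta> =
      (\<Sum>i<d. of_bool (edge_allows F \<eta> i True) * (p * wired_ratio d p n True (branch F i) (\<lambda>e. \<eta> (i # e))) *
        (\<Prod>j\<in>{..<d} - {i}. loose_factor p (\<lambda>b. wired_ratio d p n b (branch F j) (\<lambda>e. \<eta> (j # e)))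
           (edge_allows F \<eta> j))) / gas_normalizer d p (r n)"
proof -
  define A where "A n = wired_weight d p n False {} (\<lambda>_. False)" for n
  define B where "B n = wired_weight d p n True {} (\<lambda>_. False)" for n
  define Z where "Z n = B n + A n" for n
  have AB0: "0 \<le> A n" "0 \<le> B n" for n by (simp_all add: A_def B_def wired_weight_def)
  have p': "p \<le> 1" using p by simp
  have Z: "wired_weight d p n True {} \<eta> + wired_weight d p n False {} \<eta> = Z n" for n \<eta>
    by (simp add: Z_def A_def B_def wired_weight_empty[of _ _ _ _ \<eta>])
  define g where "g n = p * A n + (1 - p) * Z n" for n
  have loose: "loose_factor p (\<lambda>b. wired_weight d p n b {} \<zeta>) (edge_allows {} \<zeta>' i) = g n" for n i \<zeta> \<zeta>'
    by (simp add: loose_factor_def g_def Z_def A_def B_def wired_weight_empty[of _ _ _ _ \<zeta>])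
  have A_Suc: "A (Suc n) = g n ^ d" for n
    unfolding A_def by (subst wired_weight_Suc[OF p(1) p']) (simp_all add: loose)
  have B_Suc: "B (Suc n) = real d * p * B n * g n ^ (d - 1)" for n
    unfolding B_def by (subst wired_weight_Suc[OF p(1) p']) (simp_all add: loose)
  have Zpos: "0 < Z n" for n
  proof (induction n)
    case 0
    show ?case by (simp add: Z_def A_def B_def wired_weight_0)
  next
    case (Suc n)
    then have "0 < g n" using p AB0[of n] by (simp add: g_def add_nonneg_pos)
    then have "0 < A (Suc n)" by (simp add: A_Suc)
    then show ?case using AB0[of "Suc n"] by (simp add: Z_def)
  qed
  show "0 < wired_weight d p n True {} \<eta> + wired_weight d p n False {} \<eta>"
    using Zpos Z by simp
  have r: "r n = B n / Z n" for n by (simp add: r_def wired_ratio_def Z B_def)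
  then have r': "B n = Z n * r n" for n using Zpos[of n] by simp
  have g: "g n = Z n * (1 - p * r n)" for n
  proof -
    have "g n = Z n - p * B n" by (simp add: g_def Z_def algebra_simps)
    then show ?thesis by (simp add: r' algebra_simps)
  qed
  have gpos: "0 < g n" for n using Zpos[of n] p AB0[of n] by (simp add: g_def add_nonneg_pos)
  have pow: "x ^ d = x * x ^ (d - 1)" for x :: real using d by (cases d) simp_all
  have Z_Suc: "Z (Suc n) = Z n ^ d * gas_normalizer d p (r n)"
  proof -
    have "Z (Suc n) = g n ^ (d - 1) * (g n + real d * p * B n)"
      unfolding Z_def A_Suc B_Suc pow[of "g n"] by (simp add: algebra_simps)
    also have "g n + real d * p * B n = Z n * (1 + (real d - 1) * p * r n)"
      by (simp add: g r' algebra_simps)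
    also have "g n ^ (d - 1) = Z n ^ (d - 1) * (1 - p * r n) ^ (d - 1)"
      by (simp add: g power_mult_distrib)
    finally show ?thesis unfolding gas_normalizer_def pow[of "Z n"] by simp
  qed
  have "1 - p * r n > 0" using gpos[of n] Zpos[of n] by (simp add: g zero_less_mult_iff)
  moreover have "r n \<ge> 0" using AB0 Zpos[of n] by (simp add: r)
  moreover have "r (Suc n) * (g n + real d * p * B n) = real d * p * B n"
  proof -
    have "Z (Suc n) = g n ^ (d - 1) * (g n + real d * p * B n)"
      unfolding Z_def A_Suc B_Suc pow[of "g n"] by (simp add: algebra_simps)
    moreover have "r (Suc n) * Z (Suc n) = real d * p * B n * g n ^ (d - 1)"
      using r'[of "Suc n"] B_Suc by (simp add: mult.commute)
    ultimately have "g n ^ (d - 1) * (r (Suc n) * (g n + real d * p * B n)) = g n ^ (d - 1) * (real d * p * B n)"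
      by (simp add: algebra_simps)
    then show ?thesis using gpos[of n] by simp
  qed
  then have "Z n * (r (Suc n) * (1 + (real d - 1) * p * r n)) = Z n * (real d * p * r n)"
    by (simp add: g r' algebra_simps)
  then have "r (Suc n) * (1 + (real d - 1) * p * r n) = real d * p * r n"
    using Zpos[of n] by simp
  moreover have "1 + (real d - 1) * p * r n > 0"
    using \<open>r n \<ge> 0\<close> d p by (simp add: add_pos_nonneg)
  ultimately show "r (Suc n) = real d * p * r n / (1 + (real d - 1) * p * r n)"
    by (simp add: field_simps)
  have w: "wired_weight d p n b F \<eta> = Z n * wired_ratio d p n b F \<eta>" for n b F \<eta>
    using Zpos[of n] by (simp add: wired_ratio_def Z)
  fix F \<eta> assume F: "F \<subseteq> tree_edges d"
  let ?x = "\<lambda>i. loose_factor p (\<lambda>b. wired_ratio d p n b (branch F i) (\<lambda>e. \<eta> (i # e))) (edge_allows F \<eta> i)"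
  have "wired_weight d p (Suc n) False F \<eta> = Z n ^ d * (\<Prod>i<d. ?x i)"
    unfolding wired_weight_Suc[OF p(1) p' F] w[of n] loose_factor_scale by (simp add: prod.distrib)
  then show "wired_ratio d p (Suc n) False F \<eta> = (\<Prod>i<d. ?x i) / gas_normalizer d p (r n)"
    using Zpos[of n] by (simp add: wired_ratio_def Z Z_Suc)
  have "wired_weight d p (Suc n) True F \<eta> = (\<Sum>i<d. Z n ^ d * (of_bool (edge_allows F \<eta> i True) *
      (p * wired_ratio d p n True (branch F i) (\<lambda>e. \<eta> (i # e))) * (\<Prod>j\<in>{..<d} - {i}. ?x j)))"
    unfolding wired_weight_Suc[OF p(1) p' F] w[of n] loose_factor_scale pow[of "Z n"]
    by (intro sum.cong) (simp_all add: prod.distrib)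
  then show "wired_ratio d p (Suc n) True F \<eta> = (\<Sum>i<d. of_bool (edge_allows F \<eta> i True) *
      (p * wired_ratio d p n True (branch F i) (\<lambda>e. \<eta> (i # e))) * (\<Prod>j\<in>{..<d} - {i}. ?x j)) /
      gas_normalizer d p (r n)"
    using Zpos[of n] unfolding sum_distrib_left[symmetric] by (simp add: wired_ratio_def Z Z_Suc)
qed

lemma loose_factor_tendsto:
  assumes "\<And>b. (\<lambda>n. w n b) \<longlonglongrightarrow> l b"
  shows "(\<lambda>n. loose_factor p (w n) a) \<longlonglongrightarrow> loose_factor p l a"
  unfolding loose_factor_def by (intro tendsto_intros assms)

text \<open>
  Induction on the depth of the cylinder event, as each step of the recursion passes to the limit. The limit
  need not be computed: any family \<open>l\<close> solving the limit recursion with the right values at the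
  trivial event is the limit.
\<close>

lemma wired_ratio_limit:
  assumes d: "2 \<le> d" and p: "0 \<le> p" "p < 1"
  defines "q \<equiv> survival_prob d p"
  assumes l_empty: "\<And>\<eta>. l True {} \<eta> = q" "\<And>\<eta>. l False {} \<eta> = 1 - q"
    and l_False: "\<And>F \<eta>. F \<subseteq> tree_edges d \<Longrightarrow> l False F \<eta> =
      (\<Prod>i<d. loose_factor p (\<lambda>b. l b (branch F i) (\<lambda>e. \<eta> (i # e))) (edge_allows F \<eta> i)) / gas_normalizer d p q"
    and l_True: "\<And>F \<eta>. F \<subseteq> tree_edges d \<Longrightarrow> l True F \<eta> =
      (\<Sum>i<d. of_bool (edge_allows F \<eta> i True) * (p * l True (branch F i) (\<lambda>e. \<eta> (i # e))) *
        (\<Prod>j\<in>{..<d} - {i}. loose_factor p (\<lambda>b. l b (branch F j) (\<lambda>e. \<eta> (j # e))) (edge_allows F \<eta> j))) /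
      gas_normalizer d p q"
    and F: "F \<subseteq> tree_edges d" "\<And>e. e \<in> F \<Longrightarrow> length e \<le> K"
  shows "(\<lambda>n. wired_ratio d p n b F \<eta>) \<longlonglongrightarrow> l b F \<eta>"
proof -
  define r where "r n = wired_ratio d p n True {} (\<lambda>_. False)" for n
  note rec = wired_ratio_Suc[OF d p, folded r_def]
  have r0: "r 0 = 1" by (simp add: r_def wired_ratio_def wired_weight_0)
  have r_lim: "r \<longlonglongrightarrow> q" unfolding q_def by (rule mobius_iteration_limit(1)[OF d p r0 rec(2)])
  have q: "0 \<le> q" "q < 1" using survival_prob_fixed_point[OF d p] by (auto simp: q_def)
  have "p * q \<le> p" using q p by (simp add: mult_left_le)
  then have "0 < 1 - p * q" using p by simp
  moreover have "0 < 1 + (real d - 1) * p * q" using d p q by (simp add: add_pos_nonneg)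
  ultimately have nz: "gas_normalizer d p q \<noteq> 0" by (simp add: gas_normalizer_def)
  have c_lim: "(\<lambda>n. gas_normalizer d p (r n)) \<longlonglongrightarrow> gas_normalizer d p q"
    unfolding gas_normalizer_def by (intro tendsto_intros r_lim)
  show ?thesis using F
  proof (induction K arbitrary: F \<eta> b)
    case 0
    then have F: "F = {}" by fastforce
    have e: "wired_ratio d p n True {} \<eta> = r n" for n
      by (simp add: r_def wired_ratio_def wired_weight_empty[of _ _ _ _ \<eta>])
    have "wired_ratio d p n False {} \<eta> = 1 - r n" for n
      using rec(1)[of n \<eta>] unfolding e[symmetric] by (simp add: wired_ratio_def field_simps)
    with e show ?case using r_lim unfolding F
      by (cases b) (auto simp: l_empty intro!: tendsto_intros)
  next
    case (Suc K)
    have IH: "(\<lambda>n. wired_ratio d p n b (branch F i) (\<lambda>e. \<eta> (i # e))) \<longlonglongrightarrow> l b (branch F i) (\<lambda>e. \<eta> (i # e))"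
      for i b
    proof (rule Suc.IH)
      show "branch F i \<subseteq> tree_edges d" by (rule branch_tree_edges[OF Suc.prems(1)])
      show "length e \<le> K" if "e \<in> branch F i" for e
        using Suc.prems(2)[of "i # e"] that by (simp add: branch_def)
    qed
    note lf = loose_factor_tendsto[OF IH]
    have "(\<lambda>n. wired_ratio d p (Suc n) b F \<eta>) \<longlonglongrightarrow> l b F \<eta>"
    proof (cases b)
      case True
      then have b: "b = True" by simp
      show ?thesis
        unfolding b rec(4)[OF Suc.prems(1)] l_True[OF Suc.prems(1)]
        by (intro tendsto_intros lf IH c_lim nz)
    next
      case False
      then have b: "b = False" by simp
      show ?thesis
        unfolding b rec(3)[OF Suc.prems(1)] l_False[OF Suc.prems(1)]
        by (intro tendsto_intros lf IH c_lim nz)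
    qed
    then show ?case by (rule LIMSEQ_imp_Suc)
  qed
qed

lemma arboreal_gas_limit:
  assumes d: "2 \<le> d" and p: "0 \<le> p" "p < 1"
  defines "q \<equiv> survival_prob d p"
  assumes l_empty: "\<And>\<eta>. l True {} \<eta> = q" "\<And>\<eta>. l False {} \<eta> = 1 - q"
    and l_False: "\<And>F \<eta>. F \<subseteq> tree_edges d \<Longrightarrow> l False F \<eta> =
      (\<Prod>i<d. loose_factor p (\<lambda>b. l b (branch F i) (\<lambda>e. \<eta> (i # e))) (edge_allows F \<eta> i)) / gas_normalizer d p q"
    and l_True: "\<And>F \<eta>. F \<subseteq> tree_edges d \<Longrightarrow> l True F \<eta> =
      (\<Sum>i<d. of_bool (edge_allows F \<eta> i True) * (p * l True (branch F i) (\<lambda>e. \<eta> (i # e))) *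
        (\<Prod>j\<in>{..<d} - {i}. loose_factor p (\<lambda>b. l b (branch F j) (\<lambda>e. \<eta> (j # e))) (edge_allows F \<eta> j))) /
      gas_normalizer d p q"
    and F: "finite F" "F \<subseteq> tree_edges d"
  shows "(\<lambda>n. \<P>(f in arboreal_gas (wired_tree n d) p. \<forall>e\<in>F. f e = \<eta> e)) \<longlonglongrightarrow> l True F \<eta> + l False F \<eta>"
proof -
  obtain K where K: "\<And>e. e \<in> F \<Longrightarrow> length e \<le> K"
    using F(1) by (metis Max_ge finite_imageI image_eqI)
  have lim: "(\<lambda>n. wired_ratio d p n b F \<eta>) \<longlonglongrightarrow> l b F \<eta>" for b
    by (rule wired_ratio_limit[OF d p, folded q_def, of l, OF l_empty l_False l_True F(2) K])
  have "(\<lambda>n. wired_ratio d p n True F \<eta> + wired_ratio d p n False F \<eta>) \<longlonglongrightarrow> l True F \<eta> + l False F \<eta>"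
    by (intro tendsto_add lim)
  moreover have "\<forall>\<^sub>F n in sequentially. wired_ratio d p n True F \<eta> + wired_ratio d p n False F \<eta> =
      \<P>(f in arboreal_gas (wired_tree n d) p. \<forall>e\<in>F. f e = \<eta> e)"
    using eventually_ge_at_top[of K]
  proof eventually_elim
    case (elim n)
    then have "length e \<le> n" if "e \<in> F" for e using K[OF that] by simp
    then show ?case
      using p F(2) by (subst prob_arboreal_gas_wired) (auto simp: wired_ratio_def add_divide_distrib)
  qed
  ultimately show ?thesis by (rule Lim_transform_eventually)
qed


section \<open>The weak limit as a growth process\<close>

text \<open>
  The labels that drive the growth process. \<open>Fresh v\<close> is the type of \<open>v\<close> if its
  parent edge is closed, \<open>Side v\<close> is the state of this edge if the parent does not survive
  through \<open>v\<close>, and \<open>Choice v\<close> is the child through which \<open>v\<close> survives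
  if it does. Bits are coded by \<open>0\<close> and \<open>1\<close>, so that all labels are natural numbers
  and form one product field.
\<close>

datatype label = Fresh vertex | Side vertex | Choice vertex

text \<open>
  The translation that carries the labels of the whole tree to the labels at or below \<open>u\<close>.
\<close>

fun place :: "vertex \<Rightarrow> label \<Rightarrow> label" where
  "place u (Fresh v) = Fresh (u @ v)"
| "place u (Side v) = Side (u @ v)"
| "place u (Choice v) = Choice (u @ v)"

lemma inj_place: "inj (place u)"
proof (rule injI)
  fix x y show "place u x = place u y \<Longrightarrow> x = y" by (cases x; cases y) auto
qed

definition fresh :: "(label \<Rightarrow> nat) \<Rightarrow> vertex \<Rightarrow> bool" where "fresh X v \<longleftrightarrow> X (Fresh v) = 1"
definition side :: "(label \<Rightarrow> nat) \<Rightarrow> vertex \<Rightarrow> bool" where "side X v \<longleftrightarrow> X (Side v) = 1"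
abbreviation choice :: "(label \<Rightarrow> nat) \<Rightarrow> vertex \<Rightarrow> nat" where "choice X v \<equiv> X (Choice v)"
abbreviation shift :: "vertex \<Rightarrow> (label \<Rightarrow> nat) \<Rightarrow> label \<Rightarrow> nat" where "shift u X \<equiv> (\<lambda>l. X (place u l))"

lemma bits_shift [simp]: "fresh (shift u X) v = fresh X (u @ v)" "side (shift u X) v = side X (u @ v)"
  by (simp_all add: fresh_def side_def)

lemma pred_bits [measurable]:
  "Measurable.pred (product_field \<mu>) (\<lambda>X. fresh X v)" "Measurable.pred (product_field \<mu>) (\<lambda>X. side X v)"
  unfolding fresh_def side_def by measurable

text \<open>
  The type (\<open>True\<close>: surviving) of the child \<open>i\<close> of a vertex \<open>u\<close> of type
  \<open>t\<close>. A child below an open side edge does not survive: the parent would otherwise be joined to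
  infinity through it as well.
\<close>

definition child_type :: "(label \<Rightarrow> nat) \<Rightarrow> vertex \<Rightarrow> bool \<Rightarrow> nat \<Rightarrow> bool" where
  "child_type X u t i \<longleftrightarrow> (t \<and> choice X u = i) \<or> (\<not> side X (u @ [i]) \<and> fresh X (u @ [i]))"

text \<open>
  The process is started at a vertex \<open>u\<close> of type \<open>t\<close>, and the vertex
  \<open>u @ v\<close> is named by \<open>v\<close>. The same convention holds for \<open>edge_open\<close>.
\<close>

primrec vertex_type :: "(label \<Rightarrow> nat) \<Rightarrow> vertex \<Rightarrow> bool \<Rightarrow> vertex \<Rightarrow> bool" where
  "vertex_type X u t [] = t"
| "vertex_type X u t (i # v) = vertex_type X (u @ [i]) (child_type X u t i) v"

definition edge_open :: "(label \<Rightarrow> nat) \<Rightarrow> vertex \<Rightarrow> bool \<Rightarrow> vertex \<Rightarrow> bool" where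
  "edge_open X u t e \<longleftrightarrow>
     (vertex_type X u t (butlast e) \<and> choice X (u @ butlast e) = last e) \<or> side X (u @ e)"

lemma vertex_type_append: "vertex_type X u t (v @ w) = vertex_type X (u @ v) (vertex_type X u t v) w"
  by (induction v arbitrary: u t) auto

lemma vertex_type_snoc: "vertex_type X u t (v @ [i]) = child_type X (u @ v) (vertex_type X u t v) i"
  by (simp add: vertex_type_append)

lemma edge_open_append: "e \<noteq> [] \<Longrightarrow> edge_open X u t (v @ e) = edge_open X (u @ v) (vertex_type X u t v) e"
  by (simp add: edge_open_def butlast_append vertex_type_append)

lemma edge_open_Cons: "e \<noteq> [] \<Longrightarrow> edge_open X u t (i # e) = edge_open X (u @ [i]) (child_type X u t i) e"
  using edge_open_append[of e X u t "[i]"] by simp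

lemma edge_open_single: "edge_open X u t [i] \<longleftrightarrow> (t \<and> choice X u = i) \<or> side X (u @ [i])"
  by (simp add: edge_open_def)

lemma vertex_type_shift: "vertex_type X (u @ v) t w = vertex_type (shift u X) v t w"
  by (induction w arbitrary: v t) (simp_all add: child_type_def)

lemma edge_open_shift: "edge_open X (u @ v) t e = edge_open (shift u X) v t e"
  by (simp add: edge_open_def vertex_type_shift)

text \<open>
  The labels that the state of the edge \<open>u @ e\<close> can depend on when the process is started at
  \<open>u\<close>, together with \<open>Fresh (u @ e)\<close>, on which the type of its lower endpoint
  depends.
\<close>

definition relevant :: "vertex \<Rightarrow> vertex \<Rightarrow> label set" where
  "relevant u e = {Choice (u @ w) | w. strict_prefix w e} \<union>
     {Side (u @ w) | w. prefix w e \<and> w \<noteq> []} \<union> {Fresh (u @ w) | w. prefix w e \<and> w \<noteq> []}"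

lemma vertex_type_cong:
  "(\<And>l. l \<in> relevant u v \<Longrightarrow> X l = Y l) \<Longrightarrow> vertex_type X u t v = vertex_type Y u t v"
proof (induction v arbitrary: u t)
  case (Cons i v)
  have "X (Choice u) = Y (Choice u)"
    by (rule Cons.prems) (simp add: relevant_def)
  moreover have "X (Side (u @ [i])) = Y (Side (u @ [i]))" "X (Fresh (u @ [i])) = Y (Fresh (u @ [i]))"
    by (rule Cons.prems; force simp: relevant_def)+
  ultimately have "child_type X u t i = child_type Y u t i" by (simp add: child_type_def fresh_def side_def)
  moreover have "relevant (u @ [i]) v \<subseteq> relevant u (i # v)"
  proof
    fix l assume "l \<in> relevant (u @ [i]) v"
    then consider w where "l = Choice (u @ i # w)" "strict_prefix w v"
      | w where "l = Side (u @ i # w)" "prefix w v"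
      | w where "l = Fresh (u @ i # w)" "prefix w v"
      by (auto simp: relevant_def)
    then show "l \<in> relevant u (i # v)"
    proof cases
      case 1
      then have "strict_prefix (i # w) (i # v)" by (simp add: strict_prefix_def)
      with 1 show ?thesis unfolding relevant_def by blast
    next
      case 2
      then have "prefix (i # w) (i # v) \<and> i # w \<noteq> []" by simp
      with 2 show ?thesis unfolding relevant_def by blast
    next
      case 3
      then have "prefix (i # w) (i # v) \<and> i # w \<noteq> []" by simp
      with 3 show ?thesis unfolding relevant_def by blast
    qed
  qed
  ultimately show ?case using Cons by (simp add: subset_iff)
qed simp

lemma edge_open_cong:
  assumes "e \<noteq> []" "\<And>l. l \<in> relevant u e \<Longrightarrow> l \<noteq> Fresh (u @ e) \<Longrightarrow> X l = Y l"
  shows "edge_open X u t e = edge_open Y u t e"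
proof -
  have sp: "strict_prefix (butlast e) e"
    using assms(1) by (metis append_butlast_last_id not_Cons_self2 append_self_conv prefixI strict_prefixI)
  have "vertex_type X u t (butlast e) = vertex_type Y u t (butlast e)"
  proof (rule vertex_type_cong, rule assms(2))
    fix l assume l: "l \<in> relevant u (butlast e)"
    then show "l \<in> relevant u e"
      using sp unfolding relevant_def by (auto dest: prefix_order.dual_order.strict_trans intro: prefix_order.trans prefix_order.less_imp_le)
    show "l \<noteq> Fresh (u @ e)"
      using l sp unfolding relevant_def by (auto dest: prefix_order.leD)
  qed
  moreover have "X (Choice (u @ butlast e)) = Y (Choice (u @ butlast e))"
    using sp by (intro assms(2)) (auto simp: relevant_def)
  moreover have "X (Side (u @ e)) = Y (Side (u @ e))"
    using assms(1) by (intro assms(2)) (auto simp: relevant_def)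
  ultimately show ?thesis by (simp add: edge_open_def side_def)
qed

lemma pred_vertex_type:
  assumes [measurable]: "Measurable.pred (product_field \<mu>) T"
  shows "Measurable.pred (product_field \<mu>) (\<lambda>X. vertex_type X u (T X) v)"
  using assms
proof (induction v arbitrary: u T)
  case (Cons i v)
  have [measurable]: "Measurable.pred (product_field \<mu>) T" by fact
  have "Measurable.pred (product_field \<mu>) (\<lambda>X. child_type X u (T X) i)"
    unfolding child_type_def by measurable
  from Cons.IH[OF this] show ?case by simp
qed simp

lemma pred_edge_open:
  assumes [measurable]: "Measurable.pred (product_field \<mu>) T"
  shows "Measurable.pred (product_field \<mu>) (\<lambda>X. edge_open X u (T X) e)"
proof -
  note [measurable] = pred_vertex_type[OF assms]
  show ?thesis unfolding edge_open_def by measurable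
qed

lemma pred_agrees_compose:
  assumes [measurable]: "\<And>e. Measurable.pred M (\<lambda>X. f X e)"
  shows "Measurable.pred M (\<lambda>X. agrees F \<eta> (f X))"
  unfolding agrees_def by measurable

text \<open>
  The parameters \<open>q\<close>, the probability that a fresh vertex survives, and \<open>s\<close>, the
  probability that a side edge is open, are independent of each other here.
\<close>

locale growth =
  fixes d :: nat and q s :: real
  assumes d: "2 \<le> d" and q: "0 \<le> q" "q \<le> 1" and s: "0 \<le> s" "s \<le> 1"
begin

fun label_pmf :: "label \<Rightarrow> nat pmf" where
  "label_pmf (Fresh v) = map_pmf of_bool (bernoulli_pmf q)"
| "label_pmf (Side v) = map_pmf of_bool (bernoulli_pmf s)"
| "label_pmf (Choice v) = pmf_of_set {..<d}"

definition field :: "(label \<Rightarrow> nat) measure" where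
  "field = product_field label_pmf"

sublocale prob_space field
  by (simp add: field_def)

lemma space_field [simp]: "space field = UNIV"
  by (simp add: field_def)

lemma label_pmf_place [simp]: "label_pmf (place u l) = label_pmf l"
  by (cases l) auto

lemma measurable_label [measurable]: "(\<lambda>X. X l) \<in> field \<rightarrow>\<^sub>M count_space UNIV"
  by (simp add: field_def)

lemmas [measurable] = pred_bits[where \<mu> = label_pmf, folded field_def]
  pred_vertex_type[where \<mu> = label_pmf, folded field_def]
  pred_edge_open[where \<mu> = label_pmf, folded field_def]

lemma pred_shift:
  "Measurable.pred field Q \<Longrightarrow> Measurable.pred field (\<lambda>X. Q (shift u X))"
  unfolding field_def by (rule pred_product_field_reindex)

lemma prob_shift:
  "Measurable.pred field Q \<Longrightarrow> prob {X. Q (shift u X)} = prob {X. Q X}"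
  unfolding field_def by (rule prob_product_field_reindex[OF inj_place]) auto

lemmas prob_two_blocks' = prob_two_blocks[where \<mu> = label_pmf, folded field_def]
lemmas prob_disjoint_blocks' = prob_disjoint_blocks[where \<mu> = label_pmf, folded field_def]
lemmas prob_finite_partition' = prob_finite_partition[where \<mu> = label_pmf, folded field_def]
lemmas prob_bool_partition' = prob_bool_partition[where \<mu> = label_pmf, folded field_def]

lemma sets_Collect_field [intro]: "Measurable.pred field E \<Longrightarrow> {X. E X} \<in> events"
  unfolding field_def by (rule sets_Collect_product_field)

lemma prob_fresh: "prob {X. fresh X v = b} = (if b then q else 1 - q)"
proof -
  have "prob {X. fresh X v = b} = prob {X. X (Fresh v) \<in> {n. (n = 1) = b}}"
    by (simp add: fresh_def)
  also have "\<dots> = measure_pmf.prob (bernoulli_pmf q) (of_bool -` {n. (n = (1 :: nat)) = b})"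
    unfolding field_def prob_product_field_component by simp
  also have "of_bool -` {n. (n = (1 :: nat)) = b} = {b}" by auto
  also have "measure_pmf.prob (bernoulli_pmf q) {b} = (if b then q else 1 - q)"
    using q by (simp add: measure_pmf_single)
  finally show ?thesis .
qed

lemma prob_side: "prob {X. side X v = b} = (if b then s else 1 - s)"
proof -
  have "prob {X. side X v = b} = prob {X. X (Side v) \<in> {n. (n = 1) = b}}"
    by (simp add: side_def)
  also have "\<dots> = measure_pmf.prob (bernoulli_pmf s) (of_bool -` {n. (n = (1 :: nat)) = b})"
    unfolding field_def prob_product_field_component by simp
  also have "of_bool -` {n. (n = (1 :: nat)) = b} = {b}" by auto
  also have "measure_pmf.prob (bernoulli_pmf s) {b} = (if b then s else 1 - s)"
    using s by (simp add: measure_pmf_single)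
  finally show ?thesis .
qed

lemma prob_choice: "prob {X. choice X v = i} = (if i < d then 1 / real d else 0)"
proof -
  have "prob {X. choice X v = i} = pmf (pmf_of_set {..<d}) i"
    unfolding field_def by (subst prob_product_field_eq) simp
  also have "\<dots> = (if i < d then 1 / real d else 0)"
    using d by (subst pmf_of_set) (auto simp: indicator_def lessThan_empty_iff)
  finally show ?thesis .
qed

lemma AE_choice: "AE X in field. \<forall>v. choice X v < d"
proof -
  have "AE X in field. choice X v < d" for v
  proof -
    have "AE X in field. choice X v \<noteq> i" if "\<not> i < d" for i
    proof (rule AE_I[where N = "{X. choice X v = i}"])
      show "emeasure field {X. choice X v = i} = 0"
        using prob_choice[of v i] that by (simp add: emeasure_eq_measure)
    qed auto
    then have "AE X in field. \<forall>i. \<not> i < d \<longrightarrow> choice X v \<noteq> i"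
      by (simp add: AE_all_countable)
    then show ?thesis by eventually_elim blast
  qed
  then show ?thesis by (simp add: AE_all_countable)
qed

text \<open>
  The labels that matter once the type of the root is given: the root has no parent edge, and its type
  replaces its fresh label.
\<close>

definition interior :: "label set" where
  "interior = - {Fresh [], Side []}"

lemma determined_by_edge_open:
  assumes "[] \<notin> F" shows "determined_by interior (\<lambda>X. agrees F \<eta> (edge_open X [] t))"
proof (rule determined_byI)
  fix X Y :: "label \<Rightarrow> nat" assume XY: "\<And>l. l \<in> interior \<Longrightarrow> X l = Y l"
  have "edge_open X [] t e = edge_open Y [] t e" if "e \<in> F" for e
    using assms that by (intro edge_open_cong XY) (auto simp: relevant_def interior_def)
  then show "agrees F \<eta> (edge_open X [] t) = agrees F \<eta> (edge_open Y [] t)"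
    by (simp add: agrees_def)
qed

lemma prob_child_labels:
  assumes det: "determined_by interior Q" and m [measurable]: "Measurable.pred field Q"
  shows "prob {X. (side X u = b \<and> fresh X u = c) \<and> Q (shift u X)} =
    (if b then s else 1 - s) * (if c then q else 1 - q) * prob {X. Q X}"
proof -
  have mQ [measurable]: "Measurable.pred field (\<lambda>X. Q (shift u X))" by (rule pred_shift[OF m])
  have "prob {X. (side X u = b \<and> fresh X u = c) \<and> Q (shift u X)} =
      prob {X. side X u = b \<and> fresh X u = c} * prob {X. Q (shift u X)}"
  proof (rule prob_two_blocks'[where I = "{Side u, Fresh u}" and J = "- {Side u, Fresh u}"])
    have "place u ` interior \<subseteq> - {Side u, Fresh u}"
    proof (rule image_subsetI)
      fix l assume "l \<in> interior"
      then show "place u l \<in> - {Side u, Fresh u}" by (cases l) (auto simp: interior_def)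
    qed
    then show "determined_by (- {Side u, Fresh u}) (\<lambda>X. Q (shift u X))"
      by (rule determined_by_mono[OF determined_by_reindex[OF det]])
  qed (auto simp: determined_by_def fresh_def side_def)
  also have "prob {X. side X u = b \<and> fresh X u = c} = prob {X. side X u = b} * prob {X. fresh X u = c}"
    by (rule prob_two_blocks'[where I = "{Side u}" and J = "{Fresh u}"]) (auto simp: determined_by_def fresh_def side_def)
  finally show ?thesis by (simp add: prob_side prob_fresh prob_shift[OF m])
qed

definition cylinder_prob :: "bool \<Rightarrow> vertex set \<Rightarrow> (vertex \<Rightarrow> bool) \<Rightarrow> real" where
  "cylinder_prob t F \<eta> = prob {X. agrees F \<eta> (edge_open X [] t)}"

lemma pred_agrees_edge_open [measurable]:
  "Measurable.pred field T \<Longrightarrow> Measurable.pred field (\<lambda>X. agrees F \<eta> (edge_open X u (T X)))"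
  by (rule pred_agrees_compose) (rule pred_edge_open[where \<mu> = label_pmf, folded field_def])

text \<open>
  The cylinder event in the branch behind the child \<open>i\<close>, where \<open>c\<close> tells whether the
  root survives through \<open>i\<close>.
\<close>

definition branch_agrees :: "vertex set \<Rightarrow> (vertex \<Rightarrow> bool) \<Rightarrow> nat \<Rightarrow> bool \<Rightarrow> (label \<Rightarrow> nat) \<Rightarrow> bool" where
  "branch_agrees F \<eta> i c X \<longleftrightarrow> edge_allows F \<eta> i (c \<or> side X [i]) \<and>
     agrees (branch F i) (\<lambda>e. \<eta> (i # e)) (edge_open X [i] (c \<or> (\<not> side X [i] \<and> fresh X [i])))"

lemma agrees_edge_open_iff:
  assumes "F \<subseteq> tree_edges d"
  shows "agrees F \<eta> (edge_open X [] t) \<longleftrightarrow> (\<forall>i<d. branch_agrees F \<eta> i (t \<and> choice X [] = i) X)"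
proof -
  have "agrees (branch F i) (\<lambda>e. \<eta> (i # e)) (\<lambda>e. edge_open X [] t (i # e)) =
      agrees (branch F i) (\<lambda>e. \<eta> (i # e)) (edge_open X [i] (child_type X [] t i))" for i
    unfolding agrees_def by (intro ball_cong refl) (simp add: branch_def edge_open_Cons)
  then show ?thesis
    unfolding agrees_iff_branches[OF assms] branch_agrees_def
    by (simp add: edge_open_single child_type_def)
qed

lemma pred_branch_agrees [measurable]: "Measurable.pred field (branch_agrees F \<eta> i c)"
  unfolding branch_agrees_def edge_allows_def by measurable

lemma determined_by_branch_agrees: "determined_by (range (place [i])) (branch_agrees F \<eta> i c)"
proof (rule determined_byI)
  fix X Y :: "label \<Rightarrow> nat" assume XY: "\<And>l. l \<in> range (place [i]) \<Longrightarrow> X l = Y l"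
  have "edge_open X [i] t e = edge_open Y [i] t e" for t e
    using edge_open_shift[of _ "[i]" "[]" t e] XY by simp
  then have "edge_open X [i] t = edge_open Y [i] t" for t by auto
  moreover have "X (Side [i]) = Y (Side [i])" "X (Fresh [i]) = Y (Fresh [i])"
    using XY[OF rangeI[of _ "Side []"]] XY[OF rangeI[of _ "Fresh []"]] by simp_all
  ultimately show "branch_agrees F \<eta> i c X = branch_agrees F \<eta> i c Y"
    by (simp add: branch_agrees_def fresh_def side_def)
qed

lemma prob_branch_agrees:
  fixes \<eta> :: "vertex \<Rightarrow> bool"
  assumes F: "F \<subseteq> tree_edges d"
  defines "K \<equiv> \<lambda>i t. cylinder_prob t (branch F i) (\<lambda>e. \<eta> (i # e))"
  shows "prob {X. branch_agrees F \<eta> i True X} = of_bool (edge_allows F \<eta> i True) * K i True"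
    and "prob {X. branch_agrees F \<eta> i False X} = of_bool (edge_allows F \<eta> i True) * (s * K i False) +
      of_bool (edge_allows F \<eta> i False) * ((1 - s) * (q * K i True + (1 - q) * K i False))"
proof -
  define Q where "Q t X \<longleftrightarrow> agrees (branch F i) (\<lambda>e. \<eta> (i # e)) (edge_open X [] t)" for t X
  have mQ [measurable]: "Measurable.pred field (Q t)" for t unfolding Q_def by measurable
  have mQ' [measurable]: "Measurable.pred field (\<lambda>X. Q t (shift [i] X))" for t by (rule pred_shift[OF mQ])
  have detQ: "determined_by interior (Q t)" for t
    unfolding Q_def by (rule determined_by_edge_open) (simp add: branch_def)
  have K: "K i t = prob {X. Q t X}" for t by (simp add: K_def cylinder_prob_def Q_def)
  have "edge_open X [i] t = edge_open (shift [i] X) [] t" for X t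
    using edge_open_shift[of X "[i]" "[]" t] by auto
  then have ba: "branch_agrees F \<eta> i c X \<longleftrightarrow> edge_allows F \<eta> i (c \<or> side X [i]) \<and>
      Q (c \<or> (\<not> side X [i] \<and> fresh X [i])) (shift [i] X)" for c X
    by (simp add: branch_agrees_def Q_def)
  show "prob {X. branch_agrees F \<eta> i True X} = of_bool (edge_allows F \<eta> i True) * K i True"
    unfolding ba by (cases "edge_allows F \<eta> i True") (simp_all add: K prob_shift)
  have one: "prob {X. (side X [i] = b \<and> fresh X [i] = c) \<and> branch_agrees F \<eta> i False X} =
      of_bool (edge_allows F \<eta> i b) * ((if b then s else 1 - s) * (if c then q else 1 - q) * K i (\<not> b \<and> c))" for b c
  proof (cases "edge_allows F \<eta> i b")
    case True
    then have e: "{X. (side X [i] = b \<and> fresh X [i] = c) \<and> branch_agrees F \<eta> i False X} =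
        {X. (side X [i] = b \<and> fresh X [i] = c) \<and> Q (\<not> b \<and> c) (shift [i] X)}"
      unfolding ba by auto
    show ?thesis unfolding e K by (subst prob_child_labels[OF detQ]) (use True in simp_all)
  next
    case False
    then have e: "{X. (side X [i] = b \<and> fresh X [i] = c) \<and> branch_agrees F \<eta> i False X} = {}"
      unfolding ba by auto
    show ?thesis unfolding e using False by simp
  qed
  have "{X. branch_agrees F \<eta> i False X} = {X. \<exists>bc\<in>UNIV. (side X [i] = fst bc \<and> fresh X [i] = snd bc) \<and>
      branch_agrees F \<eta> i False X}" by auto
  also have "prob \<dots> = (\<Sum>bc\<in>UNIV. prob {X. (side X [i] = fst bc \<and> fresh X [i] = snd bc) \<and>
      branch_agrees F \<eta> i False X})"
    by (rule prob_finite_partition') (auto simp: prod_eq_iff)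
  also have "\<dots> = (\<Sum>b\<in>UNIV. \<Sum>c\<in>UNIV. prob {X. (side X [i] = b \<and> fresh X [i] = c) \<and>
      branch_agrees F \<eta> i False X})"
    by (simp add: sum.cartesian_product case_prod_beta)
  finally show "prob {X. branch_agrees F \<eta> i False X} = of_bool (edge_allows F \<eta> i True) * (s * K i False) +
      of_bool (edge_allows F \<eta> i False) * ((1 - s) * (q * K i True + (1 - q) * K i False))"
    unfolding one UNIV_bool by (simp add: algebra_simps)
qed

text \<open>
  Given the choice at the root, the branches depend on disjoint sets of labels.
\<close>

lemma cylinder_prob_rec:
  assumes F: "F \<subseteq> tree_edges d"
  shows "cylinder_prob False F \<eta> = (\<Prod>i<d. prob {X. branch_agrees F \<eta> i False X})"
    and "cylinder_prob True F \<eta> = (\<Sum>j<d. 1 / real d * (prob {X. branch_agrees F \<eta> j True X} *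
      (\<Prod>i\<in>{..<d} - {j}. prob {X. branch_agrees F \<eta> i False X})))"
proof -
  have prod: "prob {X. \<forall>i\<in>{..<d}. branch_agrees F \<eta> i (c i) X} = (\<Prod>i<d. prob {X. branch_agrees F \<eta> i (c i) X})" for c
  proof (rule prob_disjoint_blocks'[where J = "\<lambda>i. range (place [i])"])
    show "range (place [i]) \<inter> range (place [j]) = {}" if "i \<noteq> j" for i j
    proof -
      have "place [i] l \<noteq> place [j] l'" for l l' using that by (cases l; cases l') auto
      then show ?thesis by blast
    qed
  qed (auto intro: determined_by_branch_agrees)
  have "cylinder_prob False F \<eta> = prob {X. \<forall>i\<in>{..<d}. branch_agrees F \<eta> i False X}"
    unfolding cylinder_prob_def agrees_edge_open_iff[OF F] by (simp add: Ball_def)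
  then show "cylinder_prob False F \<eta> = (\<Prod>i<d. prob {X. branch_agrees F \<eta> i False X})"
    by (simp add: prod[of "\<lambda>_. False"])
  let ?E = "\<lambda>j X. choice X [] = j \<and> (\<forall>i\<in>{..<d}. branch_agrees F \<eta> i (j = i) X)"
  have "cylinder_prob True F \<eta> = prob {X. \<exists>j\<in>{..<d}. ?E j X}"
    unfolding cylinder_prob_def
  proof (rule finite_measure_eq_AE)
    show "AE X in field. (X \<in> {X. agrees F \<eta> (edge_open X [] True)}) = (X \<in> {X. \<exists>j\<in>{..<d}. ?E j X})"
      using AE_choice by eventually_elim (auto simp: agrees_edge_open_iff[OF F])
  qed auto
  also have "\<dots> = (\<Sum>j<d. prob {X. ?E j X})"
    by (rule prob_finite_partition') auto
  also have "\<dots> = (\<Sum>j<d. 1 / real d * (prob {X. branch_agrees F \<eta> j True X} *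
      (\<Prod>i\<in>{..<d} - {j}. prob {X. branch_agrees F \<eta> i False X})))"
  proof (rule sum.cong)
    fix j assume j: "j \<in> {..<d}"
    have "prob {X. ?E j X} = prob {X. choice X [] = j} * prob {X. \<forall>i\<in>{..<d}. branch_agrees F \<eta> i (j = i) X}"
    proof (rule prob_two_blocks'[where I = "{Choice []}" and J = "- {Choice []}"])
      have sub: "range (place [i]) \<subseteq> - {Choice []}" for i
      proof -
        have "place [i] l \<noteq> Choice []" for l by (cases l) auto
        then have "Choice [] \<notin> range (place [i])" by (metis rangeE)
        then show ?thesis by blast
      qed
      show "determined_by (- {Choice []}) (\<lambda>X. \<forall>i\<in>{..<d}. branch_agrees F \<eta> i (j = i) X)"
      proof (rule determined_byI)
        fix X Y :: "label \<Rightarrow> nat" assume XY: "\<And>l. l \<in> - {Choice []} \<Longrightarrow> X l = Y l"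
        have "branch_agrees F \<eta> i (j = i) X = branch_agrees F \<eta> i (j = i) Y" for i
          by (rule determined_byD[OF determined_by_mono[OF determined_by_branch_agrees sub]]) (rule XY)
        then show "(\<forall>i\<in>{..<d}. branch_agrees F \<eta> i (j = i) X) = (\<forall>i\<in>{..<d}. branch_agrees F \<eta> i (j = i) Y)"
          by simp
      qed
    qed (auto simp: determined_by_def fresh_def side_def)
    also have "prob {X. \<forall>i\<in>{..<d}. branch_agrees F \<eta> i (j = i) X} =
        prob {X. branch_agrees F \<eta> j True X} * (\<Prod>i\<in>{..<d} - {j}. prob {X. branch_agrees F \<eta> i False X})"
      unfolding prod using j by (subst prod.remove[of _ j]) (auto intro!: prod.cong)
    finally show "prob {X. ?E j X} = 1 / real d * (prob {X. branch_agrees F \<eta> j True X} *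
      (\<Prod>i\<in>{..<d} - {j}. prob {X. branch_agrees F \<eta> i False X}))"
      using j by (simp add: prob_choice)
  qed simp
  finally show "cylinder_prob True F \<eta> = (\<Sum>j<d. 1 / real d * (prob {X. branch_agrees F \<eta> j True X} *
      (\<Prod>i\<in>{..<d} - {j}. prob {X. branch_agrees F \<eta> i False X})))" .
qed

definition config :: "(label \<Rightarrow> nat) \<Rightarrow> vertex \<Rightarrow> bool" where
  "config X = (\<lambda>e\<in>tree_edges d. edge_open X [] (fresh X []) e)"

definition config_law :: "(vertex \<Rightarrow> bool) measure" where
  "config_law = distr field (config_space (tree_edges d)) config"

lemma measurable_config [measurable]: "config \<in> field \<rightarrow>\<^sub>M config_space (tree_edges d)"
  unfolding config_def config_space_def by (rule measurable_restrict) measurable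

lemma prob_config_agrees:
  assumes F: "F \<subseteq> tree_edges d"
  shows "prob {X. agrees F \<eta> (config X)} = q * cylinder_prob True F \<eta> + (1 - q) * cylinder_prob False F \<eta>"
proof -
  have "{X. agrees F \<eta> (config X)} = {X. agrees F \<eta> (edge_open X [] (fresh X []))}"
    using F unfolding agrees_def config_def by (intro Collect_cong ball_cong) auto
  also have "prob \<dots> = prob {X. fresh X [] \<and> agrees F \<eta> (edge_open X [] (fresh X []))} +
      prob {X. \<not> fresh X [] \<and> agrees F \<eta> (edge_open X [] (fresh X []))}"
    by (rule prob_bool_partition') measurable
  also have "\<dots> = prob {X. fresh X [] = True \<and> agrees F \<eta> (edge_open X [] True)} +
      prob {X. fresh X [] = False \<and> agrees F \<eta> (edge_open X [] False)}"
    by (intro arg_cong2[where f = "(+)"] arg_cong[where f = prob] Collect_cong) (auto cong: conj_cong)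
  finally have total: "prob {X. agrees F \<eta> (config X)} =
      prob {X. fresh X [] = True \<and> agrees F \<eta> (edge_open X [] True)} +
      prob {X. fresh X [] = False \<and> agrees F \<eta> (edge_open X [] False)}" .
  have ind: "prob {X. fresh X [] = b \<and> agrees F \<eta> (edge_open X [] b)} =
      prob {X. fresh X [] = b} * prob {X. agrees F \<eta> (edge_open X [] b)}" for b
  proof (rule prob_two_blocks'[where I = "{Fresh []}" and J = interior])
    show "determined_by interior (\<lambda>X. agrees F \<eta> (edge_open X [] b))"
      using F by (intro determined_by_edge_open) auto
  qed (auto simp: interior_def determined_by_def fresh_def)
  show ?thesis unfolding total ind prob_fresh cylinder_prob_def by simp
qed

end

text \<open>
  An event of the form \<open>\<forall>e\<in>J. \<omega> e \<in> A e\<close> with finite \<open>J\<close> is a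
  finite disjoint union of cylinder events, and these events generate the product
  \<open>\<sigma>\<close>-algebra.
\<close>

lemma config_space_measure_eqI:
  fixes E :: "vertex set"
  assumes "prob_space P" "prob_space Q"
    and sets: "sets P = sets (config_space E)" "sets Q = sets (config_space E)"
    and cyl: "\<And>F \<eta>. finite F \<Longrightarrow> F \<subseteq> E \<Longrightarrow>
      \<P>(\<omega> in P. \<forall>e\<in>F. \<omega> e = \<eta> e) = \<P>(\<omega> in Q. \<forall>e\<in>F. \<omega> e = \<eta> e)"
  shows "P = Q"
proof (rule measure_eqI_PiM_infinite)
  interpret P: prob_space P by fact
  interpret Q: prob_space Q by fact
  let ?C = "\<lambda>_. count_space (UNIV :: bool set)"
  show sP: "sets P = sets (PiM E ?C)" and sQ: "sets Q = sets (PiM E ?C)"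
    using sets by (auto simp: config_space_def)
  show "finite_measure P" by unfold_locales
  fix A :: "vertex \<Rightarrow> bool set" and J assume J: "finite J" "J \<subseteq> E"
  have sp: "space P = space Q" using sP sQ by (metis sets_eq_imp_space_eq)
  have spP: "space P = E \<rightarrow>\<^sub>E UNIV"
    using sets_eq_imp_space_eq[OF sP] by (simp add: space_PiM)
  let ?S = "Pi\<^sub>E J A"
  have finS: "finite ?S"
    using J by (intro finite_PiE) (auto intro: finite_subset[OF subset_UNIV])
  let ?cyl = "\<lambda>\<eta>. {\<omega> \<in> space P. \<forall>e\<in>J. \<omega> e = \<eta> e}"
  have emb: "prod_emb (E) ?C J ?S = (\<Union>\<eta>\<in>?S. ?cyl \<eta>)"
  proof safe
    fix \<omega> assume "\<omega> \<in> prod_emb (E) ?C J ?S"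
    then have "restrict \<omega> J \<in> ?S" "\<omega> \<in> space P" by (auto simp: prod_emb_def spP)
    then show "\<omega> \<in> (\<Union>\<eta>\<in>?S. ?cyl \<eta>)" by (intro UN_I[of "restrict \<omega> J"]) auto
  next
    fix \<omega> \<eta> assume "\<eta> \<in> ?S" "\<omega> \<in> space P" "\<forall>e\<in>J. \<omega> e = \<eta> e"
    then have "restrict \<omega> J = \<eta>" by (auto simp: PiE_iff extensional_def fun_eq_iff)
    then show "\<omega> \<in> prod_emb (E) ?C J ?S"
      using \<open>\<eta> \<in> ?S\<close> \<open>\<omega> \<in> space P\<close> by (auto simp: prod_emb_def spP)
  qed
  have cyl_sets: "?cyl \<eta> \<in> sets (PiM (E) ?C)" for \<eta>
  proof -
    have "?cyl \<eta> = prod_emb (E) ?C J (\<Pi>\<^sub>E e\<in>J. {\<eta> e})"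
      by (auto simp: prod_emb_def spP PiE_iff extensional_def)
    also have "\<dots> \<in> sets (PiM (E) ?C)" using J by (intro sets_PiM_I) auto
    finally show ?thesis .
  qed
  have disj: "disjoint_family_on ?cyl ?S"
  proof -
    have "\<eta> = \<zeta>" if "\<eta> \<in> ?S" "\<zeta> \<in> ?S" "\<omega> \<in> ?cyl \<eta>" "\<omega> \<in> ?cyl \<zeta>" for \<eta> \<zeta> \<omega>
      using that by (intro PiE_ext[of \<eta> J A \<zeta>]) auto
    then show ?thesis unfolding disjoint_family_on_def by blast
  qed
  have "measure P (?cyl \<eta>) = measure Q (?cyl \<eta>)" for \<eta>
    using cyl[OF J] unfolding sp .
  moreover have "measure P (\<Union>\<eta>\<in>?S. ?cyl \<eta>) = (\<Sum>\<eta>\<in>?S. measure P (?cyl \<eta>))"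
    by (rule P.finite_measure_finite_Union[OF finS _ disj]) (use cyl_sets sP in auto)
  moreover have "measure Q (\<Union>\<eta>\<in>?S. ?cyl \<eta>) = (\<Sum>\<eta>\<in>?S. measure Q (?cyl \<eta>))"
    by (rule Q.finite_measure_finite_Union[OF finS _ disj]) (use cyl_sets sQ in auto)
  ultimately have "measure P (\<Union>\<eta>\<in>?S. ?cyl \<eta>) = measure Q (\<Union>\<eta>\<in>?S. ?cyl \<eta>)"
    by simp
  then show "emeasure P (prod_emb (E) ?C J ?S) = emeasure Q (prod_emb (E) ?C J ?S)"
    unfolding emb by (simp add: P.emeasure_eq_measure Q.emeasure_eq_measure)
qed

lemma weak_limit_unique:
  assumes "arboreal_gas_weak_limit d p P" "arboreal_gas_weak_limit d p Q"
  shows "P = Q"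
proof (rule config_space_measure_eqI)
  note lim = assms[unfolded arboreal_gas_weak_limit_def]
  show "prob_space P" "prob_space Q"
    and "sets P = sets (config_space (tree_edges d))" "sets Q = sets (config_space (tree_edges d))"
    using lim by simp_all
  fix F and \<eta> :: "vertex \<Rightarrow> bool" assume F: "finite F" "F \<subseteq> tree_edges d"
  let ?p = "\<lambda>n. \<P>(f in arboreal_gas (wired_tree n d) p. \<forall>e\<in>F. f e = \<eta> e)"
  have "?p \<longlonglongrightarrow> \<P>(\<omega> in P. \<forall>e\<in>F. \<omega> e = \<eta> e)" "?p \<longlonglongrightarrow> \<P>(\<omega> in Q. \<forall>e\<in>F. \<omega> e = \<eta> e)"
    using lim F by blast+
  then show "\<P>(\<omega> in P. \<forall>e\<in>F. \<omega> e = \<eta> e) = \<P>(\<omega> in Q. \<forall>e\<in>F. \<omega> e = \<eta> e)"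
    by (rule LIMSEQ_unique)
qed

text \<open>
  The conditional probability that an edge is open, given that its lower endpoint does not join its upper one
  to infinity: weight \<open>p (1 - q)\<close> for an open edge against \<open>1 - p\<close> for a closed one,
  with sum \<open>1 - p q\<close>.
\<close>

definition side_prob :: "nat \<Rightarrow> real \<Rightarrow> real" where
  "side_prob d p = p * (1 - survival_prob d p) / (1 - p * survival_prob d p)"

text \<open>
  In the supercritical case \<open>(d - 1) p q = d p - 1\<close>, that is,
  \<open>d p (1 - q) = 1 - p q\<close>; so the side edges are exactly critical.
\<close>

lemma growth_params:
  assumes d: "2 \<le> d" and p: "0 \<le> p" "p < 1"
  shows "growth d (survival_prob d p) (side_prob d p)"
    and "p * survival_prob d p < 1"
    and "p \<le> 1 / real d \<Longrightarrow> side_prob d p = p"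
    and "1 / real d < p \<Longrightarrow> side_prob d p = 1 / real d"
proof -
  define q where "q = survival_prob d p"
  note q = survival_prob_fixed_point[OF d p, folded q_def]
  have "p * q \<le> p" using q p by (simp add: mult_left_le)
  then have pq: "p * q < 1" using p by simp
  then show "p * survival_prob d p < 1" by (simp add: q_def)
  show "growth d (survival_prob d p) (side_prob d p)"
    unfolding side_prob_def q_def[symmetric]
  proof
    show "0 \<le> p * (1 - q) / (1 - p * q)" using pq q(2) p by simp
    have "p * (1 - q) \<le> 1 - p * q" using p by (simp add: algebra_simps)
    then show "p * (1 - q) / (1 - p * q) \<le> 1" using pq by simp
  qed (use d q in auto)
  show "side_prob d p = p" if "p \<le> 1 / real d"
    using q(4)[OF that] by (simp add: side_prob_def q_def)
  show "side_prob d p = 1 / real d" if "1 / real d < p"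
  proof -
    have e: "(real d - 1) * (p * q) = real d * p - 1" using q(5)[OF that] by simp
    have "real d * (p * (1 - q)) = 1 - p * q"
      using e by (simp add: algebra_simps)
    then show ?thesis using pq d by (simp add: side_prob_def q_def[symmetric] field_simps)
  qed
qed

text \<open>
  By \<open>arboreal_gas_limit\<close> it suffices that the cylinder probabilities of the two types,
  multiplied by the probabilities \<open>q\<close> and \<open>1 - q\<close> of these types at the root, solve
  the limit recursion. For the factor of one branch this is \<open>p (1 - q) = (1 - p q) s\<close> and
  \<open>1 - p = (1 - p q) (1 - s)\<close>, and for the normalizing constant it is the fixed point equation of
  \<open>q\<close>.
\<close>

theorem config_law_weak_limit:
  assumes d: "2 \<le> d" and p: "0 \<le> p" "p < 1"
  shows "arboreal_gas_weak_limit d p (growth.config_law d (survival_prob d p) (side_prob d p))"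
proof -
  define q where "q = survival_prob d p"
  define s where "s = side_prob d p"
  interpret growth d q s unfolding q_def s_def by (rule growth_params[OF d p])
  note fp = survival_prob_fixed_point[OF d p, folded q_def]
  have pq: "p * q < 1" using growth_params(2)[OF d p] by (simp add: q_def)
  have s1: "(1 - p * q) * s = p * (1 - q)" using pq by (simp add: s_def side_prob_def q_def[symmetric])
  have s2: "(1 - p * q) * (1 - s) = 1 - p" using s1 by (simp add: algebra_simps)
  define D where "D = 1 + (real d - 1) * p * q"
  have D: "D > 0" unfolding D_def using d p q by (simp add: add_pos_nonneg)
  have D1: "(1 - q) * D = 1 - p * q" using fp(3) by (simp add: D_def algebra_simps)
  have D2: "q * D = real d * p * q" using fp(3) by (simp add: D_def)
  have pow: "x ^ d = x * x ^ (d - 1)" for x :: real using d by (cases d) simp_all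
  have nz: "gas_normalizer d p q \<noteq> 0" using D pq by (simp add: gas_normalizer_def D_def[symmetric])
  define l where "l b F \<eta> = (if b then q else 1 - q) * cylinder_prob b F \<eta>" for b F \<eta>
  have cyl_empty: "cylinder_prob b {} \<eta> = 1" for b \<eta>
    using prob_space by (simp add: cylinder_prob_def)
  have loose: "loose_factor p (\<lambda>b. l b (branch F i) (\<lambda>e. \<eta> (i # e))) (edge_allows F \<eta> i) =
      (1 - p * q) * prob {X. branch_agrees F \<eta> i False X}" if F: "F \<subseteq> tree_edges d" for F \<eta> i
  proof -
    have f: "p * ((1 - q) * k) = (1 - p * q) * (s * k)" "(1 - p) * k = (1 - p * q) * ((1 - s) * k)" for k
      using s1 s2 by (metis mult.assoc)+
    show ?thesis
      unfolding loose_factor_def prob_branch_agrees(2)[OF F] l_def if_True if_False f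
      by (simp add: distrib_left mult.left_commute)
  qed
  have "(\<lambda>n. \<P>(f in arboreal_gas (wired_tree n d) p. \<forall>e\<in>F. f e = \<eta> e)) \<longlonglongrightarrow> l True F \<eta> + l False F \<eta>"
    if F: "finite F" "F \<subseteq> tree_edges d" for F \<eta>
  proof (rule arboreal_gas_limit[OF d p, folded q_def])
    show "l True {} \<eta> = q" "l False {} \<eta> = 1 - q" for \<eta> by (simp_all add: l_def cyl_empty)
    fix F and \<eta> :: "vertex \<Rightarrow> bool" assume F: "F \<subseteq> tree_edges d"
    let ?G = "\<lambda>i. prob {X. branch_agrees F \<eta> i False X}"
    have "(\<Prod>i<d. loose_factor p (\<lambda>b. l b (branch F i) (\<lambda>e. \<eta> (i # e))) (edge_allows F \<eta> i)) =
        (1 - p * q) ^ d * (\<Prod>i<d. ?G i)"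
      unfolding loose[OF F] by (simp add: prod.distrib)
    also have "(1 - p * q) ^ d = (1 - q) * gas_normalizer d p q"
      unfolding pow gas_normalizer_def D_def[symmetric] by (simp add: D1[symmetric])
    finally show "l False F \<eta> = (\<Prod>i<d. loose_factor p (\<lambda>b. l b (branch F i) (\<lambda>e. \<eta> (i # e)))
        (edge_allows F \<eta> i)) / gas_normalizer d p q"
      using D pq by (simp add: l_def cylinder_prob_rec(1)[OF F] gas_normalizer_def D_def[symmetric])
    have *: "gas_normalizer d p q * (q * (1 / real d * (prob {X. branch_agrees F \<eta> j True X} * (\<Prod>i\<in>{..<d} - {j}. ?G i)))) =
        of_bool (edge_allows F \<eta> j True) * (p * l True (branch F j) (\<lambda>e. \<eta> (j # e))) *
        (\<Prod>i\<in>{..<d} - {j}. loose_factor p (\<lambda>b. l b (branch F i) (\<lambda>e. \<eta> (i # e))) (edge_allows F \<eta> i))"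
      (is "?L = ?R") if "j \<in> {..<d}" for j
    proof -
      have "?L = (1 - p * q) ^ (d - 1) * (q * D) * (1 / real d) * prob {X. branch_agrees F \<eta> j True X} * (\<Prod>i\<in>{..<d} - {j}. ?G i)"
        by (simp add: gas_normalizer_def D_def)
      also have "\<dots> = (1 - p * q) ^ (d - 1) * (p * q) * prob {X. branch_agrees F \<eta> j True X} * (\<Prod>i\<in>{..<d} - {j}. ?G i)"
        using d unfolding D2 by simp
      also have "\<dots> = ?R"
        unfolding loose[OF F] prob_branch_agrees(1)[OF F] using that
        by (simp add: prod.distrib l_def)
      finally show ?thesis .
    qed
    have "gas_normalizer d p q * l True F \<eta> = (\<Sum>j<d. gas_normalizer d p q * (q * (1 / real d *
        (prob {X. branch_agrees F \<eta> j True X} * (\<Prod>i\<in>{..<d} - {j}. ?G i)))))"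
      by (simp add: l_def cylinder_prob_rec(2)[OF F] sum_distrib_left)
    also have "\<dots> = (\<Sum>i<d. of_bool (edge_allows F \<eta> i True) * (p * l True (branch F i) (\<lambda>e. \<eta> (i # e))) *
        (\<Prod>j\<in>{..<d} - {i}. loose_factor p (\<lambda>b. l b (branch F j) (\<lambda>e. \<eta> (j # e))) (edge_allows F \<eta> j)))"
      by (intro sum.cong refl *)
    finally show "l True F \<eta> = (\<Sum>i<d. of_bool (edge_allows F \<eta> i True) * (p * l True (branch F i) (\<lambda>e. \<eta> (i # e))) *
        (\<Prod>j\<in>{..<d} - {i}. loose_factor p (\<lambda>b. l b (branch F j) (\<lambda>e. \<eta> (j # e))) (edge_allows F \<eta> j))) /
        gas_normalizer d p q"
      by (subst nonzero_eq_divide_eq[OF nz]) (simp only: mult.commute[of "l True F \<eta>"])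
  qed (use F in auto)
  moreover have "\<P>(\<omega> in config_law. \<forall>e\<in>F. \<omega> e = \<eta> e) = l True F \<eta> + l False F \<eta>"
    if F: "finite F" "F \<subseteq> tree_edges d" for F \<eta>
  proof -
    have "{\<omega> \<in> space config_law. \<forall>e\<in>F. \<omega> e = \<eta> e} \<in> sets (config_space (tree_edges d))"
    proof -
      have "Measurable.pred (config_space (tree_edges d)) (\<lambda>\<omega>. \<omega> e = \<eta> e)" if "e \<in> F" for e
      proof -
        have [measurable]: "(\<lambda>\<omega>. \<omega> e) \<in> config_space (tree_edges d) \<rightarrow>\<^sub>M count_space UNIV"
          using that F unfolding config_space_def by (intro measurable_component_singleton) auto
        show ?thesis by measurable
      qed
      then have "Measurable.pred (config_space (tree_edges d)) (\<lambda>\<omega>. \<forall>e\<in>F. \<omega> e = \<eta> e)"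
        by (rule pred_intros_countable_bounded)
      then show ?thesis unfolding config_law_def space_distr by (rule predE)
    qed
    then have "\<P>(\<omega> in config_law. \<forall>e\<in>F. \<omega> e = \<eta> e) =
        prob (config -` {\<omega> \<in> space config_law. \<forall>e\<in>F. \<omega> e = \<eta> e} \<inter> space field)"
      unfolding config_law_def by (intro measure_distr) auto
    also have "config -` {\<omega> \<in> space config_law. \<forall>e\<in>F. \<omega> e = \<eta> e} \<inter> space field = {X. agrees F \<eta> (config X)}"
      using measurable_space[OF measurable_config] by (auto simp: agrees_def config_law_def)
    finally show ?thesis by (simp add: prob_config_agrees[OF F(2)] l_def)
  qed
  ultimately show ?thesis
    unfolding arboreal_gas_weak_limit_def q_def[symmetric] s_def[symmetric]
    by (auto simp: config_law_def intro!: prob_space_distr)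
qed


section \<open>Clusters, ends and infinite descent\<close>

lemma adjacent_open_subgraph:
  "adjacent (open_subgraph (tree d) \<omega>) u w \<longleftrightarrow>
     (\<exists>i. w = u @ [i] \<and> w \<in> tree_verts d \<and> \<omega> w) \<or> (\<exists>i. u = w @ [i] \<and> u \<in> tree_verts d \<and> \<omega> u)"
proof
  assume "adjacent (open_subgraph (tree d) \<omega>) u w"
  then obtain e where e: "e \<in> tree_verts d" "e \<noteq> []" "\<omega> e" "{butlast e, e} = {u, w}"
    by (auto simp: adjacent_def open_subgraph_def tree_def)
  then have "e = butlast e @ [last e]" by simp
  moreover from e(4) have "(u = butlast e \<and> w = e) \<or> (u = e \<and> w = butlast e)"
    by (auto simp: doubleton_eq_iff)
  ultimately show "(\<exists>i. w = u @ [i] \<and> w \<in> tree_verts d \<and> \<omega> w) \<or> (\<exists>i. u = w @ [i] \<and> u \<in> tree_verts d \<and> \<omega> u)"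
    using e by metis
qed (auto simp: adjacent_def open_subgraph_def tree_def intro: bexI[of _ u] bexI[of _ w])

lemma adjacent_sym:
  "adjacent (open_subgraph (tree d) \<omega>) u w \<Longrightarrow> adjacent (open_subgraph (tree d) \<omega>) w u"
  by (auto simp: adjacent_open_subgraph)

lemma cluster_refl: "v \<in> cluster d \<omega> v"
  by (simp add: cluster_def component_of_def)

lemma cluster_sym: "w \<in> cluster d \<omega> v \<Longrightarrow> v \<in> cluster d \<omega> w"
proof -
  have "symp (adjacent (open_subgraph (tree d) \<omega>))"
    by (rule sympI) (rule adjacent_sym)
  then have "symp (adjacent (open_subgraph (tree d) \<omega>))\<^sup>*\<^sup>*" by (rule symp_rtranclp)
  then show "w \<in> cluster d \<omega> v \<Longrightarrow> v \<in> cluster d \<omega> w"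
    unfolding cluster_def component_of_def by (auto dest: sympD)
qed

lemma cluster_eq: "w \<in> cluster d \<omega> v \<Longrightarrow> cluster d \<omega> w = cluster d \<omega> v"
  using cluster_sym[of w d \<omega> v] unfolding cluster_def component_of_def
  by (auto intro: rtranclp_trans)

lemma open_below_in_cluster:
  "z @ x \<in> tree_verts d \<Longrightarrow> open_below \<omega> z x \<Longrightarrow> z @ x \<in> cluster d \<omega> z"
proof (induction x rule: rev_induct)
  case (snoc i x)
  then have "z @ x \<in> cluster d \<omega> z" and "\<omega> (z @ x @ [i])"
    by (auto simp: open_below_append open_below_Cons)
  moreover have "adjacent (open_subgraph (tree d) \<omega>) (z @ x) (z @ x @ [i])"
    using snoc.prems calculation by (auto simp: adjacent_open_subgraph)
  ultimately show ?case
    by (auto simp: cluster_def component_of_def intro: rtranclp.rtrancl_into_rtrancl)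
qed (simp add: cluster_refl)

text \<open>
  In a tree the path between two vertices climbs to a common ancestor \<open>z\<close> and descends again.
\<close>

lemma cluster_iff:
  assumes v: "v \<in> tree_verts d"
  shows "w \<in> cluster d \<omega> v \<longleftrightarrow> (\<exists>z x y. v = z @ x \<and> w = z @ y \<and> y \<in> tree_verts d \<and>
    open_below \<omega> z x \<and> open_below \<omega> z y)" (is "_ \<longleftrightarrow> ?R w")
proof
  assume "w \<in> cluster d \<omega> v"
  then have "(adjacent (open_subgraph (tree d) \<omega>))\<^sup>*\<^sup>* v w" by (simp add: cluster_def component_of_def)
  then show "?R w"
  proof (induction rule: rtranclp_induct)
    case base
    show ?case by (rule exI[of _ v], rule exI[of _ "[]"], rule exI[of _ "[]"]) simp
  next
    case (step w w')
    then obtain z x y where zxy: "v = z @ x" "w = z @ y" "y \<in> tree_verts d"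
      "open_below \<omega> z x" "open_below \<omega> z y" by blast
    from step(2) consider i where "w' = w @ [i]" "w' \<in> tree_verts d" "\<omega> w'"
      | i where "w = w' @ [i]" "\<omega> w"
      unfolding adjacent_open_subgraph by blast
    then show ?case
    proof cases
      case 1
      then have "w' = z @ (y @ [i])" "y @ [i] \<in> tree_verts d" "open_below \<omega> z (y @ [i])"
        using zxy by (auto simp: open_below_append open_below_Cons)
      then show ?thesis using zxy by blast
    next
      case 2
      show ?thesis
      proof (cases "y = []")
        case True
        then have "v = w' @ (i # x)" "w' = w' @ []" "open_below \<omega> w' (i # x)"
          using 2 zxy by (auto simp: open_below_Cons)
        then show ?thesis by (metis tree_verts_simps(1) open_below_Nil)
      next
        case False
        then obtain y' j where y: "y = y' @ [j]" by (metis rev_exhaust)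
        then have "w' = z @ y'" "y' \<in> tree_verts d" "open_below \<omega> z y'"
          using 2 zxy by (auto simp: open_below_append)
        then show ?thesis using zxy by blast
      qed
    qed
  qed
next
  assume "?R w"
  then obtain z x y where zxy: "v = z @ x" "w = z @ y" "y \<in> tree_verts d"
    "open_below \<omega> z x" "open_below \<omega> z y" by blast
  then have "v \<in> cluster d \<omega> z" "w \<in> cluster d \<omega> z"
    using v by (auto intro!: open_below_in_cluster)
  then show "w \<in> cluster d \<omega> v" using cluster_eq by blast
qed

lemma cluster_below_iff:
  assumes v: "v \<in> tree_verts d" and x: "x \<in> tree_verts d"
  shows "v @ x \<in> cluster d \<omega> v \<longleftrightarrow> open_below \<omega> v x"
proof
  assume "v @ x \<in> cluster d \<omega> v"
  then obtain z x' y where "v = z @ x'" "v @ x = z @ y" "open_below \<omega> z y"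
    unfolding cluster_iff[OF v] by blast
  then show "open_below \<omega> v x" by (auto simp: open_below_append)
qed (use open_below_in_cluster[of v x d \<omega>] v x in auto)

lemma rooted_cluster_eq:
  "v \<in> tree_verts d \<Longrightarrow> rooted_cluster d v \<omega> = (\<lambda>x\<in>tree_verts d. open_below \<omega> v x)"
  unfolding rooted_cluster_def by (intro restrict_ext) (simp add: cluster_below_iff)

lemma cluster_parent_closed:
  assumes v: "v \<in> tree_verts d" and c: "parent_closed \<omega> v"
  shows "cluster d \<omega> v = (@) v ` {x \<in> tree_verts d. open_below \<omega> v x}"
proof -
  have "w \<in> cluster d \<omega> v \<Longrightarrow> \<exists>x. w = v @ x \<and> x \<in> tree_verts d \<and> open_below \<omega> v x" for w
  proof -
    assume "w \<in> cluster d \<omega> v"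
    then obtain z x y where zxy: "v = z @ x" "w = z @ y" "y \<in> tree_verts d" "open_below \<omega> z x" "open_below \<omega> z y"
      unfolding cluster_iff[OF v] by blast
    have "x = []"
    proof (rule ccontr)
      assume "x \<noteq> []"
      then have "\<omega> (z @ x)" using zxy(4) by (simp add: open_below_def)
      then show False using c zxy \<open>x \<noteq> []\<close> by (auto simp: parent_closed_def)
    qed
    then show ?thesis using zxy by auto
  qed
  then show ?thesis using v cluster_below_iff[OF v] by blast
qed

text \<open>
  Infinite descent inside the cluster, which serves as the observable counterpart of the type: it is an event
  of the configuration, while the type is a function of the labels.
\<close>

definition infinite_below :: "nat \<Rightarrow> (vertex \<Rightarrow> bool) \<Rightarrow> vertex \<Rightarrow> bool" where
  "infinite_below d \<omega> v \<longleftrightarrow> infinite {x \<in> tree_verts d. open_below \<omega> v x}"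

lemma infinite_below_cluster:
  "v \<in> tree_verts d \<Longrightarrow> infinite_below d \<omega> v \<Longrightarrow> infinite (cluster d \<omega> v)"
proof -
  assume v: "v \<in> tree_verts d" and "infinite_below d \<omega> v"
  then have "infinite ((@) v ` {x \<in> tree_verts d. open_below \<omega> v x})"
    by (simp add: infinite_below_def finite_image_iff inj_on_def)
  then show "infinite (cluster d \<omega> v)"
    by (rule infinite_super[rotated]) (use v cluster_below_iff[OF v] in auto)
qed

lemma infinite_cluster_top:
  "v \<in> tree_verts d \<Longrightarrow> parent_closed \<omega> v \<Longrightarrow> infinite (cluster d \<omega> v) \<longleftrightarrow> infinite_below d \<omega> v"
  unfolding infinite_below_def by (simp add: cluster_parent_closed finite_image_iff inj_on_def)

text \<open>
  The cluster of \<open>v\<close> is the union of the descents from the finitely many ancestors of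
  \<open>v\<close> in it.
\<close>

lemma infinite_cluster_ancestor:
  assumes v: "v \<in> tree_verts d" and inf: "infinite (cluster d \<omega> v)"
  shows "\<exists>z x. v = z @ x \<and> open_below \<omega> z x \<and> infinite_below d \<omega> z"
proof (rule ccontr)
  assume no: "\<not> ?thesis"
  let ?Z = "{z. \<exists>x. v = z @ x \<and> open_below \<omega> z x}"
  have fin: "finite {y \<in> tree_verts d. open_below \<omega> z y}" if "z \<in> ?Z" for z
    using that no unfolding infinite_below_def by blast
  have "finite ?Z"
    by (rule finite_subset[of _ "set (prefixes v)"]) (auto simp: prefix_def)
  moreover have "cluster d \<omega> v \<subseteq> (\<Union>z\<in>?Z. (@) z ` {y \<in> tree_verts d. open_below \<omega> z y})"
    unfolding cluster_iff[OF v] subset_iff by blast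
  ultimately show False
    using inf fin by (meson finite_UN_I finite_imageI finite_subset)
qed

lemma infinite_below_child:
  "infinite_below d \<omega> v \<Longrightarrow> \<exists>i<d. \<omega> (v @ [i]) \<and> infinite_below d \<omega> (v @ [i])"
proof (rule ccontr)
  assume inf: "infinite_below d \<omega> v" and no: "\<not> (\<exists>i<d. \<omega> (v @ [i]) \<and> infinite_below d \<omega> (v @ [i]))"
  let ?I = "{i. i < d \<and> \<omega> (v @ [i])}"
  have "{x \<in> tree_verts d. open_below \<omega> v x} \<subseteq>
      insert [] (\<Union>i\<in>?I. (#) i ` {x \<in> tree_verts d. open_below \<omega> (v @ [i]) x})"
  proof
    fix x assume "x \<in> {x \<in> tree_verts d. open_below \<omega> v x}"
    then show "x \<in> insert [] (\<Union>i\<in>?I. (#) i ` {x \<in> tree_verts d. open_below \<omega> (v @ [i]) x})"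
      by (cases x) (auto simp: open_below_Cons)
  qed
  moreover have "finite (insert [] (\<Union>i\<in>?I. (#) i ` {x \<in> tree_verts d. open_below \<omega> (v @ [i]) x}))"
    using no by (auto simp: infinite_below_def)
  ultimately show False using inf unfolding infinite_below_def by (meson finite_subset)
qed

lemma infinite_below_ancestor:
  assumes "x \<in> tree_verts d" "open_below \<omega> v x" "infinite_below d \<omega> (v @ x)"
  shows "infinite_below d \<omega> v"
proof -
  have "infinite ((@) x ` {y \<in> tree_verts d. open_below \<omega> (v @ x) y})"
    using assms(3) by (simp add: infinite_below_def finite_image_iff inj_on_def)
  moreover have "(@) x ` {y \<in> tree_verts d. open_below \<omega> (v @ x) y} \<subseteq> {y \<in> tree_verts d. open_below \<omega> v y}"
    using assms by (auto simp: open_below_append)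
  ultimately show ?thesis unfolding infinite_below_def by (meson finite_subset)
qed

text \<open>
  From a vertex with infinite descent there is only one way to go down for ever. For a configuration with this
  property all infinite clusters are one-ended.
\<close>

definition unique_heir :: "nat \<Rightarrow> (vertex \<Rightarrow> bool) \<Rightarrow> bool" where
  "unique_heir d \<omega> \<longleftrightarrow> (\<forall>v\<in>tree_verts d. \<forall>i<d. \<forall>j<d.
     \<omega> (v @ [i]) \<and> infinite_below d \<omega> (v @ [i]) \<and> \<omega> (v @ [j]) \<and> infinite_below d \<omega> (v @ [j]) \<longrightarrow> i = j)"

locale heir_configuration =
  fixes d :: nat and \<omega> :: "vertex \<Rightarrow> bool"
  assumes heir: "unique_heir d \<omega>"
begin

abbreviation G :: "(vertex, vertex) multigraph" where "G \<equiv> open_subgraph (tree d) \<omega>"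

text \<open>
  The step towards the end of the cluster: down to the heir if the descent is infinite, up to the parent
  otherwise. Every infinite self-avoiding path takes these steps (\<open>path_step\<close>).
\<close>

definition next_vertex :: "vertex \<Rightarrow> vertex" where
  "next_vertex u = (if infinite_below d \<omega> u
     then u @ [SOME i. i < d \<and> \<omega> (u @ [i]) \<and> infinite_below d \<omega> (u @ [i])] else butlast u)"

lemma next_vertex_infinite:
  assumes "infinite_below d \<omega> u"
  obtains i where "next_vertex u = u @ [i]" "i < d" "\<omega> (u @ [i])" "infinite_below d \<omega> (u @ [i])"
proof -
  let ?i = "SOME i. i < d \<and> \<omega> (u @ [i]) \<and> infinite_below d \<omega> (u @ [i])"
  have "?i < d \<and> \<omega> (u @ [?i]) \<and> infinite_below d \<omega> (u @ [?i])"
    using infinite_below_child[OF assms] by (rule someI_ex)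
  then show thesis using assms by (intro that[of ?i]) (auto simp: next_vertex_def)
qed

lemma next_vertex_heir:
  assumes "u \<in> tree_verts d" "i < d" "\<omega> (u @ [i])" "infinite_below d \<omega> (u @ [i])"
  shows "next_vertex u = u @ [i]"
proof -
  have "infinite_below d \<omega> u"
    using infinite_below_ancestor[of "[i]" d \<omega> u] assms by (simp add: open_below_Cons)
  then obtain j where "next_vertex u = u @ [j]" "j < d" "\<omega> (u @ [j])" "infinite_below d \<omega> (u @ [j])"
    by (rule next_vertex_infinite)
  with heir assms show ?thesis unfolding unique_heir_def by blast
qed

context
  fixes \<gamma> :: "nat \<Rightarrow> vertex"
  assumes inj: "inj \<gamma>" and adj: "\<And>i. adjacent G (\<gamma> i) (\<gamma> (Suc i))" and start: "\<gamma> 0 \<in> tree_verts d"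
begin

lemma path_verts: "\<gamma> i \<in> tree_verts d"
proof (induction i)
  case (Suc i)
  then show ?case using adj[of i] by (auto simp: adjacent_open_subgraph)
qed (rule start)

text \<open>
  The subtree entered by a step down can only be left through the vertex from which it was entered; so the
  path stays there for ever.
\<close>

lemma path_down_infinite:
  assumes down: "\<gamma> (Suc i) = \<gamma> i @ [j]"
  shows "infinite_below d \<omega> (\<gamma> (Suc i))"
proof -
  let ?w = "\<gamma> (Suc i)"
  have stay: "\<exists>x\<in>tree_verts d. \<gamma> (Suc i + m) = ?w @ x \<and> open_below \<omega> ?w x" for m
  proof (induction m)
    case 0
    show ?case by (intro bexI[of _ "[]"]) auto
  next
    case (Suc m)
    then obtain x where x: "x \<in> tree_verts d" "\<gamma> (Suc i + m) = ?w @ x" "open_below \<omega> ?w x" by blast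
    from adj[of "Suc i + m"] consider k where "\<gamma> (Suc (Suc i + m)) = ?w @ x @ [k]"
        "\<gamma> (Suc (Suc i + m)) \<in> tree_verts d" "\<omega> (?w @ x @ [k])"
      | k where "?w @ x = \<gamma> (Suc (Suc i + m)) @ [k]"
      unfolding adjacent_open_subgraph x(2) by force
    then show ?case
    proof cases
      case 1
      then show ?thesis using x
        by (intro bexI[of _ "x @ [k]"]) (auto simp: open_below_append open_below_Cons)
    next
      case 2
      show ?thesis
      proof (cases "x = []")
        case True
        then have "\<gamma> (Suc (Suc i + m)) = \<gamma> i" using 2 down by simp
        then show ?thesis using inj by (auto dest: injD)
      next
        case False
        then obtain y k' where "x = y @ [k']" by (metis rev_exhaust)
        then show ?thesis using 2 x by (intro bexI[of _ y]) (auto simp: open_below_append)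
      qed
    qed
  qed
  have "infinite (range (\<lambda>m. \<gamma> (Suc i + m)))"
    by (intro range_inj_infinite injI) (auto dest!: injD[OF inj])
  moreover have "range (\<lambda>m. \<gamma> (Suc i + m)) \<subseteq> (@) ?w ` {x \<in> tree_verts d. open_below \<omega> ?w x}"
    using stay by blast
  ultimately show ?thesis unfolding infinite_below_def by (meson finite_imageI finite_subset)
qed

text \<open>
  Suppose that the path leaves a vertex of infinite descent upwards. This vertex is the heir of its parent, so
  the path cannot descend from the parent without returning to it. It has to go on upwards, which is possible
  only finitely often.
\<close>

lemma path_up_finite:
  assumes up: "\<gamma> i = \<gamma> (Suc i) @ [j]"
  shows "\<not> infinite_below d \<omega> (\<gamma> i)"
  using up
proof (induction "length (\<gamma> i)" arbitrary: i j rule: less_induct)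
  case less
  show ?case
  proof
    assume inf: "infinite_below d \<omega> (\<gamma> i)"
    have "\<omega> (\<gamma> (Suc i) @ [j])"
      using adj[of i] less.prems by (auto simp: adjacent_open_subgraph)
    moreover have "j < d" using path_verts[of i] less.prems by simp
    ultimately have N: "next_vertex (\<gamma> (Suc i)) = \<gamma> i" and I: "infinite_below d \<omega> (\<gamma> (Suc i))"
      using inf less.prems path_verts[of "Suc i"] next_vertex_heir[of "\<gamma> (Suc i)" j]
        infinite_below_ancestor[of "[j]" d \<omega> "\<gamma> (Suc i)"] by (auto simp: open_below_Cons)
    from adj[of "Suc i"] consider k where "\<gamma> (Suc (Suc i)) = \<gamma> (Suc i) @ [k]" "k < d" "\<omega> (\<gamma> (Suc i) @ [k])"
      | k where "\<gamma> (Suc i) = \<gamma> (Suc (Suc i)) @ [k]"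
      unfolding adjacent_open_subgraph by auto
    then show False
    proof cases
      case 1
      then have "\<gamma> (Suc (Suc i)) = \<gamma> i"
        using N path_down_infinite[OF 1(1)] path_verts[of "Suc i"] next_vertex_heir[of "\<gamma> (Suc i)" k] by simp
      then show False using inj by (auto dest: injD)
    next
      case 2
      then show False using less.hyps[OF _ 2] less.prems I by simp
    qed
  qed
qed

lemma path_step: "\<gamma> (Suc i) = next_vertex (\<gamma> i)"
proof -
  from adj[of i] consider k where "\<gamma> (Suc i) = \<gamma> i @ [k]" "k < d" "\<omega> (\<gamma> i @ [k])"
    | k where "\<gamma> i = \<gamma> (Suc i) @ [k]"
    unfolding adjacent_open_subgraph by auto
  then show ?thesis
  proof cases
    case 1
    then show ?thesis using path_down_infinite[OF 1(1)] next_vertex_heir[of "\<gamma> i" k] path_verts[of i] by simp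
  next
    case 2
    have "butlast (\<gamma> i) = \<gamma> (Suc i)" by (subst 2) simp
    then show ?thesis using path_up_finite[OF 2] by (simp add: next_vertex_def)
  qed
qed

end

text \<open>
  Climb to the lowest ancestor in the cluster with infinite descent, then follow the heirs.
\<close>

lemma infinite_sa_path_exists:
  assumes v: "v \<in> tree_verts d" and inf: "infinite (cluster d \<omega> v)"
  shows "\<exists>\<gamma>. infinite_sa_path G v \<gamma>"
proof -
  define S where "S x \<longleftrightarrow> (\<exists>z. v = z @ x \<and> open_below \<omega> z x \<and> infinite_below d \<omega> z)" for x
  obtain x0 where "S x0"
    using infinite_cluster_ancestor[OF v inf] unfolding S_def by metis
  \<comment> \<open>a shortest \<open>x\<close> belongs to a lowest ancestor\<close>
  from ex_has_least_nat[of S, OF this, of length] obtain x where x: "S x" "\<And>y. S y \<Longrightarrow> length x \<le> length y"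
    by blast
  then obtain z where z: "v = z @ x" "open_below \<omega> z x" "infinite_below d \<omega> z" by (auto simp: S_def)
  define n where "n = length x"
  define \<gamma> where "\<gamma> j = (next_vertex ^^ j) v" for j
  have \<gamma>_Suc: "\<gamma> (Suc j) = next_vertex (\<gamma> j)" for j by (simp add: \<gamma>_def)
  have not_inf: "\<not> infinite_below d \<omega> (z @ take k x)" if k: "0 < k" "k \<le> n" for k
  proof
    assume "infinite_below d \<omega> (z @ take k x)"
    moreover have "open_below \<omega> z (take k x @ drop k x)" using z by simp
    ultimately have "S (drop k x)"
      unfolding S_def open_below_append using z by (intro exI[of _ "z @ take k x"]) simp
    then show False using x(2)[of "drop k x"] k by (simp add: n_def)
  qed
  have up: "\<gamma> j = z @ take (n - j) x" if "j \<le> n" for j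
    using that
  proof (induction j)
    case 0
    then show ?case using z by (simp add: \<gamma>_def n_def)
  next
    case (Suc j)
    then have "\<gamma> (Suc j) = butlast (z @ take (n - j) x)"
      using not_inf[of "n - j"] by (simp add: \<gamma>_Suc next_vertex_def)
    also have "\<dots> = z @ take (n - Suc j) x"
      using Suc.prems by (auto simp: butlast_append butlast_take n_def)
    finally show ?case .
  qed
  have down: "infinite_below d \<omega> (\<gamma> (n + m)) \<and> length (\<gamma> (n + m)) = length z + m \<and> \<gamma> (n + m) \<in> tree_verts d" for m
  proof (induction m)
    case 0
    then show ?case using up[of n] z v by simp
  next
    case (Suc m)
    then obtain i where "next_vertex (\<gamma> (n + m)) = \<gamma> (n + m) @ [i]" "i < d"
      "infinite_below d \<omega> (\<gamma> (n + m) @ [i])"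
      using next_vertex_infinite by metis
    then show ?case using Suc by (simp add: \<gamma>_Suc)
  qed
  have "adjacent G (\<gamma> j) (\<gamma> (Suc j))" for j
  proof (cases "j < n")
    case True
    have 1: "\<gamma> j = z @ take (n - j) x" "\<gamma> (Suc j) = z @ take (n - Suc j) x"
      using True by (auto intro!: up)
    moreover have "take (n - j) x = take (n - Suc j) x @ [x ! (n - Suc j)]"
      using True by (subst take_Suc_conv_app_nth[symmetric]) (auto simp: n_def Suc_diff_Suc)
    moreover have "take (n - j) x \<noteq> []" using True by (auto simp: n_def)
    then have "\<omega> (z @ take (n - j) x)"
      using z(2) unfolding open_below_def by (simp add: take_is_prefix)
    moreover have "z @ take (n - j) x \<in> tree_verts d"
      using v z by (auto intro: tree_verts_prefix take_is_prefix)
    ultimately show ?thesis unfolding adjacent_open_subgraph by (metis append.assoc)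
  next
    case False
    then obtain m where m: "j = n + m" by (metis le_iff_add not_less)
    then obtain i where "next_vertex (\<gamma> j) = \<gamma> j @ [i]" "i < d" "\<omega> (\<gamma> j @ [i])"
      using down[of m] next_vertex_infinite by metis
    then show ?thesis using down[of m] m by (auto simp: adjacent_open_subgraph \<gamma>_Suc)
  qed
  moreover have "inj \<gamma>"
  proof (rule injI)
    have False if "i < n" "\<not> j < n" "\<gamma> i = \<gamma> j" for i j
    proof -
      obtain m where "j = n + m" using \<open>\<not> j < n\<close> by (metis le_iff_add not_less)
      then show False using that down[of m] not_inf[of "n - i"] up[of i] by simp
    qed
    note mixed = this
    fix i j assume eq: "\<gamma> i = \<gamma> j"
    show "i = j"
    proof (cases "i < n \<longleftrightarrow> j < n")
      case True
      show ?thesis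
      proof (cases "i < n")
        case i: True
        then have "length (z @ take (n - i) x) = length (z @ take (n - j) x)"
          using True eq up[of i] up[of j] by simp
        then show ?thesis using i True by (simp add: n_def)
      next
        case False
        then have "length (\<gamma> i) = length z + (i - n)" "length (\<gamma> j) = length z + (j - n)"
          using True down[of "i - n"] down[of "j - n"] by simp_all
        then show ?thesis using eq False True by simp
      qed
    next
      case False
      then show ?thesis using mixed[of i j] mixed[of j i] eq by auto
    qed
  qed
  ultimately show ?thesis by (intro exI[of _ \<gamma>]) (simp add: infinite_sa_path_def \<gamma>_def)
qed

lemma infinite_sa_path_unique:
  assumes v: "v \<in> tree_verts d" and "infinite_sa_path G v \<gamma>" "infinite_sa_path G v \<delta>"
  shows "\<gamma> = \<delta>"
proof
  fix i
  show "\<gamma> i = \<delta> i"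
  proof (induction i)
    case 0
    then show ?case using assms by (simp add: infinite_sa_path_def)
  next
    case (Suc i)
    then show ?case using path_step[of \<gamma> i] path_step[of \<delta> i] assms by (simp add: infinite_sa_path_def)
  qed
qed

theorem infinite_components_one_ended:
  assumes C: "C \<in> graph_components G" and inf: "infinite C"
  shows "one_ended G C"
  unfolding one_ended_def
proof
  fix v assume v: "v \<in> C"
  obtain u where u: "u \<in> tree_verts d" "C = cluster d \<omega> u"
    using C by (auto simp: graph_components_def cluster_def open_subgraph_def tree_def)
  have "v \<in> tree_verts d" using v u unfolding u(2) cluster_iff[OF u(1)] by auto
  moreover have "infinite (cluster d \<omega> v)" using v u inf cluster_eq by metis
  ultimately show "\<exists>!\<gamma>. infinite_sa_path G v \<gamma>"
    using infinite_sa_path_exists infinite_sa_path_unique by metis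
qed

end

text \<open>
  A cluster has only one top, so different tops have different clusters.
\<close>

lemma infinitely_many_infinite_components:
  assumes "infinite {v \<in> tree_verts d. parent_closed \<omega> v \<and> infinite_below d \<omega> v}"
  shows "infinite {C \<in> graph_components (open_subgraph (tree d) \<omega>). infinite C}"
proof -
  let ?T = "{v \<in> tree_verts d. parent_closed \<omega> v \<and> infinite_below d \<omega> v}"
  have "inj_on (cluster d \<omega>) ?T"
  proof (rule inj_onI)
    fix v w assume vw: "v \<in> ?T" "w \<in> ?T" "cluster d \<omega> v = cluster d \<omega> w"
    then have "v \<in> cluster d \<omega> w" "w \<in> cluster d \<omega> v" using cluster_refl by blast+
    moreover have "cluster d \<omega> u \<subseteq> range ((@) u)" if "u \<in> ?T" for u
      using that cluster_parent_closed[of u d \<omega>] by auto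
    ultimately have "v \<in> range ((@) w)" "w \<in> range ((@) v)" using vw by blast+
    then obtain x y where "v = w @ x" "w = v @ y" by blast
    then show "v = w" by simp
  qed
  then have "infinite (cluster d \<omega> ` ?T)" using assms by (simp add: finite_image_iff)
  moreover have "cluster d \<omega> ` ?T \<subseteq> {C \<in> graph_components (open_subgraph (tree d) \<omega>). infinite C}"
    using infinite_below_cluster
    by (auto simp: graph_components_def cluster_def open_subgraph_def tree_def)
  ultimately show ?thesis by (meson finite_subset)
qed


section \<open>Critical percolation and the typical configuration\<close>

lemma prob_not:
  assumes "Measurable.pred (product_field \<mu>) E"
  shows "measure (product_field \<mu>) {X. \<not> E X} = 1 - measure (product_field \<mu>) {X. E X}"
proof -
  interpret prob_space "product_field \<mu>" by simp
  have "{X. \<not> E X} = space (product_field \<mu>) - {X. E X}" by auto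
  then show ?thesis using prob_compl[OF sets_Collect_product_field[OF assms]] by simp
qed

lemma distr_product_field_map:
  assumes "inj t" and \<nu>: "\<And>j. \<nu> j = map_pmf (g j) (\<mu> (t j))"
  shows "distr (product_field \<mu>) (product_field \<nu>) (\<lambda>X j. g j (X (t j))) = product_field \<nu>" (is "?D = _")
proof (rule sym, unfold product_field_def[of \<nu>], rule measure_eqI_PiM_infinite)
  have m: "(\<lambda>X j. g j (X (t j))) \<in> product_field \<mu> \<rightarrow>\<^sub>M (\<Pi>\<^sub>M i\<in>UNIV. measure_pmf (\<nu> i))"
  proof (rule measurable_PiM_single')
    show "(\<lambda>X. g j (X (t j))) \<in> product_field \<mu> \<rightarrow>\<^sub>M measure_pmf (\<nu> j)" for j
      by (rule measurable_compose[OF measurable_product_field_component]) simp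
  qed auto
  interpret A: prob_space "product_field \<mu>" by simp
  interpret B: prob_space "(\<Pi>\<^sub>M i\<in>UNIV. measure_pmf (\<nu> i))"
    using prob_space_product_field[of \<nu>] by (simp add: product_field_def)
  show "finite_measure (\<Pi>\<^sub>M i\<in>UNIV. measure_pmf (\<nu> i))" by unfold_locales
  fix A J assume J: "finite J" "J \<subseteq> UNIV" "\<And>i. i \<in> J \<Longrightarrow> A i \<in> sets (measure_pmf (\<nu> i))"
  let ?S = "prod_emb UNIV (\<lambda>i. measure_pmf (\<nu> i)) J (Pi\<^sub>E J A)"
  have "emeasure (distr (product_field \<mu>) (\<Pi>\<^sub>M i\<in>UNIV. measure_pmf (\<nu> i)) (\<lambda>X j. g j (X (t j)))) ?S =
      emeasure (product_field \<mu>) {X. \<forall>j\<in>J. g j (X (t j)) \<in> A j}"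
  proof (subst emeasure_distr[OF m])
    show "?S \<in> sets (\<Pi>\<^sub>M i\<in>UNIV. measure_pmf (\<nu> i))" using J by (intro sets_PiM_I) auto
  qed (auto intro!: arg_cong[where f = "emeasure _"] simp: prod_emb_def PiE_iff)
  also have "\<dots> = (\<Prod>j\<in>J. A.prob {X. g j (X (t j)) \<in> A j})"
  proof -
    have "Measurable.pred (product_field \<mu>) (\<lambda>X. g k (X (t k)) \<in> A k)" for k
      by (rule measurable_compose[OF measurable_product_field_component]) simp
    then show ?thesis
      unfolding A.emeasure_eq_measure using assms(1) J
      by (subst prob_disjoint_blocks[where J = "\<lambda>j. {t j}"]) (auto simp: determined_by_def dest: injD)
  qed
  also have "\<dots> = (\<Prod>j\<in>J. measure (measure_pmf (\<nu> j)) (A j))"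
  proof -
    have "A.prob {X. g j (X (t j)) \<in> A j} = measure (measure_pmf (\<nu> j)) (A j)" for j
      using prob_product_field_component[of \<mu> "t j" "g j -` A j"] by (simp add: \<nu>)
    then show ?thesis by simp
  qed
  also have "\<dots> = (\<Prod>j\<in>J. emeasure (measure_pmf (\<nu> j)) (A j))"
    by (simp add: measure_pmf.emeasure_eq_measure prod_ennreal)
  also have "\<dots> = emeasure (\<Pi>\<^sub>M i\<in>UNIV. measure_pmf (\<nu> i)) ?S"
    using J by (subst emeasure_PiM_emb) (auto intro: measure_pmf.prob_space_axioms)
  finally show "emeasure (\<Pi>\<^sub>M i\<in>UNIV. measure_pmf (\<nu> i)) ?S =
    emeasure (distr (product_field \<mu>) (\<Pi>\<^sub>M i\<in>UNIV. measure_pmf (\<nu> i)) (\<lambda>X j. g j (X (t j)))) ?S" by simp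
qed auto

text \<open>
  The second Borel--Cantelli lemma for events determined by disjoint blocks.
\<close>

lemma AE_infinitely_often:
  fixes E :: "nat \<Rightarrow> ('i \<Rightarrow> 'a) \<Rightarrow> bool"
  assumes disj: "\<And>k l. k \<noteq> l \<Longrightarrow> J k \<inter> J l = {}" and det: "\<And>k. determined_by (J k) (E k)"
    and meas [measurable]: "\<And>k. Measurable.pred (product_field \<mu>) (E k)"
    and "0 < \<epsilon>" and lower: "\<And>k. \<epsilon> \<le> measure (product_field \<mu>) {X. E k X}"
  shows "AE X in product_field \<mu>. infinite {k. E k X}"
proof -
  interpret prob_space "product_field \<mu>" by simp
  have "AE X in product_field \<mu>. \<exists>k\<ge>m. E k X" for m
  proof (rule AE_I[where N = "{X. \<forall>k\<ge>m. \<not> E k X}"])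
    have "prob {X. \<forall>k\<ge>m. \<not> E k X} \<le> (1 - \<epsilon>) ^ n" for n
    proof -
      have "prob {X. \<forall>k\<ge>m. \<not> E k X} \<le> prob {X. \<forall>k\<in>{m..<m + n}. \<not> E k X}"
        by (rule finite_measure_mono) auto
      also have "\<dots> = (\<Prod>k\<in>{m..<m + n}. prob {X. \<not> E k X})"
        using det by (intro prob_disjoint_blocks[where J = J] disj) (auto simp: determined_by_def)
      also have "\<dots> \<le> (\<Prod>k\<in>{m..<m + n}. 1 - \<epsilon>)"
      proof (rule prod_mono)
        fix k
        have "prob {X. \<not> E k X} = 1 - prob {X. E k X}"
          by (rule prob_not[OF meas])
        then show "0 \<le> prob {X. \<not> E k X} \<and> prob {X. \<not> E k X} \<le> 1 - \<epsilon>" using lower[of k] by simp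
      qed
      finally show ?thesis by simp
    qed
    moreover have "(\<lambda>n. (1 - \<epsilon>) ^ n) \<longlonglongrightarrow> 0"
      using \<open>0 < \<epsilon>\<close> order_trans[OF lower[of 0] prob_le_1] by (intro LIMSEQ_power_zero) simp
    ultimately have "prob {X. \<forall>k\<ge>m. \<not> E k X} \<le> 0"
      by (intro LIMSEQ_le_const) auto
    then show "emeasure (product_field \<mu>) {X. \<forall>k\<ge>m. \<not> E k X} = 0"
      by (simp add: emeasure_eq_measure measure_le_0_iff)
    show "{X. \<forall>k\<ge>m. \<not> E k X} \<in> events" by auto
  qed auto
  then have "AE X in product_field \<mu>. \<forall>m. \<exists>k\<ge>m. E k X" by (simp add: AE_all_countable)
  then show ?thesis by eventually_elim (auto simp: infinite_nat_iff_unbounded_le)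
qed

text \<open>
  Spheres are finite. This turns infiniteness into a countable condition and so makes it measurable.
\<close>

lemma infinite_tree_verts_iff:
  assumes "A \<subseteq> tree_verts d" shows "infinite A \<longleftrightarrow> (\<forall>n. \<exists>x\<in>A. n \<le> length x)"
proof
  assume inf: "infinite A"
  show "\<forall>n. \<exists>x\<in>A. n \<le> length x"
  proof (rule ccontr)
    assume "\<not> ?thesis"
    then obtain n where "\<And>x. x \<in> A \<Longrightarrow> length x \<le> n" by (metis not_le less_imp_le)
    then have "A \<subseteq> {xs. set xs \<subseteq> {..<d} \<and> length xs \<le> n}" using assms by (auto simp: tree_verts_def)
    then show False using inf finite_lists_length_le[of "{..<d}" n] finite_subset by blast
  qed
next
  assume unb: "\<forall>n. \<exists>x\<in>A. n \<le> length x"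
  show "infinite A"
  proof
    assume "finite A"
    then obtain n where "\<And>x. x \<in> A \<Longrightarrow> length x < n"
      by (metis Max_ge finite_imageI image_eqI le_imp_less_Suc)
    then show False using unb by (meson not_le)
  qed
qed

lemma pred_open_below:
  assumes [measurable]: "\<And>e. Measurable.pred M (\<lambda>X. f X e)"
  shows "Measurable.pred M (\<lambda>X. open_below (f X) v x)"
  unfolding open_below_def by measurable

lemma pred_infinite_below:
  assumes "\<And>e. Measurable.pred M (\<lambda>X. f X e)"
  shows "Measurable.pred M (\<lambda>X. infinite_below d (f X) v)"
proof -
  note [measurable] = pred_open_below[where f = f and M = M, OF assms]
  have "infinite_below d (f X) v \<longleftrightarrow> (\<forall>n. \<exists>x. x \<in> tree_verts d \<and> open_below (f X) v x \<and> n \<le> length x)" for X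
    unfolding infinite_below_def by (subst infinite_tree_verts_iff[of _ d]) auto
  then show ?thesis by simp
qed

lemma measurable_config_component [measurable]:
  "(\<lambda>\<omega>. \<omega> e) \<in> config_space E \<rightarrow>\<^sub>M count_space UNIV"
proof (cases "e \<in> E")
  case True
  then show ?thesis unfolding config_space_def by (rule measurable_component_singleton)
next
  case False
  then have "\<omega> e = undefined" if "\<omega> \<in> space (config_space E)" for \<omega>
    using that by (auto simp: config_space_def space_PiM PiE_iff extensional_def)
  then show ?thesis by (subst measurable_cong[where g = "\<lambda>_. undefined"]) auto
qed

lemma measurable_to_config_space:
  assumes "\<And>e. e \<in> E \<Longrightarrow> Measurable.pred M (\<lambda>X. f X e)"
  shows "(\<lambda>X. \<lambda>e\<in>E. f X e) \<in> M \<rightarrow>\<^sub>M config_space E"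
  unfolding config_space_def using assms by (rule measurable_restrict)

lemma space_config_space: "space (config_space E) = E \<rightarrow>\<^sub>E UNIV"
  by (simp add: config_space_def space_PiM)

text \<open>
  Equal to \<open>rooted_cluster\<close> at every vertex of the tree, but stated by open paths: it makes sense
  for configurations on all words and is visibly determined by the edges below \<open>v\<close>.
\<close>

definition descendants :: "nat \<Rightarrow> vertex \<Rightarrow> (vertex \<Rightarrow> bool) \<Rightarrow> vertex \<Rightarrow> bool" where
  "descendants d v f = (\<lambda>x\<in>tree_verts d. open_below f v x)"

lemma measurable_descendants:
  "(\<And>e. Measurable.pred M (\<lambda>X. f X e)) \<Longrightarrow> (\<lambda>X. descendants d v (f X)) \<in> M \<rightarrow>\<^sub>M config_space (tree_verts d)"
  unfolding descendants_def by (intro measurable_to_config_space pred_open_below)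

lemma bernoulli_percolation_eq_distr:
  "bernoulli_percolation d r =
     distr (bernoulli_field r) (config_space (tree_edges d)) (\<lambda>B. restrict B (tree_edges d))"
proof -
  have "distr (bernoulli_field r) (\<Pi>\<^sub>M e\<in>tree_edges d. measure_pmf (bernoulli_pmf r)) (\<lambda>B. \<lambda>e\<in>tree_edges d. B e) =
      (\<Pi>\<^sub>M e\<in>tree_edges d. measure_pmf (bernoulli_pmf r))"
    unfolding product_field_def
    using distr_PiM_reindex[of UNIV "\<lambda>_. measure_pmf (bernoulli_pmf r)" "\<lambda>e. e" "tree_edges d"]
    by (simp add: measure_pmf.prob_space_axioms)
  moreover have "distr (bernoulli_field r) (\<Pi>\<^sub>M e\<in>tree_edges d. measure_pmf (bernoulli_pmf r)) (\<lambda>B. \<lambda>e\<in>tree_edges d. B e) =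
      distr (bernoulli_field r) (config_space (tree_edges d)) (\<lambda>B. restrict B (tree_edges d))"
    by (rule distr_cong) (auto simp: config_space_def intro!: sets_PiM_cong)
  ultimately show ?thesis by (simp add: bernoulli_percolation_def)
qed

lemma percolation_tree_eq_distr:
  "percolation_tree d r = distr (bernoulli_field r) (config_space (tree_verts d)) (descendants d [])"
proof -
  have "percolation_tree d r = distr (bernoulli_percolation d r) (config_space (tree_verts d)) (descendants d [])"
    unfolding percolation_tree_def by (intro distr_cong) (auto simp: rooted_cluster_eq descendants_def)
  also have "\<dots> = distr (bernoulli_field r) (config_space (tree_verts d)) (descendants d [] \<circ> (\<lambda>B. restrict B (tree_edges d)))"
    unfolding bernoulli_percolation_eq_distr
    by (rule distr_distr) (auto intro!: measurable_descendants measurable_to_config_space)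
  also have "\<dots> = distr (bernoulli_field r) (config_space (tree_verts d)) (descendants d [])"
  proof (rule distr_cong)
    fix B :: "vertex \<Rightarrow> bool"
    have "open_below (restrict B (tree_edges d)) [] x = open_below B [] x" if "x \<in> tree_verts d" for x
      using that by (intro open_below_cong) (auto dest: tree_verts_prefix)
    then show "(descendants d [] \<circ> (\<lambda>B. restrict B (tree_edges d))) B = descendants d [] B"
      by (auto simp: descendants_def intro!: restrict_ext)
  qed auto
  finally show ?thesis .
qed

lemma prob_space_percolation_tree [simp]: "prob_space (percolation_tree d r)"
  unfolding percolation_tree_eq_distr
  by (intro prob_space.prob_space_distr measurable_descendants) auto

lemma sets_percolation_tree [measurable_cong]: "sets (percolation_tree d r) = sets (config_space (tree_verts d))"
  by (simp add: percolation_tree_def)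

lemma determined_by_hits_boundary: "determined_by {e. e \<noteq> []} (hits_boundary d n)"
  by (rule determined_byI, rule hits_boundary_cong) auto

lemma hits_boundary_Suc_imp: "hits_boundary d (Suc n) f \<Longrightarrow> hits_boundary d n f"
proof -
  assume "hits_boundary d (Suc n) f"
  then obtain x where x: "x \<in> tree_verts d" "length x = Suc n" "open_below f [] x"
    unfolding hits_boundary_iff by blast
  have "open_below f [] (take n x @ drop n x)" using x by simp
  then show "hits_boundary d n f"
    unfolding hits_boundary_iff open_below_append using x
    by (intro bexI[of _ "take n x"]) (auto intro: tree_verts_prefix take_is_prefix)
qed

text \<open>
  By Bernoulli's inequality the generating function of a critical binomial law is strictly above the diagonal
  to the left of \<open>1\<close>.
\<close>

lemma critical_extinction_fixed_point:
  fixes L :: real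
  assumes "2 \<le> d" "0 \<le> L" "L \<le> 1" "L = 1 - (1 - 1 / real d * L) ^ d"
  shows "L = 0"
proof -
  obtain n where d: "d = Suc n" "0 < n" using assms(1) by (cases d) auto
  define x where "x = L / real d"
  have x: "0 \<le> x" "x \<le> 1" using assms d by (auto simp: x_def field_simps)
  have "1 + real n * (- x) \<le> (1 + (- x)) ^ n" using x by (intro Bernoulli_inequality) simp
  then have "(1 - x) * (1 - real n * x) \<le> (1 - x) * (1 - x) ^ n"
    using x by (intro mult_left_mono) auto
  also have "(1 - x) * (1 - x) ^ n = 1 - L" using assms(4) d by (simp add: x_def)
  finally have "(1 - x) * (1 - real n * x) \<le> 1 - real d * x" using d by (simp add: x_def)
  then have "real n * (x * x) \<le> 0" using d by (simp add: algebra_simps)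
  then have "x * x \<le> 0" using d by (simp add: mult_le_0_iff)
  then have "x = 0" using x by (simp add: mult_le_0_iff)
  then show ?thesis using d by (simp add: x_def)
qed

text \<open>
  The probabilities of reaching distance \<open>n\<close> satisfy
  \<open>\<theta> (n + 1) = 1 - (1 - \<theta> n / d) ^ d\<close>, so their limit is a fixed point of this map.
\<close>

lemma AE_critical_percolation_finite:
  assumes d: "2 \<le> d"
  shows "AE f in bernoulli_field (1 / real d). \<not> infinite_below d f []"
proof -
  define r where "r = 1 / real d"
  have r: "0 \<le> r" "r \<le> 1" using d by (auto simp: r_def)
  interpret prob_space "bernoulli_field r" by simp
  define \<theta> where "\<theta> n = prob {f. hits_boundary d n f}" for n
  have mh' [measurable]: "Measurable.pred (bernoulli_field r) (\<lambda>f. hits_boundary d n (\<lambda>e. f (i # e)))" for i n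
    by (rule pred_hits_boundary) measurable
  have rec: "\<theta> (Suc n) = 1 - (1 - r * \<theta> n) ^ d" for n
  proof -
    have "1 - \<theta> (Suc n) = prob {f. \<not> hits_boundary d (Suc n) f}"
      unfolding \<theta>_def by (rule prob_not[symmetric]) measurable
    also have "{f. \<not> hits_boundary d (Suc n) f} =
        {f. \<forall>i\<in>{..<d}. \<not> (f [i] = True \<and> hits_boundary d n (\<lambda>e. f (i # e)))}" by auto
    also have "prob \<dots> = (\<Prod>i<d. prob {f. \<not> (f [i] = True \<and> hits_boundary d n (\<lambda>e. f (i # e)))})"
      by (rule prob_disjoint_blocks[where J = "\<lambda>i. range ((#) i)"]) (auto simp: determined_by_def)
    also have "\<dots> = (\<Prod>i<d. 1 - r * \<theta> n)"
    proof (rule prod.cong)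
      fix i
      have "prob {f. f [i] = True \<and> hits_boundary d n (\<lambda>e. f (i # e))} = r * \<theta> n"
        unfolding \<theta>_def by (subst prob_child[OF r determined_by_hits_boundary]) auto
      then show "prob {f. \<not> (f [i] = True \<and> hits_boundary d n (\<lambda>e. f (i # e)))} = 1 - r * \<theta> n"
        by (subst prob_not) auto
    qed simp
    finally show ?thesis by simp
  qed
  have "decseq \<theta>"
    unfolding \<theta>_def by (intro decseq_SucI finite_measure_mono) (auto dest: hits_boundary_Suc_imp)
  then obtain L where L: "\<theta> \<longlonglongrightarrow> L"
    using decseq_convergent[of \<theta> 0] by (auto simp: \<theta>_def)
  have "L \<ge> 0" by (rule LIMSEQ_le_const[OF L]) (auto simp: \<theta>_def)
  moreover have "L \<le> 1" by (rule LIMSEQ_le_const2[OF L]) (auto simp: \<theta>_def)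
  moreover have "(\<lambda>n. \<theta> (Suc n)) \<longlonglongrightarrow> 1 - (1 - r * L) ^ d"
    unfolding rec by (intro tendsto_intros L)
  then have "L = 1 - (1 - r * L) ^ d" using LIMSEQ_unique LIMSEQ_Suc[OF L] by blast
  ultimately have "L = 0"
    using critical_extinction_fixed_point[OF d] unfolding r_def by blast
  have [measurable]: "Measurable.pred (bernoulli_field r) (\<lambda>f. infinite_below d f [])"
    by (rule pred_infinite_below) measurable
  \<comment> \<open>infinite descent reaches every distance\<close>
  have "prob {f. infinite_below d f []} \<le> \<theta> n" for n
    unfolding \<theta>_def
  proof (rule finite_measure_mono)
    show "{f. infinite_below d f []} \<subseteq> {f. hits_boundary d n f}"
    proof safe
      fix f assume "infinite_below d f []"
      then obtain x where x: "x \<in> tree_verts d" "open_below f [] x" "n \<le> length x"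
        unfolding infinite_below_def by (subst (asm) infinite_tree_verts_iff[of _ d]) auto
      have "open_below f [] (take n x @ drop n x)" using x by simp
      then show "hits_boundary d n f"
        unfolding hits_boundary_iff open_below_append using x
        by (intro bexI[of _ "take n x"]) (auto intro: tree_verts_prefix take_is_prefix)
    qed
  qed auto
  then have "prob {f. infinite_below d f []} \<le> L"
    by (intro LIMSEQ_le_const[OF L]) auto
  then have "prob {f. infinite_below d f []} = 0" using \<open>L = 0\<close> by (simp add: measure_le_0_iff)
  then show ?thesis
    unfolding r_def[symmetric] by (intro AE_I[where N = "{f. infinite_below d f []}"]) (auto simp: emeasure_eq_measure)
qed

lemma AE_percolation_tree_finite:
  assumes "2 \<le> d"
  shows "AE T in percolation_tree d (1 / real d). finite {x \<in> tree_verts d. T x}"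
proof -
  let ?r = "1 / real d"
  have "(\<lambda>B. descendants d [] B) \<in> bernoulli_field ?r \<rightarrow>\<^sub>M config_space (tree_verts d)"
    by (rule measurable_descendants) measurable
  moreover have "{T \<in> space (config_space (tree_verts d)). finite {x \<in> tree_verts d. T x}} \<in>
      sets (config_space (tree_verts d))"
  proof -
    have "infinite {x \<in> tree_verts d. T x} \<longleftrightarrow> (\<forall>n. \<exists>x. x \<in> tree_verts d \<and> T x \<and> n \<le> length x)" for T
      by (subst infinite_tree_verts_iff[of _ d]) auto
    then have "Measurable.pred (config_space (tree_verts d)) (\<lambda>T. \<not> infinite {x \<in> tree_verts d. T x})"
      by simp
    then show ?thesis by (simp add: pred_def)
  qed
  moreover have "AE B in bernoulli_field ?r. finite {x \<in> tree_verts d. descendants d [] B x}"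
    using AE_critical_percolation_finite[OF assms]
  proof eventually_elim
    case (elim B)
    have "{x \<in> tree_verts d. descendants d [] B x} = {x \<in> tree_verts d. open_below B [] x}"
      by (auto simp: descendants_def)
    then show ?case using elim by (simp add: infinite_below_def)
  qed
  ultimately show ?thesis
    unfolding percolation_tree_eq_distr by (subst AE_distr_iff)
qed

lemma open_below_edge_open_Cons:
  "open_below (edge_open X v t) [] (i # x) \<longleftrightarrow> ((t \<and> choice X v = i) \<or> side X (v @ [i])) \<and>
     open_below (edge_open X (v @ [i]) (child_type X v t i)) [] x"
proof -
  have "open_below (edge_open X v t) [i] x = open_below (\<lambda>e. edge_open X v t (i # e)) [] x"
    using open_below_shift[of "edge_open X v t" "[i]" "[]"] by simp
  also have "\<dots> = open_below (edge_open X (v @ [i]) (child_type X v t i)) [] x"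
    by (rule open_below_cong) (simp add: edge_open_Cons)
  finally show ?thesis by (simp add: open_below_Cons edge_open_single)
qed

text \<open>
  Below a non-surviving vertex a child joined by an open edge does not survive either. So inside the cluster
  all edges are given by the side labels, which form a Bernoulli field.
\<close>

lemma open_below_edge_open_False: "open_below (edge_open X v False) [] x = open_below (side X) v x"
proof (induction x arbitrary: v)
  case (Cons i x)
  show ?case
  proof (cases "side X (v @ [i])")
    case True
    then have "child_type X v False i = False" by (simp add: child_type_def)
    then show ?thesis
      unfolding open_below_edge_open_Cons open_below_Cons[of "side X"] using True Cons.IH by simp
  qed (simp add: open_below_edge_open_Cons open_below_Cons[of "side X"])
qed simp

text \<open>
  The choices lead down for ever.
\<close>

lemma infinite_below_edge_open_True:
  assumes "\<And>v. choice X v < d"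
  shows "infinite_below d (edge_open X v True) []"
proof -
  have "\<exists>x\<in>tree_verts d. open_below (edge_open X v True) [] x \<and> n \<le> length x" for n
  proof (induction n arbitrary: v)
    case (Suc n)
    then obtain x where "x \<in> tree_verts d" "open_below (edge_open X (v @ [choice X v]) True) [] x" "n \<le> length x" by blast
    then show ?case
      using assms by (intro bexI[of _ "choice X v # x"]) (auto simp: open_below_edge_open_Cons child_type_def)
  qed (auto intro: bexI[of _ "[]"])
  then show ?thesis
    unfolding infinite_below_def by (subst infinite_tree_verts_iff[of _ d]) auto
qed

lemma map_pmf_bit: "map_pmf (\<lambda>n. n = (1 :: nat)) (map_pmf of_bool \<mu>) = \<mu>"
proof -
  have "(\<lambda>n. n = (1::nat)) \<circ> of_bool = (\<lambda>b. b)" by (auto simp: fun_eq_iff)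
  then show ?thesis by (simp add: pmf.map_comp map_pmf_ident)
qed

context growth
begin

abbreviation type_of :: "(label \<Rightarrow> nat) \<Rightarrow> vertex \<Rightarrow> bool" where
  "type_of X v \<equiv> vertex_type X [] (fresh X []) v"

lemma pred_type_of [measurable]: "Measurable.pred field (\<lambda>X. type_of X v)"
  by measurable

lemma config_open_below:
  assumes "v \<in> tree_verts d" "x \<in> tree_verts d"
  shows "open_below (config X) v x = open_below (edge_open X v (type_of X v)) [] x"
proof -
  have "open_below (config X) v x = open_below (edge_open X [] (fresh X [])) v x"
    using assms by (intro open_below_cong) (auto simp: config_def dest: tree_verts_prefix)
  also have "\<dots> = open_below (\<lambda>e. edge_open X [] (fresh X []) (v @ e)) [] x"
    using open_below_shift[of "edge_open X [] (fresh X [])" v "[]"] by simp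
  also have "\<dots> = open_below (edge_open X v (type_of X v)) [] x"
    by (rule open_below_cong) (simp add: edge_open_append)
  finally show ?thesis .
qed

lemma config_snoc:
  "v @ [i] \<in> tree_verts d \<Longrightarrow> config X (v @ [i]) \<longleftrightarrow> (type_of X v \<and> choice X v = i) \<or> side X (v @ [i])"
  by (simp add: config_def edge_open_def)

lemma distr_side: "distr field (bernoulli_field s) (\<lambda>X v. side X v) = bernoulli_field s"
proof -
  show ?thesis
    unfolding field_def side_def
    using distr_product_field_map[of Side "\<lambda>_. bernoulli_pmf s" "\<lambda>_ n. n = 1" label_pmf]
    by (simp add: inj_def map_pmf_bit del: One_nat_def)
qed

lemma measurable_side: "(\<lambda>X v. side X v) \<in> field \<rightarrow>\<^sub>M bernoulli_field s"
  unfolding product_field_def by (rule measurable_PiM_single') auto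

lemma prob_side_field:
  assumes "Measurable.pred (bernoulli_field s) E"
  shows "prob {X. E (side X)} = measure (bernoulli_field s) {B. E B}"
proof -
  have "measure (bernoulli_field s) {B. E B} = measure (distr field (bernoulli_field s) (\<lambda>X v. side X v)) {B. E B}"
    by (simp add: distr_side)
  also have "\<dots> = prob {X. E (side X)}"
    using sets_Collect_product_field[OF assms] measurable_side
    by (subst measure_distr) (auto simp: vimage_def)
  finally show ?thesis by simp
qed

text \<open>
  The almost sure event outside of which nothing is claimed: the choices are children, and the side labels do
  not percolate. On it survival and infinite descent agree (\<open>regular_infinite_below\<close>).
\<close>

definition regular :: "(label \<Rightarrow> nat) \<Rightarrow> bool" where
  "regular X \<longleftrightarrow> (\<forall>v. choice X v < d) \<and> (\<forall>v. \<not> infinite_below d (side X) v)"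

lemma regular_infinite_below:
  assumes X: "regular X" and v: "v \<in> tree_verts d"
  shows "infinite_below d (config X) v \<longleftrightarrow> type_of X v"
proof -
  have "infinite_below d (config X) v \<longleftrightarrow> infinite_below d (edge_open X v (type_of X v)) []"
    unfolding infinite_below_def using config_open_below[OF v] by (metis (no_types, lifting) Collect_cong)
  moreover have "infinite_below d (edge_open X v False) [] = infinite_below d (side X) v"
    by (simp add: infinite_below_def open_below_edge_open_False)
  ultimately show ?thesis
    using X infinite_below_edge_open_True[of X d v] by (cases "type_of X v") (auto simp: regular_def)
qed

lemma regular_unique_heir:
  assumes X: "regular X" shows "unique_heir d (config X)"
proof -
  have "i = choice X v" if "v \<in> tree_verts d" "i < d" "config X (v @ [i])" "infinite_below d (config X) (v @ [i])" for v i
  proof -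
    have "type_of X (v @ [i])" using regular_infinite_below[OF X, of "v @ [i]"] that by simp
    then show ?thesis using config_snoc[of v i X] that by (auto simp: vertex_type_snoc child_type_def)
  qed
  then show ?thesis unfolding unique_heir_def by metis
qed

text \<open>
  The second child of the \<open>k\<close>-th vertex on the leftmost ray. If that vertex chooses its first
  child, the parent edge of the sprout and its type are determined by labels at the sprout; so these are
  infinitely many independent attempts to be the top of a cluster of a given type.
\<close>

definition sprout :: "nat \<Rightarrow> vertex" where
  "sprout k = replicate k 0 @ [1]"

lemma sprout_verts: "sprout k \<in> tree_verts d" "replicate k 0 \<in> tree_verts d"
  using d by (auto simp: sprout_def tree_verts_def)

lemma inj_sprout: "inj sprout"
  by (rule injI) (auto simp: sprout_def dest: arg_cong[where f = length])

definition sprout_top :: "bool \<Rightarrow> nat \<Rightarrow> (label \<Rightarrow> nat) \<Rightarrow> bool" where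
  "sprout_top b k X \<longleftrightarrow> choice X (replicate k 0) = 0 \<and> \<not> side X (sprout k) \<and> fresh X (sprout k) = b"

lemma sprout_topD:
  assumes "sprout_top b k X"
  shows "parent_closed (config X) (sprout k)" "type_of X (sprout k) = b"
proof -
  have "\<not> config X (sprout k)"
    using assms sprout_verts[of k] unfolding sprout_def sprout_top_def by (subst config_snoc) auto
  then show "parent_closed (config X) (sprout k)" by (simp add: parent_closed_def)
  show "type_of X (sprout k) = b"
    using assms unfolding sprout_def sprout_top_def by (auto simp: vertex_type_snoc child_type_def)
qed

lemma AE_infinitely_many_tops:
  assumes "s < 1" "0 < (if b then q else 1 - q)"
  shows "AE X in field. infinite {v \<in> tree_verts d. parent_closed (config X) v \<and> type_of X v = b}"
proof -
  let ?q = "if b then q else 1 - q"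
  have m [measurable]: "Measurable.pred field (sprout_top b k)" for k
    unfolding sprout_top_def by measurable
  have p: "prob {X. sprout_top b k X} = 1 / real d * ((1 - s) * ?q)" for k
  proof -
    have "prob {X. choice X (replicate k 0) = 0 \<and> (side X (sprout k) = False \<and> fresh X (sprout k) = b)} =
        prob {X. choice X (replicate k 0) = 0} * prob {X. side X (sprout k) = False \<and> fresh X (sprout k) = b}"
      by (rule prob_two_blocks'[where I = "{Choice (replicate k 0)}" and J = "{Side (sprout k), Fresh (sprout k)}"])
        (auto simp: determined_by_def side_def fresh_def)
    also have "prob {X. side X (sprout k) = False \<and> fresh X (sprout k) = b} =
        prob {X. side X (sprout k) = False} * prob {X. fresh X (sprout k) = b}"
      by (rule prob_two_blocks'[where I = "{Side (sprout k)}" and J = "{Fresh (sprout k)}"])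
        (auto simp: determined_by_def side_def fresh_def)
    finally show ?thesis
      using d unfolding prob_side prob_fresh prob_choice by (simp add: sprout_top_def)
  qed
  have "AE X in field. infinite {k. sprout_top b k X}"
    unfolding field_def
  proof (rule AE_infinitely_often[where J = "\<lambda>k. {Choice (replicate k 0), Side (sprout k), Fresh (sprout k)}"])
    show "0 < 1 / real d * ((1 - s) * ?q)" using assms d by simp
    show "1 / real d * ((1 - s) * ?q) \<le> measure (product_field label_pmf) {X. sprout_top b k X}" for k
      using p[of k] by (simp add: field_def)
    show "{Choice (replicate k 0), Side (sprout k), Fresh (sprout k)} \<inter>
        {Choice (replicate l 0), Side (sprout l), Fresh (sprout l)} = {}" if "k \<noteq> l" for k l
      using that inj_sprout by (auto dest: injD)
    show "Measurable.pred (product_field label_pmf) (sprout_top b k)" for k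
      using m by (simp add: field_def)
  qed (auto simp: determined_by_def sprout_top_def side_def fresh_def)
  then show ?thesis
  proof eventually_elim
    case (elim X)
    then have "infinite (sprout ` {k. sprout_top b k X})"
      using inj_sprout by (subst finite_image_iff) (auto intro: inj_on_subset)
    moreover have "sprout ` {k. sprout_top b k X} \<subseteq> {v \<in> tree_verts d. parent_closed (config X) v \<and> type_of X v = b}"
      using sprout_topD sprout_verts by blast
    ultimately show ?case by (rule infinite_super[rotated])
  qed
qed

end

locale supercritical = growth d q "1 / real d" for d :: nat and q :: real +
  assumes q_pos: "0 < q" and q_less: "q < 1"
begin

lemma AE_regular: "AE X in field. regular X"
proof -
  have [measurable]: "Measurable.pred field (\<lambda>X. infinite_below d (side X) v)" for v
    by (rule pred_infinite_below) measurable
  have "AE X in field. \<not> infinite_below d (side X) v" for v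
  proof -
    have mB: "Measurable.pred (bernoulli_field (1 / real d)) (\<lambda>B. infinite_below d B [])"
      by (rule pred_infinite_below) measurable
    have "prob {X. infinite_below d (side X) v} = prob {X. infinite_below d (side (shift v X)) []}"
      by (simp add: infinite_below_def open_below_def)
    also have "\<dots> = prob {X. infinite_below d (side X) []}"
      by (rule prob_shift) measurable
    also have "\<dots> = measure (bernoulli_field (1 / real d)) {B. infinite_below d B []}"
      by (rule prob_side_field[OF mB])
    also have "\<dots> = 0"
    proof -
      interpret B: prob_space "bernoulli_field (1 / real d)" by simp
      have "B.prob {B. infinite_below d B []} = B.prob {}"
        using AE_critical_percolation_finite[OF d] mB by (intro B.finite_measure_eq_AE) auto
      then show ?thesis by simp
    qed
    finally show ?thesis
      by (intro AE_I[where N = "{X. infinite_below d (side X) v}"]) (auto simp: emeasure_eq_measure)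
  qed
  then show ?thesis using AE_choice unfolding regular_def by (simp add: AE_all_countable)
qed

lemma pred_config_law_unique_heir [measurable]: "Measurable.pred (config_space (tree_edges d)) (unique_heir d)"
proof -
  have [measurable]: "Measurable.pred (config_space (tree_edges d)) (\<lambda>\<omega>. infinite_below d \<omega> v)" for v
    by (rule pred_infinite_below) measurable
  show ?thesis unfolding unique_heir_def by measurable
qed

lemma AE_config_lawI:
  assumes "Measurable.pred (config_space (tree_edges d)) Q" "AE X in field. Q (config X)"
  shows "AE \<omega> in config_law. Q \<omega>"
  unfolding config_law_def using assms by (subst AE_distr_iff) (auto simp: pred_def)

lemma AE_unique_heir: "AE \<omega> in config_law. unique_heir d \<omega>"
  by (rule AE_config_lawI) (use AE_regular in \<open>auto intro: regular_unique_heir elim: eventually_mono\<close>)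

lemma AE_tops:
  "AE \<omega> in config_law. infinite {v \<in> tree_verts d. parent_closed \<omega> v \<and> infinite_below d \<omega> v = b}"
proof (rule AE_config_lawI)
  have [measurable]: "Measurable.pred (config_space (tree_edges d)) (\<lambda>\<omega>. infinite_below d \<omega> v)" for v
    by (rule pred_infinite_below) measurable
  have [measurable]: "Measurable.pred (config_space (tree_edges d)) (\<lambda>\<omega>. parent_closed \<omega> v)" for v
    unfolding parent_closed_def by measurable
  have "infinite {v \<in> tree_verts d. parent_closed \<omega> v \<and> infinite_below d \<omega> v = b} \<longleftrightarrow>
      (\<forall>n. \<exists>v. v \<in> tree_verts d \<and> parent_closed \<omega> v \<and> infinite_below d \<omega> v = b \<and> n \<le> length v)" for \<omega>
    by (subst infinite_tree_verts_iff[of _ d]) auto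
  then show "Measurable.pred (config_space (tree_edges d))
      (\<lambda>\<omega>. infinite {v \<in> tree_verts d. parent_closed \<omega> v \<and> infinite_below d \<omega> v = b})" by simp
  have "1 / real d < 1" "0 < (if b then q else 1 - q)" using d q_pos q_less by auto
  from AE_infinitely_many_tops[OF this] AE_regular
  show "AE X in field. infinite {v \<in> tree_verts d. parent_closed (config X) v \<and> infinite_below d (config X) v = b}"
  proof eventually_elim
    case (elim X)
    have "{v \<in> tree_verts d. parent_closed (config X) v \<and> infinite_below d (config X) v = b} =
        {v \<in> tree_verts d. parent_closed (config X) v \<and> type_of X v = b}"
      using regular_infinite_below[OF elim(2)] by auto
    then show ?case using elim(1) by simp
  qed
qed

end


section \<open>Branching processes and the randomness of the spine\<close>

lemma determined_by_compose: "determined_by J f \<Longrightarrow> determined_by J (\<lambda>X. h (f X))"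
  unfolding determined_by_def by metis

text \<open>
  \<open>prob_disjoint_blocks\<close> for functions instead of events.
\<close>

lemma indep_vars_disjoint_blocks:
  assumes disj: "\<And>k l. k \<in> K \<Longrightarrow> l \<in> K \<Longrightarrow> k \<noteq> l \<Longrightarrow> J k \<inter> J l = {}"
    and det: "\<And>k. k \<in> K \<Longrightarrow> determined_by (J k) (f k)"
    and meas: "\<And>k. k \<in> K \<Longrightarrow> f k \<in> product_field \<mu> \<rightarrow>\<^sub>M N k"
  shows "prob_space.indep_vars (product_field \<mu>) N f K"
proof -
  interpret prob_space "product_field \<mu>" by simp
  show ?thesis
    unfolding indep_vars_def2
  proof (intro conjI ballI indep_setsI)
    show "random_variable (N k) (f k)" if "k \<in> K" for k by (rule meas[OF that])
    show "{f k -` A \<inter> space (product_field \<mu>) |A. A \<in> sets (N k)} \<subseteq> events" if "k \<in> K" for k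
      using measurable_sets[OF meas[OF that]] by auto
  next
    fix A I assume I: "I \<noteq> {}" "I \<subseteq> K" "finite I"
      and A: "\<forall>j\<in>I. A j \<in> {f j -` A \<inter> space (product_field \<mu>) |A. A \<in> sets (N j)}"
    from A have "\<forall>j\<in>I. \<exists>B. B \<in> sets (N j) \<and> A j = {X. f j X \<in> B}" by (auto simp: vimage_def)
    then obtain B where B: "\<And>j. j \<in> I \<Longrightarrow> B j \<in> sets (N j)" "\<And>j. j \<in> I \<Longrightarrow> A j = {X. f j X \<in> B j}"
      by metis
    have "(\<Inter>j\<in>I. A j) = {X. \<forall>j\<in>I. f j X \<in> B j}" using B(2) by auto
    also have "prob \<dots> = (\<Prod>j\<in>I. prob {X. f j X \<in> B j})"
    proof (rule prob_disjoint_blocks[where J = J])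
      show "determined_by (J k) (\<lambda>X. f k X \<in> B k)" if "k \<in> I" for k
        using det[of k] that I unfolding determined_by_def by (metis subsetD)
      show "Measurable.pred (product_field \<mu>) (\<lambda>X. f k X \<in> B k)" if "k \<in> I" for k
        using that I by (intro pred_sets2[OF B(1) meas]) auto
    qed (use disj I in auto)
    finally show "prob (\<Inter>j\<in>I. A j) = (\<Prod>j\<in>I. prob (A j))" using B(2) by simp
  qed
qed

lemma distr_pair_blocks:
  assumes "I \<inter> J = {}" "determined_by I f" "determined_by J g"
    and "f \<in> product_field \<mu> \<rightarrow>\<^sub>M N" "g \<in> product_field \<mu> \<rightarrow>\<^sub>M L"
  shows "distr (product_field \<mu>) (N \<Otimes>\<^sub>M L) (\<lambda>X. (f X, g X)) = distr (product_field \<mu>) N f \<Otimes>\<^sub>M distr (product_field \<mu>) L g"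
proof -
  interpret prob_space "product_field \<mu>" by simp
  let ?F = "\<lambda>X. (f X, g X)"
  interpret A: prob_space "distr (product_field \<mu>) N f" by (rule prob_space_distr) fact
  interpret B: prob_space "distr (product_field \<mu>) L g" by (rule prob_space_distr) fact
  interpret pair_sigma_finite "distr (product_field \<mu>) N f" "distr (product_field \<mu>) L g" ..
  have F: "?F \<in> product_field \<mu> \<rightarrow>\<^sub>M N \<Otimes>\<^sub>M L" using assms by simp
  show ?thesis
  proof (rule pair_measure_eqI[symmetric])
    fix A B assume A: "A \<in> sets (distr (product_field \<mu>) N f)" and B: "B \<in> sets (distr (product_field \<mu>) L g)"
    have fA: "Measurable.pred (product_field \<mu>) (\<lambda>X. f X \<in> A)"
      using A by (intro pred_sets2[OF _ assms(4)]) simp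
    have gB: "Measurable.pred (product_field \<mu>) (\<lambda>X. g X \<in> B)"
      using B by (intro pred_sets2[OF _ assms(5)]) simp
    have "emeasure (distr (product_field \<mu>) (N \<Otimes>\<^sub>M L) ?F) (A \<times> B) = prob {X. f X \<in> A \<and> g X \<in> B}"
      using A B by (subst emeasure_distr[OF F]) (auto simp: emeasure_eq_measure vimage_def)
    also have "prob {X. f X \<in> A \<and> g X \<in> B} = prob {X. f X \<in> A} * prob {X. g X \<in> B}"
      using assms fA gB
      by (intro prob_two_blocks[where I = I and J = J])
        (auto intro: determined_by_compose[of I f "\<lambda>x. x \<in> A"] determined_by_compose[of J g "\<lambda>x. x \<in> B"])
    also have "ennreal \<dots> = emeasure (distr (product_field \<mu>) N f) A * emeasure (distr (product_field \<mu>) L g) B"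
      using A B assms by (simp add: emeasure_distr emeasure_eq_measure ennreal_mult vimage_def)
    finally show "emeasure (distr (product_field \<mu>) N f) A * emeasure (distr (product_field \<mu>) L g) B =
      emeasure (distr (product_field \<mu>) (N \<Otimes>\<^sub>M L) ?F) (A \<times> B)" by simp
  qed (use A.sigma_finite_measure_axioms B.sigma_finite_measure_axioms in \<open>auto intro!: sets_pair_measure_cong\<close>)
qed

lemma prob_product_field_map:
  assumes "inj t" and \<nu>: "\<And>j. \<nu> j = map_pmf (g j) (\<mu> (t j))" and E: "Measurable.pred (product_field \<nu>) E"
  shows "measure (product_field \<mu>) {X. E (\<lambda>j. g j (X (t j)))} = measure (product_field \<nu>) {X. E X}"
proof -
  have m: "(\<lambda>X j. g j (X (t j))) \<in> product_field \<mu> \<rightarrow>\<^sub>M product_field \<nu>"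
    unfolding product_field_def[of \<nu>]
  proof (rule measurable_PiM_single')
    show "(\<lambda>X. g j (X (t j))) \<in> product_field \<mu> \<rightarrow>\<^sub>M measure_pmf (\<nu> j)" for j
      by (rule measurable_compose[OF measurable_product_field_component]) simp
  qed auto
  have "measure (product_field \<nu>) {X. E X} =
      measure (distr (product_field \<mu>) (product_field \<nu>) (\<lambda>X j. g j (X (t j)))) {X. E X}"
    using distr_product_field_map[of t \<nu> g \<mu>] assms(1,2) by simp
  also have "\<dots> = measure (product_field \<mu>) {X. E (\<lambda>j. g j (X (t j)))}"
    using sets_Collect_product_field[OF E] m by (subst measure_distr) (simp_all add: vimage_def)
  finally show ?thesis by simp
qed

lemma prob_partition_AE:
  assumes "finite S" and AE: "AE X in product_field \<mu>. f X \<in> S"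
    and [measurable]: "\<And>a. Measurable.pred (product_field \<mu>) (\<lambda>X. f X = a)" "Measurable.pred (product_field \<mu>) E"
  shows "measure (product_field \<mu>) {X. E X} = (\<Sum>a\<in>S. measure (product_field \<mu>) {X. f X = a \<and> E X})"
proof -
  interpret prob_space "product_field \<mu>" by simp
  have m [measurable]: "Measurable.pred (product_field \<mu>) (\<lambda>X. \<exists>a\<in>S. f X = a \<and> E X)"
    using assms(1) by measurable
  have "prob {X. E X} = prob {X. \<exists>a\<in>S. f X = a \<and> E X}"
  proof (rule finite_measure_eq_AE)
    show "AE X in product_field \<mu>. (X \<in> {X. E X}) = (X \<in> {X. \<exists>a\<in>S. f X = a \<and> E X})"
      using AE by eventually_elim auto
    show "{X. \<exists>a\<in>S. f X = a \<and> E X} \<in> events" by (rule sets_Collect_product_field[OF m])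
  qed auto
  also have "\<dots> = (\<Sum>a\<in>S. prob {X. f X = a \<and> E X})"
    by (rule prob_finite_partition[OF assms(1)]) auto
  finally show ?thesis .
qed

text \<open>
  The binomial law is the law of the number of successes in a product of Bernoulli laws over a finite set; by
  \<open>prob_finite_determined\<close> the field may be replaced by this finite product.
\<close>

lemma prob_card_binomial:
  assumes S: "finite S" and r: "0 \<le> r" "r \<le> 1"
  shows "measure (product_field (\<lambda>_. bernoulli_pmf r)) {B. card {i \<in> S. B i} \<in> A} =
    measure_pmf.prob (binomial_pmf (card S) r) A"
proof -
  let ?P = "Pi_pmf S undefined (\<lambda>_. bernoulli_pmf r)"
  let ?F = "{f \<in> S \<rightarrow>\<^sub>E UNIV. card {i \<in> S. f i} \<in> A}"
  have "measure_pmf.prob (binomial_pmf (card S) r) A = measure_pmf.prob ?P {f. card {i \<in> S. f i} \<in> A}"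
    using r by (subst binomial_pmf_altdef'[OF S refl, where dflt = undefined]) (simp_all add: vimage_def)
  also have "\<dots> = measure_pmf.prob ?P ?F"
  proof (rule measure_pmf.finite_measure_eq_AE)
    have "f \<in> S \<rightarrow>\<^sub>E UNIV" if "f \<in> set_pmf ?P" for f
      using that pmf_Pi_outside[OF S, of f undefined] by (auto simp: set_pmf_iff PiE_iff extensional_def)
    then show "AE f in ?P. (f \<in> {f. card {i \<in> S. f i} \<in> A}) = (f \<in> ?F)"
      by (simp add: AE_measure_pmf_iff)
  qed auto
  also have "\<dots> = (\<Sum>f\<in>?F. pmf ?P f)"
    using S by (intro measure_measure_pmf_finite) (simp add: finite_PiE)
  also have "\<dots> = (\<Sum>f\<in>?F. \<Prod>x\<in>S. pmf (bernoulli_pmf r) (f x))"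
    using S by (intro sum.cong refl pmf_Pi') (auto simp: PiE_iff extensional_def)
  also have "\<dots> = (\<Sum>f\<in>S \<rightarrow>\<^sub>E UNIV. if card {i \<in> S. f i} \<in> A then \<Prod>x\<in>S. pmf (bernoulli_pmf r) (f x) else 0)"
    using S by (intro sum.mono_neutral_cong_left) (auto simp: finite_PiE)
  also have "\<dots> = measure (product_field (\<lambda>_. bernoulli_pmf r)) {B. card {i \<in> S. B i} \<in> A}"
  proof (rule prob_finite_determined[OF S, symmetric], rule determined_byI)
    fix X Y :: "'a \<Rightarrow> bool" assume "\<And>j. j \<in> S \<Longrightarrow> X j = Y j"
    then have "{i \<in> S. X i} = {i \<in> S. Y i}" by blast
    then show "(card {i \<in> S. X i} \<in> A) = (card {i \<in> S. Y i} \<in> A)" by simp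
  qed
  finally show ?thesis by simp
qed

lemma expectation_binomial_pmf: "0 \<le> r \<Longrightarrow> r \<le> 1 \<Longrightarrow> measure_pmf.expectation (binomial_pmf n r) real = real n * r"
  using sum_k_Bernstein[of n r] by (subst expectation_binomial_pmf') (simp_all add: Bernstein_def mult.commute)

lemma pred_card_eq:
  fixes S :: "'i set"
  assumes "finite S" and [measurable]: "\<And>i. Measurable.pred M (\<lambda>X. P X i)"
  shows "Measurable.pred M (\<lambda>X. card {i \<in> S. P X i} = k)"
proof -
  have "card {i \<in> S. P X i} = k \<longleftrightarrow> (\<exists>T\<in>Pow S. card T = k \<and> (\<forall>i\<in>S. P X i \<longleftrightarrow> i \<in> T))" for X
  proof
    assume "card {i \<in> S. P X i} = k"
    then show "\<exists>T\<in>Pow S. card T = k \<and> (\<forall>i\<in>S. P X i \<longleftrightarrow> i \<in> T)"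
      by (intro bexI[of _ "{i \<in> S. P X i}"]) auto
  next
    assume "\<exists>T\<in>Pow S. card T = k \<and> (\<forall>i\<in>S. P X i \<longleftrightarrow> i \<in> T)"
    then obtain T where T: "T \<subseteq> S" "card T = k" "\<And>i. i \<in> S \<Longrightarrow> P X i \<longleftrightarrow> i \<in> T" by auto
    then have "{i \<in> S. P X i} = T" by auto
    then show "card {i \<in> S. P X i} = k" using T by simp
  qed
  then show ?thesis using assms(1) by simp
qed

lemma pred_card_in:
  fixes S :: "'i set"
  assumes "finite S" and "\<And>i. Measurable.pred M (\<lambda>X. P X i)"
  shows "Measurable.pred M (\<lambda>X. card {i \<in> S. P X i} \<in> A)"
proof -
  have [measurable]: "Measurable.pred M (\<lambda>X. card {i \<in> S. P X i} = k)" for k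
    using assms by (rule pred_card_eq)
  have "Measurable.pred M (\<lambda>X. \<exists>k. k \<in> A \<and> card {i \<in> S. P X i} = k)" by measurable
  then show ?thesis by simp
qed

lemma prob_child_count:
  assumes r: "0 \<le> r" "r \<le> 1"
  shows "measure (bernoulli_field r) {B. card {i. i < d \<and> B (x @ [i])} = k} = pmf (binomial_pmf d r) k"
proof -
  have "measure (bernoulli_field r) {B. (\<lambda>B. card {i \<in> {..<d}. B i} = k) (\<lambda>i. B (x @ [i]))} =
      measure (product_field (\<lambda>_::nat. bernoulli_pmf r)) {B. card {i \<in> {..<d}. B i} = k}"
    by (rule prob_product_field_reindex) (auto simp: inj_def intro!: pred_card_eq)
  also have "\<dots> = pmf (binomial_pmf d r) k"
    using prob_card_binomial[OF _ r, of "{..<d}" "{k}"] by (simp add: measure_pmf_single)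
  finally show ?thesis by simp
qed

lemma measurable_descendants' [measurable]:
  "descendants d v \<in> bernoulli_field r \<rightarrow>\<^sub>M config_space (tree_verts d)"
  by (rule measurable_descendants) measurable

lemma generations_descendants:
  "generations d n (descendants d [] B) = {x \<in> tree_verts d. length x \<le> n \<and> open_below B [] x}"
  by (auto simp: generations_def descendants_def)

text \<open>
  The first \<open>n\<close> generations are determined by edges at distance at most \<open>n\<close> from the
  root, and the numbers of children in generation \<open>n\<close> by disjoint sets of edges at distance
  \<open>n + 1\<close>.
\<close>

lemma percolation_tree_branching_process:
  assumes r: "0 \<le> r" "r \<le> 1"
  shows "branching_process d (binomial_pmf d r) (percolation_tree d r)"
  unfolding branching_process_def
proof (intro conjI allI)
  show "prob_space (percolation_tree d r)" by simp
  show "sets (percolation_tree d r) = sets (config_space (tree_verts d))" by (simp add: percolation_tree_def)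
  interpret prob_space "bernoulli_field r" by simp
  show "AE T in percolation_tree d r. T [] \<and> (\<forall>x\<in>tree_verts d. \<forall>i<d. T (x @ [i]) \<longrightarrow> T x)"
    unfolding percolation_tree_eq_distr
  proof (subst AE_distr_iff[OF measurable_descendants'])
    have "Measurable.pred (config_space (tree_verts d)) (\<lambda>T. T [] \<and> (\<forall>x\<in>tree_verts d. \<forall>i<d. T (x @ [i]) \<longrightarrow> T x))"
      by measurable
    then show "{T \<in> space (config_space (tree_verts d)). T [] \<and> (\<forall>x\<in>tree_verts d. \<forall>i<d. T (x @ [i]) \<longrightarrow> T x)} \<in>
        sets (config_space (tree_verts d))" by (simp add: pred_def)
  qed (auto simp: descendants_def open_below_append)
  fix n and S :: "vertex set" and \<kappa> :: "vertex \<Rightarrow> nat"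
  let ?Sn = "{x \<in> S. length x = n}"
  define G where "G B \<longleftrightarrow> {x \<in> tree_verts d. length x \<le> n \<and> open_below B [] x} = S" for B
  have pred_eq: "Measurable.pred M (\<lambda>X. {x \<in> A. Q X x} = S)" if "\<And>x. Measurable.pred M (\<lambda>X. Q X x)"
    for M :: "'z measure" and A :: "vertex set" and Q
  proof -
    have "{x \<in> A. Q X x} = S \<longleftrightarrow> (\<forall>x. x \<in> A \<and> Q X x \<longleftrightarrow> x \<in> S)" for X by auto
    then show ?thesis using that by simp
  qed
  have mG [measurable]: "Measurable.pred (bernoulli_field r) G"
    unfolding G_def by (rule pred_eq) (use pred_open_below[where f = "\<lambda>B. B"] in measurable)
  have m_gen: "Measurable.pred (config_space (tree_verts d)) (\<lambda>T. generations d n T = S)"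
    unfolding generations_def by (rule pred_eq) measurable
  have m_off: "Measurable.pred (config_space (tree_verts d)) (\<lambda>T. \<forall>x\<in>S. length x = n \<longrightarrow> offspring d T x = \<kappa> x)"
    unfolding offspring_def by measurable
  have prob_tree: "\<P>(T in percolation_tree d r. E T) = prob {B. E (descendants d [] B)}"
    if E: "Measurable.pred (config_space (tree_verts d)) E" for E
  proof -
    have "{T \<in> space (config_space (tree_verts d)). E T} \<in> sets (config_space (tree_verts d))"
      using predE[OF E] .
    then have "\<P>(T in percolation_tree d r. E T) =
        prob (descendants d [] -` {T \<in> space (config_space (tree_verts d)). E T} \<inter> space (bernoulli_field r))"
      unfolding percolation_tree_eq_distr space_distr by (rule measure_distr[OF measurable_descendants'])
    also have "descendants d [] -` {T \<in> space (config_space (tree_verts d)). E T} \<inter> space (bernoulli_field r) =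
        {B. E (descendants d [] B)}"
      using measurable_space[OF measurable_descendants'[of d "[]" r]] by auto
    finally show ?thesis .
  qed
  have m_both: "Measurable.pred (config_space (tree_verts d))
      (\<lambda>T. generations d n T = S \<and> (\<forall>x\<in>S. length x = n \<longrightarrow> offspring d T x = \<kappa> x))"
    using m_gen m_off by measurable
  have "{B. generations d n (descendants d [] B) = S \<and>
        (\<forall>x\<in>S. length x = n \<longrightarrow> offspring d (descendants d [] B) x = \<kappa> x)} =
      {B. G B \<and> (\<forall>x\<in>?Sn. card {i. i < d \<and> B (x @ [i])} = \<kappa> x)}" (is "?L = ?R")
  proof -
    have "offspring d (descendants d [] B) x = card {i. i < d \<and> B (x @ [i])}" if "G B" "x \<in> S" for B x
    proof -
      have "x \<in> tree_verts d" "open_below B [] x" using that by (auto simp: G_def)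
      then show ?thesis
        by (auto simp: offspring_def descendants_def open_below_append open_below_Cons intro!: arg_cong[where f = card])
    qed
    then show ?thesis by (auto simp: generations_descendants G_def)
  qed
  also have "prob ?R = prob {B. G B} * (\<Prod>x\<in>?Sn. pmf (binomial_pmf d r) (\<kappa> x))"
  proof (cases "\<exists>B. G B")
    case True
    then have S: "S \<subseteq> {xs. set xs \<subseteq> {..<d} \<and> length xs \<le> n}"
      by (auto simp: G_def tree_verts_def)
    have "finite S" by (rule finite_subset[OF S]) (rule finite_lists_length_le, simp)
    then have fin: "finite ?Sn" by simp
    have m_cnt [measurable]: "Measurable.pred (bernoulli_field r) (\<lambda>B. card {i. i < d \<and> B (x @ [i])} = \<kappa> x)" for x
      using pred_card_eq[where S = "{..<d}" and M = "bernoulli_field r" and P = "\<lambda>B i. B (x @ [i])" and k = "\<kappa> x"] by simp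
    have m_all: "Measurable.pred (bernoulli_field r) (\<lambda>B. \<forall>x\<in>?Sn. card {i. i < d \<and> B (x @ [i])} = \<kappa> x)"
      by (rule pred_intros_countable_bounded) (rule m_cnt)
    have "prob ?R = prob {B. G B} * prob {B. \<forall>x\<in>?Sn. card {i. i < d \<and> B (x @ [i])} = \<kappa> x}"
    proof (rule prob_two_blocks[where I = "{e. length e \<le> n}" and J = "{e. n < length e}"])
      show "determined_by {e. length e \<le> n} G"
      proof (rule determined_byI)
        fix X Y :: "vertex \<Rightarrow> bool" assume XY: "\<And>e. e \<in> {e. length e \<le> n} \<Longrightarrow> X e = Y e"
        have "open_below X [] x = open_below Y [] x" if "length x \<le> n" for x
          using that by (intro open_below_cong XY) (auto dest: prefix_length_le)
        then have "{x \<in> tree_verts d. length x \<le> n \<and> open_below X [] x} =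
            {x \<in> tree_verts d. length x \<le> n \<and> open_below Y [] x}"
          by (intro Collect_cong conj_cong refl) simp
        then show "G X = G Y" unfolding G_def by (rule arg_cong)
      qed
    qed (use m_all in \<open>auto simp: determined_by_def\<close>)
    also have "prob {B. \<forall>x\<in>?Sn. card {i. i < d \<and> B (x @ [i])} = \<kappa> x} =
        (\<Prod>x\<in>?Sn. prob {B. card {i. i < d \<and> B (x @ [i])} = \<kappa> x})"
      by (rule prob_disjoint_blocks[OF fin, where J = "\<lambda>x. range (\<lambda>i. x @ [i])"])
        (auto simp: determined_by_def)
    finally show ?thesis by (simp add: prob_child_count[OF r])
  next
    case False
    then have e: "{B. G B} = {}" "?R = {}" by auto
    show ?thesis unfolding e by simp
  qed
  finally show "\<P>(T in percolation_tree d r. generations d n T = S \<and> (\<forall>x\<in>S. length x = n \<longrightarrow> offspring d T x = \<kappa> x)) =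
      \<P>(T in percolation_tree d r. generations d n T = S) * (\<Prod>x | x \<in> S \<and> length x = n. pmf (binomial_pmf d r) (\<kappa> x))"
    unfolding prob_tree[OF m_both] prob_tree[OF m_gen] generations_descendants G_def by simp
qed

text \<open>
  A product field that realises the input of \<open>spine_cluster\<close> (see
  \<open>spine_space_eq_distr\<close>): \<open>Turn k\<close> is the step \<open>\<xi> k\<close>,
  \<open>Gate w\<close> is the state \<open>\<eta> w\<close>, and the \<open>Bush w e\<close> are the edges of
  the percolation whose cluster at the root is \<open>\<tau> w\<close>.
\<close>

datatype spine_label = Turn nat | Gate vertex | Bush vertex vertex

fun spine_label_pmf :: "nat \<Rightarrow> spine_label \<Rightarrow> nat pmf" where
  "spine_label_pmf d (Turn k) = pmf_of_set {..<d}"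
| "spine_label_pmf d (Gate w) = map_pmf of_bool (bernoulli_pmf (1 / real d))"
| "spine_label_pmf d (Bush w e) = map_pmf of_bool (bernoulli_pmf (1 / real d))"

abbreviation spine_field :: "nat \<Rightarrow> (spine_label \<Rightarrow> nat) measure" where
  "spine_field d \<equiv> product_field (spine_label_pmf d)"

abbreviation turn :: "(spine_label \<Rightarrow> nat) \<Rightarrow> nat \<Rightarrow> nat" where "turn Y k \<equiv> Y (Turn k)"
definition gate :: "(spine_label \<Rightarrow> nat) \<Rightarrow> vertex \<Rightarrow> bool" where "gate Y w \<longleftrightarrow> Y (Gate w) = 1"
definition bush :: "(spine_label \<Rightarrow> nat) \<Rightarrow> vertex \<Rightarrow> vertex \<Rightarrow> bool" where "bush Y w e \<longleftrightarrow> Y (Bush w e) = 1"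

definition spine_input :: "nat \<Rightarrow> (spine_label \<Rightarrow> nat) \<Rightarrow> spine_sample" where
  "spine_input d Y = (turn Y, restrict (gate Y) (tree_edges d), \<lambda>w\<in>tree_edges d. descendants d [] (bush Y w))"

lemma pred_gate_bush [measurable]:
  "Measurable.pred (product_field \<mu>) (\<lambda>Y. gate Y w)" "Measurable.pred (product_field \<mu>) (\<lambda>Y. bush Y w e)"
  unfolding gate_def bush_def by measurable

lemma sets_bernoulli_percolation [measurable_cong]:
  "sets (bernoulli_percolation d r) = sets (config_space (tree_edges d))"
  unfolding bernoulli_percolation_def config_space_def by (rule sets_PiM_cong) auto

lemma spine_space_eq_distr:
  assumes d: "2 \<le> d"
  shows "spine_space d = distr (spine_field d) (spine_space d) (spine_input d)"
proof -
  let ?F = "spine_field d" and ?r = "1 / real d"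
  let ?U = "\<Pi>\<^sub>M k\<in>(UNIV :: nat set). measure_pmf (pmf_of_set {..<d})"
  let ?B = "bernoulli_percolation d ?r"
  let ?T = "\<Pi>\<^sub>M w\<in>tree_edges d. percolation_tree d ?r"
  let ?g = "\<lambda>Y. restrict (gate Y) (tree_edges d)" and ?t = "\<lambda>Y. \<lambda>w\<in>tree_edges d. descendants d [] (bush Y w)"
  interpret prob_space ?F by simp
  have U: "distr ?F ?U turn = ?U"
    using distr_product_field_map[of Turn "\<lambda>_. pmf_of_set {..<d}" "\<lambda>_ n. n" "spine_label_pmf d"]
    by (simp add: inj_def map_pmf_ident product_field_def[of "\<lambda>_. pmf_of_set {..<d}"])
  have mB: "(\<lambda>Y e. gate Y e) \<in> ?F \<rightarrow>\<^sub>M bernoulli_field ?r"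
    unfolding product_field_def[of "\<lambda>_. bernoulli_pmf _"] by (rule measurable_PiM_single') auto
  have dB: "distr ?F (bernoulli_field ?r) (\<lambda>Y e. gate Y e) = bernoulli_field ?r"
    unfolding gate_def
    using distr_product_field_map[of Gate "\<lambda>_. bernoulli_pmf ?r" "\<lambda>_ n. n = 1" "spine_label_pmf d"]
    by (simp add: inj_def map_pmf_bit del: One_nat_def)
  have B: "distr ?F ?B ?g = ?B"
  proof -
    have "?B = distr (distr ?F (bernoulli_field ?r) (\<lambda>Y e. gate Y e)) (config_space (tree_edges d)) (\<lambda>B. restrict B (tree_edges d))"
      unfolding dB by (rule bernoulli_percolation_eq_distr)
    also have "\<dots> = distr ?F (config_space (tree_edges d)) ((\<lambda>B. restrict B (tree_edges d)) \<circ> (\<lambda>Y e. gate Y e))"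
      by (rule distr_distr[OF _ mB]) (auto intro!: measurable_to_config_space)
    also have "\<dots> = distr ?F ?B ?g"
      by (rule distr_cong) (auto simp: sets_bernoulli_percolation)
    finally show ?thesis by simp
  qed
  have mT: "(\<lambda>Y. descendants d [] (bush Y w)) \<in> ?F \<rightarrow>\<^sub>M config_space (tree_verts d)" for w
    by (rule measurable_descendants) measurable
  have dT: "distr ?F (config_space (tree_verts d)) (\<lambda>Y. descendants d [] (bush Y w)) = percolation_tree d ?r" for w
  proof -
    have mb: "(\<lambda>Y e. bush Y w e) \<in> ?F \<rightarrow>\<^sub>M bernoulli_field ?r"
      unfolding product_field_def[of "\<lambda>_. bernoulli_pmf _"] by (rule measurable_PiM_single') auto
    have db: "distr ?F (bernoulli_field ?r) (\<lambda>Y e. bush Y w e) = bernoulli_field ?r"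
      unfolding bush_def
      using distr_product_field_map[of "Bush w" "\<lambda>_. bernoulli_pmf ?r" "\<lambda>_ n. n = 1" "spine_label_pmf d"]
      by (simp add: inj_def map_pmf_bit del: One_nat_def)
    have "percolation_tree d ?r = distr (distr ?F (bernoulli_field ?r) (\<lambda>Y e. bush Y w e)) (config_space (tree_verts d)) (descendants d [])"
      unfolding db by (rule percolation_tree_eq_distr)
    also have "\<dots> = distr ?F (config_space (tree_verts d)) (descendants d [] \<circ> (\<lambda>Y e. bush Y w e))"
      by (rule distr_distr[OF _ mb]) measurable
    finally show ?thesis by (simp add: comp_def)
  qed
  have T: "distr ?F ?T ?t = ?T"
  proof -
    have "[0] \<in> tree_edges d" using d by simp
    then have ne: "tree_edges d \<noteq> {}" by blast
    have "indep_vars (\<lambda>_. config_space (tree_verts d)) (\<lambda>w Y. descendants d [] (bush Y w)) (tree_edges d)"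
    proof (rule indep_vars_disjoint_blocks[where J = "\<lambda>w. range (Bush w)"])
      show "determined_by (range (Bush k)) (\<lambda>Y. descendants d [] (bush Y k))" for k
        by (rule determined_byI) (simp add: bush_def[abs_def])
    qed (use mT in auto)
    then have "distr ?F (\<Pi>\<^sub>M w\<in>tree_edges d. config_space (tree_verts d)) ?t =
        (\<Pi>\<^sub>M w\<in>tree_edges d. distr ?F (config_space (tree_verts d)) (\<lambda>Y. descendants d [] (bush Y w)))"
      using ne mT by (subst (asm) indep_vars_iff_distr_eq_PiM') auto
    also have "\<dots> = ?T" unfolding dT ..
    also have "distr ?F (\<Pi>\<^sub>M w\<in>tree_edges d. config_space (tree_verts d)) ?t = distr ?F ?T ?t"
      by (rule distr_cong) (auto intro!: sets_PiM_cong simp: sets_percolation_tree)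
    finally show ?thesis .
  qed
  have mt: "?t \<in> ?F \<rightarrow>\<^sub>M ?T"
  proof (rule measurable_restrict)
    show "(\<lambda>Y. descendants d [] (bush Y w)) \<in> ?F \<rightarrow>\<^sub>M percolation_tree d ?r" for w
      using mT[of w] by (simp cong: measurable_cong_sets add: sets_percolation_tree)
  qed
  have mg: "?g \<in> ?F \<rightarrow>\<^sub>M ?B"
  proof -
    have "?g \<in> ?F \<rightarrow>\<^sub>M config_space (tree_edges d)" by (rule measurable_to_config_space) measurable
    then show ?thesis by (simp cong: measurable_cong_sets add: sets_bernoulli_percolation)
  qed
  have mu: "turn \<in> ?F \<rightarrow>\<^sub>M ?U" by (rule measurable_PiM_single') auto
  have detg: "determined_by (range Gate) ?g"
    by (rule determined_byI) (auto simp: gate_def intro!: restrict_ext)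
  have dett: "determined_by {l. \<exists>w e. l = Bush w e} ?t"
    by (rule determined_byI) (auto simp: bush_def[abs_def] intro!: restrict_ext)
  have "?B \<Otimes>\<^sub>M ?T = distr ?F ?B ?g \<Otimes>\<^sub>M distr ?F ?T ?t" by (simp only: B T)
  also have "\<dots> = distr ?F (?B \<Otimes>\<^sub>M ?T) (\<lambda>Y. (?g Y, ?t Y))"
    by (rule distr_pair_blocks[symmetric, OF _ detg dett mg mt]) auto
  finally have BT: "?B \<Otimes>\<^sub>M ?T = distr ?F (?B \<Otimes>\<^sub>M ?T) (\<lambda>Y. (?g Y, ?t Y))" .
  have "?U \<Otimes>\<^sub>M (?B \<Otimes>\<^sub>M ?T) = distr ?F ?U turn \<Otimes>\<^sub>M distr ?F (?B \<Otimes>\<^sub>M ?T) (\<lambda>Y. (?g Y, ?t Y))"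
    by (simp only: U BT[symmetric])
  also have "\<dots> = distr ?F (?U \<Otimes>\<^sub>M (?B \<Otimes>\<^sub>M ?T)) (\<lambda>Y. (turn Y, (?g Y, ?t Y)))"
  proof (rule distr_pair_blocks[symmetric, where I = "range Turn" and J = "- range Turn"])
    show "determined_by (range Turn) turn" by (rule determined_byI) auto
    show "determined_by (- range Turn) (\<lambda>Y. (?g Y, ?t Y))"
    proof (rule determined_byI)
      fix X Y :: "spine_label \<Rightarrow> nat" assume XY: "\<And>l. l \<in> - range Turn \<Longrightarrow> X l = Y l"
      have "?g X = ?g Y" by (rule determined_byD[OF detg]) (use XY in auto)
      moreover have "?t X = ?t Y" by (rule determined_byD[OF dett]) (use XY in auto)
      ultimately show "(?g X, ?t X) = (?g Y, ?t Y)" by simp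
    qed
  qed (use mu mg mt in auto)
  finally show ?thesis by (simp add: spine_space_def spine_input_def[abs_def])
qed

lemma sets_spine_space [measurable_cong]:
  "sets (spine_space d) = sets ((\<Pi>\<^sub>M k\<in>UNIV. count_space UNIV) \<Otimes>\<^sub>M
     (config_space (tree_edges d) \<Otimes>\<^sub>M (\<Pi>\<^sub>M w\<in>tree_edges d. config_space (tree_verts d))))"
  unfolding spine_space_def
  by (intro sets_pair_measure_cong sets_PiM_cong) (auto simp: sets_bernoulli_percolation sets_percolation_tree)

lemma measurable_spine_input: "spine_input d \<in> spine_field d \<rightarrow>\<^sub>M spine_space d"
proof -
  have "turn \<in> spine_field d \<rightarrow>\<^sub>M (\<Pi>\<^sub>M k\<in>(UNIV :: nat set). count_space UNIV)"
    by (rule measurable_PiM_single') auto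
  moreover have "(\<lambda>Y. restrict (gate Y) (tree_edges d)) \<in> spine_field d \<rightarrow>\<^sub>M config_space (tree_edges d)"
    by (rule measurable_to_config_space) measurable
  moreover have "(\<lambda>Y. \<lambda>w\<in>tree_edges d. descendants d [] (bush Y w)) \<in>
      spine_field d \<rightarrow>\<^sub>M (\<Pi>\<^sub>M w\<in>tree_edges d. config_space (tree_verts d))"
    by (intro measurable_restrict measurable_descendants) measurable
  ultimately show ?thesis
    unfolding measurable_cong_sets[OF refl sets_spine_space] spine_input_def[abs_def]
    by (intro measurable_Pair)
qed


section \<open>The side edges of the spine\<close>

lemma spine_nth_take:
  assumes "spine \<xi> N = \<iota>" "k \<le> N" shows "spine \<xi> k = take k \<iota>" "k < N \<Longrightarrow> \<xi> k = \<iota> ! k"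
  using assms by (auto simp: spine_def take_map)

lemma spine_eq_iff: "spine \<xi> k = u \<longleftrightarrow> length u = k \<and> (\<forall>j<k. \<xi> j = u ! j)"
  by (auto simp: spine_def list_eq_iff_nth_eq)

lemma measurable_spine_components [measurable]:
  "(\<lambda>\<sigma>. fst \<sigma> k) \<in> spine_space d \<rightarrow>\<^sub>M count_space UNIV"
  "(\<lambda>\<sigma>. fst (snd \<sigma>) e) \<in> spine_space d \<rightarrow>\<^sub>M count_space UNIV"
  "(\<lambda>\<sigma>. snd (snd \<sigma>) w y) \<in> spine_space d \<rightarrow>\<^sub>M count_space UNIV"
proof -
  let ?U = "\<Pi>\<^sub>M k\<in>(UNIV :: nat set). count_space (UNIV :: nat set)"
  let ?B = "config_space (tree_edges d)"
  let ?T = "\<Pi>\<^sub>M w\<in>tree_edges d. config_space (tree_verts d)"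
  have *: "f \<in> spine_space d \<rightarrow>\<^sub>M N \<longleftrightarrow> f \<in> ?U \<Otimes>\<^sub>M (?B \<Otimes>\<^sub>M ?T) \<rightarrow>\<^sub>M N" for f and N :: "'z measure"
    by (rule arg_cong2[where f = "(\<in>)", OF refl measurable_cong_sets[OF sets_spine_space refl]])
  show "(\<lambda>\<sigma>. fst \<sigma> k) \<in> spine_space d \<rightarrow>\<^sub>M count_space UNIV"
    unfolding * by measurable
  show "(\<lambda>\<sigma>. fst (snd \<sigma>) e) \<in> spine_space d \<rightarrow>\<^sub>M count_space UNIV"
    unfolding * by measurable
  show "(\<lambda>\<sigma>. snd (snd \<sigma>) w y) \<in> spine_space d \<rightarrow>\<^sub>M count_space UNIV"
  proof (cases "w \<in> tree_edges d")
    case True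
    then have "(\<lambda>\<sigma>. snd (snd \<sigma>) w) \<in> ?U \<Otimes>\<^sub>M (?B \<Otimes>\<^sub>M ?T) \<rightarrow>\<^sub>M config_space (tree_verts d)"
      by measurable
    from measurable_compose[OF this measurable_config_component] show ?thesis unfolding * .
  next
    case False
    then have "snd (snd \<sigma>) w y = (undefined :: vertex \<Rightarrow> bool) y" if "\<sigma> \<in> space (?U \<Otimes>\<^sub>M (?B \<Otimes>\<^sub>M ?T))" for \<sigma>
      using that by (auto simp: space_pair_measure space_PiM PiE_iff extensional_def)
    then show ?thesis unfolding * by (subst measurable_cong[where g = "\<lambda>_. undefined y"]) auto
  qed
qed

lemma pred_spine_eq [measurable]: "Measurable.pred (spine_space d) (\<lambda>\<sigma>. u = spine (fst \<sigma>) k)"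
  unfolding eq_commute[of u] spine_eq_iff by measurable

lemma spine_cluster_iff:
  assumes "x \<in> tree_verts d"
  shows "spine_cluster d \<sigma> x \<longleftrightarrow> (\<exists>k. x = spine (fst \<sigma>) k) \<or>
    (\<exists>k i y u. u = spine (fst \<sigma>) k \<and> i < d \<and> i \<noteq> fst \<sigma> k \<and> fst (snd \<sigma>) (u @ [i]) \<and>
       x = u @ i # y \<and> snd (snd \<sigma>) (u @ [i]) y)"
proof -
  obtain \<xi> \<eta> \<tau> where \<sigma>: "\<sigma> = (\<xi>, \<eta>, \<tau>)" by (cases \<sigma>)
  have "(\<exists>w\<in>open_side_edges d \<xi> \<eta> k. \<exists>y. x = w @ y \<and> \<tau> w y) \<longleftrightarrow>
      (\<exists>i y u. u = spine \<xi> k \<and> i < d \<and> i \<noteq> \<xi> k \<and> \<eta> (u @ [i]) \<and> x = u @ i # y \<and> \<tau> (u @ [i]) y)" for k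
    unfolding open_side_edges_def by force
  then show ?thesis using assms unfolding \<sigma> spine_cluster_def by simp
qed

lemma measurable_spine_cluster: "spine_cluster d \<in> spine_space d \<rightarrow>\<^sub>M config_space (tree_verts d)"
proof -
  have "(\<lambda>\<sigma>. \<lambda>x\<in>tree_verts d. (\<exists>k. x = spine (fst \<sigma>) k) \<or>
    (\<exists>k i y u. u = spine (fst \<sigma>) k \<and> i < d \<and> i \<noteq> fst \<sigma> k \<and> fst (snd \<sigma>) (u @ [i]) \<and>
       x = u @ i # y \<and> snd (snd \<sigma>) (u @ [i]) y)) \<in> spine_space d \<rightarrow>\<^sub>M config_space (tree_verts d)"
    by (rule measurable_to_config_space) measurable
  also have "(\<lambda>\<sigma>. \<lambda>x\<in>tree_verts d. (\<exists>k. x = spine (fst \<sigma>) k) \<or>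
    (\<exists>k i y u. u = spine (fst \<sigma>) k \<and> i < d \<and> i \<noteq> fst \<sigma> k \<and> fst (snd \<sigma>) (u @ [i]) \<and>
       x = u @ i # y \<and> snd (snd \<sigma>) (u @ [i]) y)) = spine_cluster d"
  proof (intro ext)
    fix \<sigma> x
    show "(\<lambda>x\<in>tree_verts d. (\<exists>k. x = spine (fst \<sigma>) k) \<or>
      (\<exists>k i y u. u = spine (fst \<sigma>) k \<and> i < d \<and> i \<noteq> fst \<sigma> k \<and> fst (snd \<sigma>) (u @ [i]) \<and>
         x = u @ i # y \<and> snd (snd \<sigma>) (u @ [i]) y)) x = spine_cluster d \<sigma> x"
      using spine_cluster_iff[of x d \<sigma>]
      by (cases "x \<in> tree_verts d") (simp_all add: spine_cluster_def split: prod.split)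
  qed
  finally show ?thesis .
qed

lemma card_open_side_edges:
  "card (open_side_edges d \<xi> \<eta> k) = card {i. i < d \<and> i \<noteq> \<xi> k \<and> \<eta> (spine \<xi> k @ [i])}"
proof -
  have "open_side_edges d \<xi> \<eta> k = (\<lambda>i. spine \<xi> k @ [i]) ` {i. i < d \<and> i \<noteq> \<xi> k \<and> \<eta> (spine \<xi> k @ [i])}"
    by (auto simp: open_side_edges_def)
  then show ?thesis by (simp add: card_image inj_on_def)
qed

lemma measurable_side_counts:
  "(\<lambda>(\<xi>, \<eta>, \<tau>). \<lambda>k. card (open_side_edges d \<xi> \<eta> k)) \<in> spine_space d \<rightarrow>\<^sub>M (\<Pi>\<^sub>M k\<in>UNIV. count_space UNIV)"
proof (rule measurable_PiM_single')
  fix k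
  have eq: "(case \<sigma> of (\<xi>, \<eta>, \<tau>) \<Rightarrow> \<lambda>k. card (open_side_edges d \<xi> \<eta> k)) k =
      card {i. i < d \<and> i \<noteq> fst \<sigma> k \<and> (\<exists>u. u = spine (fst \<sigma>) k \<and> fst (snd \<sigma>) (u @ [i]))}" for \<sigma>
    by (cases \<sigma>) (simp add: card_open_side_edges)
  show "(\<lambda>\<sigma>. (case \<sigma> of (\<xi>, \<eta>, \<tau>) \<Rightarrow> \<lambda>k. card (open_side_edges d \<xi> \<eta> k)) k) \<in>
      spine_space d \<rightarrow>\<^sub>M count_space UNIV"
    unfolding eq
  proof (rule measurable_card)
    fix i
    have "Measurable.pred (spine_space d)
        (\<lambda>\<sigma>. i < d \<and> i \<noteq> fst \<sigma> k \<and> (\<exists>u. u = spine (fst \<sigma>) k \<and> fst (snd \<sigma>) (u @ [i])))"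
      by measurable
    from predE[OF this] show "{\<sigma> \<in> space (spine_space d).
        i \<in> {i. i < d \<and> i \<noteq> fst \<sigma> k \<and> (\<exists>u. u = spine (fst \<sigma>) k \<and> fst (snd \<sigma>) (u @ [i]))}} \<in> sets (spine_space d)"
      by (simp only: mem_Collect_eq)
  qed
qed auto

text \<open>
  The possible beginnings of the spine.
\<close>

definition words :: "nat \<Rightarrow> nat \<Rightarrow> vertex set" where
  "words d N = {\<iota> \<in> tree_verts d. length \<iota> = N}"

lemma finite_words: "finite (words d N)" and card_words: "card (words d N) = d ^ N"
proof -
  have "words d N = {xs. set xs \<subseteq> {..<d} \<and> length xs = N}" by (auto simp: words_def tree_verts_def)
  then show "finite (words d N)" "card (words d N) = d ^ N"
    using finite_lists_length_eq[of "{..<d}" N] card_lists_length_eq[of "{..<d}" N] by auto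
qed

lemma nth_in_tree_verts: "v \<in> tree_verts d \<Longrightarrow> k < length v \<Longrightarrow> v ! k < d"
  by (auto simp: tree_verts_def dest: nth_mem)

lemma prob_uniform_label:
  fixes d :: nat
  assumes "2 \<le> d" "\<mu> l = pmf_of_set {..<d}" "i < d"
  shows "measure (product_field \<mu>) {X. X l = i} = 1 / real d"
  unfolding prob_product_field_eq assms(2) using assms
  by (subst pmf_of_set) (auto simp: indicator_def lessThan_empty_iff)

lemma AE_uniform_label:
  fixes d :: nat
  assumes "2 \<le> d" "\<mu> l = pmf_of_set {..<d}"
  shows "AE X in product_field \<mu>. X l < d"
proof -
  have "AE n in measure_pmf (\<mu> l). n < d"
    using assms by (auto simp: AE_measure_pmf_iff set_pmf_of_set lessThan_empty_iff)
  then show ?thesis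
    unfolding product_field_def
    by (intro AE_PiM_component) (auto intro: measure_pmf.prob_space_axioms)
qed

text \<open>
  The labels \<open>l k\<close> that are read along a word may depend on the word, as long as they are
  distinct.
\<close>

lemma prob_along_word:
  assumes d: "2 \<le> d" and \<iota>: "\<iota> \<in> words d N"
    and inj: "inj_on l {..<N}" and uni: "\<And>k. k < N \<Longrightarrow> \<mu> (l k) = pmf_of_set {..<d}"
  shows "measure (product_field \<mu>) {X. \<forall>k\<in>{..<N}. X (l k) = \<iota> ! k} = (1 / real d) ^ N"
proof -
  have "measure (product_field \<mu>) {X. \<forall>k\<in>{..<N}. X (l k) = \<iota> ! k} =
      (\<Prod>k\<in>{..<N}. measure (product_field \<mu>) {X. X (l k) = \<iota> ! k})"
    using inj by (intro prob_disjoint_blocks[where J = "\<lambda>k. {l k}"]) (auto simp: determined_by_def dest: inj_onD)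
  also have "\<dots> = (\<Prod>k\<in>{..<N}. 1 / real d)"
    using \<iota> by (intro prod.cong refl prob_uniform_label d uni) (auto simp: words_def intro: nth_in_tree_verts)
  finally show ?thesis by simp
qed

text \<open>
  The child edges counted at the \<open>k\<close>-th vertex of the spine depend on the spine. But given the
  first \<open>N\<close> steps \<open>\<iota>\<close>, the counts are determined by fixed disjoint sets of
  \<open>d - 1\<close> gates, and the conditional law does not depend on \<open>\<iota>\<close>.
\<close>

theorem side_counts_law:
  assumes d: "2 \<le> d"
  shows "distr (spine_space d) (\<Pi>\<^sub>M k\<in>UNIV. count_space UNIV)
      (\<lambda>(\<xi>, \<eta>, \<tau>). \<lambda>k. card (open_side_edges d \<xi> \<eta> k)) =
    (\<Pi>\<^sub>M k\<in>(UNIV :: nat set). measure_pmf (binomial_pmf (d - 1) (1 / real d)))"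
    (is "distr _ ?C ?f = PiM UNIV (\<lambda>_. measure_pmf ?bin)")
proof (rule sym, rule measure_eqI_PiM_infinite)
  let ?F = "spine_field d"
  interpret F: prob_space ?F by simp
  note mi = measurable_spine_input[of d]
  show "sets (PiM UNIV (\<lambda>_. measure_pmf ?bin)) = sets (PiM UNIV (\<lambda>_. measure_pmf ?bin))" ..
  show "sets (distr (spine_space d) ?C ?f) = sets (PiM UNIV (\<lambda>_. measure_pmf ?bin))"
    by (simp, rule sets_PiM_cong) auto
  interpret B: prob_space "PiM (UNIV :: nat set) (\<lambda>_. measure_pmf ?bin)"
    by (intro prob_space_PiM measure_pmf.prob_space_axioms)
  show "finite_measure (PiM (UNIV :: nat set) (\<lambda>_. measure_pmf ?bin))" by unfold_locales
  fix A and J :: "nat set" assume J: "finite J" "J \<subseteq> UNIV" "\<And>i. i \<in> J \<Longrightarrow> A i \<in> sets (measure_pmf ?bin)"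
  let ?S = "prod_emb UNIV (\<lambda>_. measure_pmf ?bin) J (Pi\<^sub>E J A)"
  have S: "?S \<in> sets ?C"
  proof -
    have "?S \<in> sets (PiM UNIV (\<lambda>_. measure_pmf ?bin))" using J by (intro sets_PiM_I) auto
    also have "sets (PiM UNIV (\<lambda>_. measure_pmf ?bin)) = sets ?C" by (rule sets_PiM_cong) auto
    finally show ?thesis .
  qed
  obtain N where N: "\<And>k. k \<in> J \<Longrightarrow> k < N" using J(1) by (meson finite_nat_bounded lessThan_iff subsetD)
  \<comment> \<open>the counts at all the vertices up to the last one in \<open>J\<close> are treated together, with no condition outside \<open>J\<close>\<close>
  define A' where "A' k = (if k \<in> J then A k else UNIV)" for k
  define count where "count k Y = card {i. i < d \<and> i \<noteq> turn Y k \<and> restrict (gate Y) (tree_edges d) (spine (turn Y) k @ [i])}" for k Y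
  define E where "E Y \<longleftrightarrow> (\<forall>k\<in>{..<N}. count k Y \<in> A' k)" for Y
  have f_input: "?f (spine_input d Y) k = count k Y" for Y k
    by (simp add: spine_input_def card_open_side_edges count_def)
  have mE [measurable]: "Measurable.pred ?F E"
  proof -
    have "(\<lambda>Y. ?f (spine_input d Y) k) \<in> ?F \<rightarrow>\<^sub>M count_space UNIV" for k
      using measurable_compose[OF measurable_compose[OF mi measurable_side_counts] measurable_component_singleton[of k UNIV]] by simp
    then have [measurable]: "count k \<in> ?F \<rightarrow>\<^sub>M count_space UNIV" for k
      unfolding f_input by simp
    show ?thesis unfolding E_def by measurable
  qed
  have "emeasure (distr (spine_space d) ?C ?f) ?S = emeasure (distr (distr ?F (spine_space d) (spine_input d)) ?C ?f) ?S"
    using spine_space_eq_distr[OF d] by simp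
  also have "\<dots> = emeasure (distr ?F ?C (?f \<circ> spine_input d)) ?S"
    by (subst distr_distr[OF measurable_side_counts mi]) simp
  also have "\<dots> = emeasure ?F {Y. \<forall>k\<in>J. count k Y \<in> A k}"
    using measurable_comp[OF mi measurable_side_counts] S
    by (subst emeasure_distr) (auto simp: prod_emb_def PiE_iff f_input intro!: arg_cong[where f = "emeasure _"])
  also have "{Y. \<forall>k\<in>J. count k Y \<in> A k} = {Y. E Y}"
    using N by (auto simp: E_def A'_def)
  finally have lhs: "emeasure (distr (spine_space d) ?C ?f) ?S = ennreal (F.prob {Y. E Y})"
    by (simp add: F.emeasure_eq_measure)
  have AE_turn: "AE Y in ?F. \<forall>k. turn Y k < d"
    using AE_uniform_label[OF d, of "spine_label_pmf d" "Turn k" for k] by (simp add: AE_all_countable)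
  have one: "F.prob {Y. spine (turn Y) N = \<iota> \<and> E Y} = (1 / real d) ^ N * (\<Prod>k<N. measure_pmf.prob ?bin (A' k))"
    if \<iota>: "\<iota> \<in> words d N" for \<iota>
  proof -
    have len: "length \<iota> = N" "\<iota> \<in> tree_verts d" using \<iota> by (auto simp: words_def)
    let ?I = "\<lambda>k. {..<d} - {\<iota> ! k}"
    let ?cnt = "\<lambda>k Y. card {i \<in> ?I k. gate Y (take k \<iota> @ [i])}"
    have cnt: "count k Y = ?cnt k Y" if "spine (turn Y) N = \<iota>" "k < N" for k Y
    proof -
      have "spine (turn Y) k = take k \<iota>" "turn Y k = \<iota> ! k"
        using spine_nth_take[OF that(1)] that(2) by auto
      moreover have "take k \<iota> @ [i] \<in> tree_edges d" if "i < d" for i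
        using that len by (auto intro: tree_verts_prefix take_is_prefix)
      ultimately show ?thesis
        unfolding count_def by (intro arg_cong[where f = card]) auto
    qed
    have event: "{Y. spine (turn Y) N = \<iota> \<and> E Y} =
        {Y. (\<forall>k\<in>{..<N}. turn Y k = \<iota> ! k) \<and> (\<forall>k\<in>{..<N}. ?cnt k Y \<in> A' k)}"
    proof (intro Collect_cong)
      fix Y
      have "spine (turn Y) N = \<iota> \<longleftrightarrow> (\<forall>k\<in>{..<N}. turn Y k = \<iota> ! k)"
        using len by (auto simp: spine_eq_iff)
      then show "spine (turn Y) N = \<iota> \<and> E Y \<longleftrightarrow> (\<forall>k\<in>{..<N}. turn Y k = \<iota> ! k) \<and> (\<forall>k\<in>{..<N}. ?cnt k Y \<in> A' k)"
        unfolding E_def using cnt[of Y] by (auto simp del: spine_eq_iff)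
    qed
    have m_cnt: "Measurable.pred ?F (\<lambda>Y. ?cnt k Y \<in> A' k)" for k
      by (intro pred_card_in) auto
    have factor: "F.prob {Y. (\<forall>k\<in>{..<N}. turn Y k = \<iota> ! k) \<and> (\<forall>k\<in>{..<N}. ?cnt k Y \<in> A' k)} =
        F.prob {Y. \<forall>k\<in>{..<N}. turn Y k = \<iota> ! k} * F.prob {Y. \<forall>k\<in>{..<N}. ?cnt k Y \<in> A' k}"
    proof -
      have "determined_by (range Gate) (\<lambda>Y. \<forall>k\<in>{..<N}. ?cnt k Y \<in> A' k)"
        by (rule determined_byI) (simp add: gate_def)
      then show ?thesis
        using m_cnt by (intro prob_two_blocks[where I = "range Turn" and J = "range Gate"]) (auto simp: determined_by_def)
    qed
    have turns: "F.prob {Y. \<forall>k\<in>{..<N}. turn Y k = \<iota> ! k} = (1 / real d) ^ N"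
      by (rule prob_along_word[OF d \<iota>]) (auto simp: inj_on_def)
    have counts: "F.prob {Y. \<forall>k\<in>{..<N}. ?cnt k Y \<in> A' k} = (\<Prod>k<N. F.prob {Y. ?cnt k Y \<in> A' k})"
    proof (rule prob_disjoint_blocks[where J = "\<lambda>k. Gate ` {w. length w = Suc k}"])
      show "determined_by (Gate ` {w. length w = Suc k}) (\<lambda>Y. ?cnt k Y \<in> A' k)" if "k \<in> {..<N}" for k
        using that len by (intro determined_byI) (simp add: gate_def)
      show "Measurable.pred ?F (\<lambda>Y. ?cnt k Y \<in> A' k)" for k by (rule m_cnt)
    qed auto
    have each: "(\<Prod>k<N. F.prob {Y. ?cnt k Y \<in> A' k}) = (\<Prod>k<N. measure_pmf.prob ?bin (A' k))"
    proof (rule prod.cong)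
      fix k assume k: "k \<in> {..<N}"
      let ?t = "\<lambda>i. Gate (take k \<iota> @ [i])"
      have m: "Measurable.pred (product_field (\<lambda>_::nat. bernoulli_pmf (1 / real d))) (\<lambda>B. card {i \<in> ?I k. B i} \<in> A' k)"
        by (intro pred_card_in) auto
      have "F.prob {Y. ?cnt k Y \<in> A' k} = measure (product_field (\<lambda>_::nat. bernoulli_pmf (1 / real d))) {B. card {i \<in> ?I k. B i} \<in> A' k}"
        unfolding gate_def
        by (rule prob_product_field_map[of ?t, OF _ _ m]) (auto simp: inj_def map_pmf_bit simp del: One_nat_def)
      also have "\<dots> = measure_pmf.prob ?bin (A' k)"
        using d k len nth_in_tree_verts[of \<iota> d k] by (subst prob_card_binomial) auto
      finally show "F.prob {Y. ?cnt k Y \<in> A' k} = measure_pmf.prob ?bin (A' k)" .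
    qed simp
    show ?thesis unfolding event factor turns counts each ..
  qed
  have "F.prob {Y. E Y} = (\<Sum>\<iota>\<in>words d N. F.prob {Y. spine (turn Y) N = \<iota> \<and> E Y})"
  proof (rule prob_partition_AE[OF finite_words])
    show "AE Y in ?F. spine (turn Y) N \<in> words d N"
      using AE_turn by eventually_elim (auto simp: words_def spine_def tree_verts_def)
    show "Measurable.pred ?F (\<lambda>Y. spine (turn Y) N = \<iota>)" for \<iota>
      unfolding spine_eq_iff by measurable
  qed measurable
  also have "\<dots> = (\<Prod>k<N. measure_pmf.prob ?bin (A' k))"
    using d by (simp add: one card_words power_one_over)
  also have "\<dots> = (\<Prod>k\<in>J. measure_pmf.prob ?bin (A k))"
    using N by (intro prod.mono_neutral_cong_right) (auto simp: A'_def)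
  finally show "emeasure (PiM UNIV (\<lambda>_. measure_pmf ?bin)) ?S = emeasure (distr (spine_space d) ?C ?f) ?S"
    unfolding lhs using J
    by (subst emeasure_PiM_emb) (auto simp: measure_pmf.emeasure_eq_measure prod_ennreal intro: measure_pmf.prob_space_axioms)
qed


section \<open>The law of a surviving cluster\<close>

text \<open>
  The vertices just off the path from the root to \<open>\<iota>\<close>. Every vertex up to the level of
  \<open>\<iota>\<close> lies on that path or below exactly one of these (\<open>side_children_cover\<close>,
  \<open>side_children_disjoint\<close>).
\<close>

definition side_children :: "nat \<Rightarrow> vertex \<Rightarrow> vertex set" where
  "side_children d \<iota> = {take k \<iota> @ [i] | k i. k < length \<iota> \<and> i < d \<and> i \<noteq> \<iota> ! k}"

text \<open>
  The cluster agrees with the pattern \<open>g\<close> on the part of \<open>J\<close> below \<open>w\<close>,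
  if \<open>b\<close> tells whether the parent edge of \<open>w\<close> is open and \<open>T\<close> which of
  its descendants are joined to \<open>w\<close>.
\<close>

definition side_matches :: "vertex set \<Rightarrow> (vertex \<Rightarrow> bool) \<Rightarrow> vertex \<Rightarrow> bool \<Rightarrow> (vertex \<Rightarrow> bool) \<Rightarrow> bool" where
  "side_matches J g w b T \<longleftrightarrow> (\<forall>y. w @ y \<in> J \<longrightarrow> (b \<and> T y) = g (w @ y))"

lemma finite_side_children: "finite (side_children d \<iota>)"
proof -
  have "side_children d \<iota> \<subseteq> (\<lambda>(k, i). take k \<iota> @ [i]) ` ({..<length \<iota>} \<times> {..<d})"
    by (auto simp: side_children_def)
  then show ?thesis by (rule finite_subset) auto
qed

lemma nth_divergence: "k < length \<iota> \<Longrightarrow> (take k \<iota> @ i # y) ! k = i"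
  by (simp add: nth_append)

text \<open>
  The vertex at which a word leaves the path is the first place where they differ.
\<close>

lemma divergence_unique:
  assumes eq: "take k \<iota> @ i # y = take k' \<iota> @ i' # y'" and k: "k < length \<iota>" "k' < length \<iota>"
    and i: "i \<noteq> \<iota> ! k" "i' \<noteq> \<iota> ! k'"
  shows "k = k'" "i = i'" "y = y'"
proof -
  have nth: "(take l \<iota> @ z) ! m = \<iota> ! m" if "m < l" "l < length \<iota>" for l m z
    using that by (simp add: nth_append)
  show kk: "k = k'"
  proof (rule ccontr)
    assume "k \<noteq> k'"
    then consider "k < k'" | "k' < k" by linarith
    then show False
    proof cases
      case 1
      then show False using nth[of k k' "i' # y'"] nth_divergence[OF k(1), of i y] eq k i by simp
    next
      case 2
      then show False using nth[of k' k "i # y"] nth_divergence[OF k(2), of i' y'] eq k i by simp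
    qed
  qed
  show "i = i'" "y = y'" using eq unfolding kk by simp_all
qed

lemma side_children_disjoint:
  assumes "w \<in> side_children d \<iota>" "w' \<in> side_children d \<iota>" "w @ y = w' @ y'"
  shows "w = w'"
proof -
  obtain k i where w: "w = take k \<iota> @ [i]" "k < length \<iota>" "i \<noteq> \<iota> ! k"
    using assms(1) by (auto simp: side_children_def)
  obtain k' i' where w': "w' = take k' \<iota> @ [i']" "k' < length \<iota>" "i' \<noteq> \<iota> ! k'"
    using assms(2) by (auto simp: side_children_def)
  have "take k \<iota> @ i # y = take k' \<iota> @ i' # y'" using assms(3) w(1) w'(1) by simp
  from divergence_unique[OF this w(2) w'(2) w(3) w'(3)] show ?thesis using w(1) w'(1) by simp
qed

lemma side_children_not_prefix: "w \<in> side_children d \<iota> \<Longrightarrow> \<not> prefix (w @ y) \<iota>"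
proof
  assume "w \<in> side_children d \<iota>" and p: "prefix (w @ y) \<iota>"
  then obtain k i where ki: "w = take k \<iota> @ [i]" "k < length \<iota>" "i \<noteq> \<iota> ! k" by (auto simp: side_children_def)
  from p obtain z where z: "\<iota> = w @ y @ z" by (auto simp: prefix_def)
  have "w ! k = i" using ki by (simp add: nth_append)
  moreover have "\<iota> ! k = w ! k" using ki by (subst z) (simp add: nth_append)
  ultimately show False using ki by simp
qed

lemma side_children_cover:
  assumes x: "x \<in> tree_verts d" "length x \<le> length \<iota>" and np: "\<not> prefix x \<iota>"
  shows "\<exists>w\<in>side_children d \<iota>. \<exists>y. x = w @ y"
proof -
  have "\<not> prefix \<iota> x"
  proof
    assume "prefix \<iota> x"
    then have "x = \<iota>" using x(2) by (auto simp: prefix_def)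
    then show False using np by simp
  qed
  then have "x \<parallel> \<iota>" using np by (simp add: parallel_def)
  then obtain as b bs c cs where dec: "b \<noteq> c" "x = as @ b # bs" "\<iota> = as @ c # cs"
    using parallel_decomp by blast
  then have "as @ [b] \<in> side_children d \<iota>"
    using x unfolding side_children_def by (intro CollectI exI[of _ "length as"] exI[of _ b]) (auto simp: nth_append)
  then show ?thesis using dec by (intro bexI[of _ "as @ [b]"] exI[of _ bs]) auto
qed

text \<open>
  Given that the spine starts with \<open>\<iota>\<close>, a cluster pattern up to the level of
  \<open>\<iota>\<close> is a condition on the spine, which is in the cluster, and a separate condition below
  each side child.
\<close>

lemma pattern_iff:
  assumes J: "\<And>x. x \<in> J \<Longrightarrow> x \<in> tree_verts d \<and> length x \<le> length \<iota>"
    and on: "\<And>x. x \<in> J \<Longrightarrow> prefix x \<iota> \<Longrightarrow> C x"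
    and off: "\<And>w y. w \<in> side_children d \<iota> \<Longrightarrow> w @ y \<in> J \<Longrightarrow> C (w @ y) \<longleftrightarrow> b w \<and> T w y"
  shows "(\<forall>x\<in>J. C x = g x) \<longleftrightarrow>
    (\<forall>x\<in>J. prefix x \<iota> \<longrightarrow> g x) \<and> (\<forall>w\<in>side_children d \<iota>. side_matches J g w (b w) (T w))"
proof
  assume "\<forall>x\<in>J. C x = g x"
  then show "(\<forall>x\<in>J. prefix x \<iota> \<longrightarrow> g x) \<and> (\<forall>w\<in>side_children d \<iota>. side_matches J g w (b w) (T w))"
    using on off unfolding side_matches_def by metis
next
  assume R: "(\<forall>x\<in>J. prefix x \<iota> \<longrightarrow> g x) \<and> (\<forall>w\<in>side_children d \<iota>. side_matches J g w (b w) (T w))"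
  show "\<forall>x\<in>J. C x = g x"
  proof
    fix x assume x: "x \<in> J"
    show "C x = g x"
    proof (cases "prefix x \<iota>")
      case True
      then show ?thesis using R on x by blast
    next
      case False
      then obtain w y where "w \<in> side_children d \<iota>" "x = w @ y"
        using side_children_cover J[OF x] by metis
      then show ?thesis using R off x unfolding side_matches_def by metis
    qed
  qed
qed

definition side_prob_match :: "nat \<Rightarrow> vertex set \<Rightarrow> (vertex \<Rightarrow> bool) \<Rightarrow> vertex \<Rightarrow> real" where
  "side_prob_match d J g w =
     measure (bernoulli_field (1 / real d)) {B. side_matches J g w (B []) (open_below B [])}"

text \<open>
  A surviving cluster of the growth process and the spine cluster both consist of a uniform ray with
  independent critical percolation behind each side child, only with differently named labels:
  \<open>l k\<close> for the steps, \<open>t w []\<close> for the parent edge of \<open>w\<close> and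
  \<open>t w e\<close> for the edge \<open>e\<close> below it. As the probability is the same for all such
  namings, the two clusters have the same law.
\<close>

lemma prob_word_and_sides:
  fixes \<mu> :: "'l \<Rightarrow> nat pmf" and t :: "vertex \<Rightarrow> vertex \<Rightarrow> 'l" and l :: "nat \<Rightarrow> 'l"
  assumes d: "2 \<le> d" and \<iota>: "\<iota> \<in> words d N"
    and inj_l: "inj_on l {..<N}" and uni: "\<And>k. k < N \<Longrightarrow> \<mu> (l k) = pmf_of_set {..<d}"
    and inj_t: "\<And>w. inj (t w)" and ber: "\<And>w e. \<mu> (t w e) = map_pmf of_bool (bernoulli_pmf (1 / real d))"
    and disj_t: "\<And>w w'. w \<in> side_children d \<iota> \<Longrightarrow> w' \<in> side_children d \<iota> \<Longrightarrow> w \<noteq> w' \<Longrightarrow>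
      range (t w) \<inter> range (t w') = {}"
    and disj_l: "\<And>w k e. l k \<noteq> t w e"
  shows "measure (product_field \<mu>) {X. (\<forall>k\<in>{..<N}. X (l k) = \<iota> ! k) \<and>
      (\<forall>w\<in>side_children d \<iota>. side_matches J g w (X (t w []) = 1) (open_below (\<lambda>e. X (t w e) = 1) []))} =
    (1 / real d) ^ N * (\<Prod>w\<in>side_children d \<iota>. side_prob_match d J g w)"
proof -
  define R where "R w X \<longleftrightarrow> side_matches J g w (X (t w []) = 1) (open_below (\<lambda>e. X (t w e) = 1) [])"
    for w and X :: "'l \<Rightarrow> nat"
  have mR: "Measurable.pred (product_field \<mu>) (R w)" for w
  proof -
    have [measurable]: "Measurable.pred (product_field \<mu>) (\<lambda>X. open_below (\<lambda>e. X (t w e) = 1) [] y)" for y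
      by (rule pred_open_below) measurable
    show ?thesis unfolding R_def side_matches_def by measurable
  qed
  have mall: "Measurable.pred (product_field \<mu>) (\<lambda>X. \<forall>w\<in>side_children d \<iota>. R w X)"
    by (rule pred_intros_countable_bounded) (rule mR)
  have dR: "determined_by (range (t w)) (R w)" for w
    by (rule determined_byI) (simp add: R_def)
  have "measure (product_field \<mu>) {X. (\<forall>k\<in>{..<N}. X (l k) = \<iota> ! k) \<and> (\<forall>w\<in>side_children d \<iota>. R w X)} =
      measure (product_field \<mu>) {X. \<forall>k\<in>{..<N}. X (l k) = \<iota> ! k} *
      measure (product_field \<mu>) {X. \<forall>w\<in>side_children d \<iota>. R w X}"
  proof (rule prob_two_blocks[where I = "range l" and J = "- range l"])
    have "determined_by (- range l) (R w)" for w
      by (rule determined_by_mono[OF dR]) (use disj_l in \<open>auto simp: eq_commute\<close>)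
    then show "determined_by (- range l) (\<lambda>X. \<forall>w\<in>side_children d \<iota>. R w X)"
      unfolding determined_by_def by metis
  qed (use mall in \<open>auto simp: determined_by_def\<close>)
  moreover have "measure (product_field \<mu>) {X. \<forall>k\<in>{..<N}. X (l k) = \<iota> ! k} = (1 / real d) ^ N"
    using prob_along_word[of d \<iota> N l \<mu>] d \<iota> inj_l uni by simp
  moreover have "measure (product_field \<mu>) {X. \<forall>w\<in>side_children d \<iota>. R w X} =
      (\<Prod>w\<in>side_children d \<iota>. measure (product_field \<mu>) {X. R w X})"
    by (rule prob_disjoint_blocks[where J = "\<lambda>w. range (t w)"]) (use finite_side_children disj_t dR mR in blast)+
  moreover have "measure (product_field \<mu>) {X. R w X} = side_prob_match d J g w" for w
  proof -
    have m: "Measurable.pred (bernoulli_field (1 / real d)) (\<lambda>B. side_matches J g w (B []) (open_below B []))"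
    proof -
      have [measurable]: "Measurable.pred (bernoulli_field (1 / real d)) (\<lambda>B. open_below B [] y)" for y
        by (rule pred_open_below) measurable
      show ?thesis unfolding side_matches_def by measurable
    qed
    show ?thesis
      unfolding R_def side_prob_match_def
      by (rule prob_product_field_map[where t = "t w" and g = "\<lambda>_ n. n = 1" and E = "\<lambda>B. side_matches J g w (B []) (open_below B [])", OF inj_t _ m])
        (simp add: ber map_pmf_bit del: One_nat_def)
  qed
  ultimately show ?thesis unfolding R_def by simp
qed

lemma measure_const_conj: "measure M {X. c \<and> Q X} = of_bool c * measure M {X. Q X}"
  by (cases c) simp_all

text \<open>
  The ray along which a surviving root survives.
\<close>

primrec walk :: "(label \<Rightarrow> nat) \<Rightarrow> nat \<Rightarrow> vertex" where
  "walk X 0 = []"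
| "walk X (Suc k) = walk X k @ [choice X (walk X k)]"

lemma walk_eq_iff: "walk X N = \<iota> \<longleftrightarrow> length \<iota> = N \<and> (\<forall>k<N. choice X (take k \<iota>) = \<iota> ! k)"
proof (induction N arbitrary: \<iota>)
  case (Suc N)
  show ?case
  proof (cases \<iota> rule: rev_cases)
    case (snoc \<iota>' c)
    have "walk X (Suc N) = \<iota> \<longleftrightarrow> walk X N = \<iota>' \<and> choice X \<iota>' = c" by (auto simp: snoc)
    also have "\<dots> \<longleftrightarrow> length \<iota>' = N \<and> (\<forall>k<N. choice X (take k \<iota>') = \<iota>' ! k) \<and> choice X \<iota>' = c"
      by (simp add: Suc)
    also have "\<dots> \<longleftrightarrow> length \<iota> = Suc N \<and> (\<forall>k<Suc N. choice X (take k \<iota>) = \<iota> ! k)"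
      by (auto simp: snoc less_Suc_eq nth_append)
    finally show ?thesis .
  qed auto
qed auto

context
  fixes X :: "label \<Rightarrow> nat" and \<iota> :: vertex
  assumes walk: "\<And>k. k < length \<iota> \<Longrightarrow> choice X (take k \<iota>) = \<iota> ! k"
begin

lemma type_along_walk:
  "k \<le> length \<iota> \<Longrightarrow> vertex_type X [] True (take k \<iota>) \<and> open_below (edge_open X [] True) [] (take k \<iota>)"
proof (induction k)
  case (Suc k)
  then have "take (Suc k) \<iota> = take k \<iota> @ [\<iota> ! k]" by (simp add: take_Suc_conv_app_nth)
  then show ?case
    using Suc walk[of k]
    by (simp add: vertex_type_snoc child_type_def open_below_append open_below_Cons edge_open_def)
qed simp

lemma open_off_walk:
  assumes k: "k < length \<iota>" "i \<noteq> \<iota> ! k"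
  shows "open_below (edge_open X [] True) [] (take k \<iota> @ i # y) \<longleftrightarrow>
    side X (take k \<iota> @ [i]) \<and> open_below (side X) (take k \<iota> @ [i]) y"
proof -
  let ?u = "take k \<iota>"
  have u: "vertex_type X [] True ?u" "open_below (edge_open X [] True) [] ?u"
    using type_along_walk[of k] k by auto
  have "open_below (edge_open X [] True) [] (?u @ i # y) \<longleftrightarrow> open_below (edge_open X [] True) ?u (i # y)"
    using u by (simp add: open_below_append)
  also have "\<dots> \<longleftrightarrow> open_below (\<lambda>e. edge_open X [] True (?u @ e)) [] (i # y)"
    using open_below_shift[of "edge_open X [] True" ?u "[]"] by simp
  also have "\<dots> \<longleftrightarrow> open_below (edge_open X ?u True) [] (i # y)"
    using u by (intro open_below_cong) (simp add: edge_open_append)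
  also have "\<dots> \<longleftrightarrow> side X (?u @ [i]) \<and> open_below (edge_open X (?u @ [i]) (child_type X ?u True i)) [] y"
    unfolding open_below_edge_open_Cons using walk[of k] k by simp
  also have "\<dots> \<longleftrightarrow> side X (?u @ [i]) \<and> open_below (side X) (?u @ [i]) y"
  proof (cases "side X (?u @ [i])")
    case True
    then have "child_type X ?u True i = False" using walk[of k] k by (simp add: child_type_def)
    then show ?thesis by (simp add: open_below_edge_open_False)
  qed simp
  finally show ?thesis .
qed

end

text \<open>
  The counterpart of \<open>type_along_walk\<close> and \<open>open_off_walk\<close> for the spine cluster.
\<close>

lemma spine_cluster_along:
  fixes Y :: "spine_label \<Rightarrow> nat"
  assumes sp: "spine (turn Y) N = \<iota>" and x: "x \<in> tree_verts d" "length x \<le> N"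
  shows "prefix x \<iota> \<Longrightarrow> spine_cluster d (spine_input d Y) x"
    and "\<And>w y. w \<in> side_children d \<iota> \<Longrightarrow> x = w @ y \<Longrightarrow>
      spine_cluster d (spine_input d Y) x \<longleftrightarrow> gate Y w \<and> open_below (bush Y w) [] y"
proof -
  have len: "length \<iota> = N" using sp by (auto simp: spine_def)
  have take: "spine (turn Y) k = take k \<iota>" "k < N \<Longrightarrow> turn Y k = \<iota> ! k" if "k \<le> N" for k
    using spine_nth_take[OF sp that] by auto
  note iff = spine_cluster_iff[OF x(1), of "spine_input d Y", unfolded spine_input_def fst_conv snd_conv,
    folded spine_input_def]
  show "spine_cluster d (spine_input d Y) x" if p: "prefix x \<iota>"
  proof -
    have "x = spine (turn Y) (length x)" using p take(1)[OF x(2)] by (auto simp: prefix_def)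
    then show ?thesis unfolding iff by blast
  qed
  fix w y assume w: "w \<in> side_children d \<iota>" and xw: "x = w @ y"
  obtain k i where ki: "w = take k \<iota> @ [i]" "k < N" "i < d" "i \<noteq> \<iota> ! k"
    using w len by (auto simp: side_children_def)
  have wE: "w \<in> tree_edges d" "y \<in> tree_verts d" using x xw ki by auto
  have not_spine: "x \<noteq> spine (turn Y) k'" for k'
  proof
    assume e: "x = spine (turn Y) k'"
    then have "k' \<le> N" using x(2) by (auto simp: spine_def)
    then have "prefix x \<iota>" using e take(1) by (simp add: take_is_prefix)
    then show False using side_children_not_prefix[OF w] xw by blast
  qed
  show "spine_cluster d (spine_input d Y) x \<longleftrightarrow> gate Y w \<and> open_below (bush Y w) [] y"
  proof
    assume "spine_cluster d (spine_input d Y) x"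
    then obtain k' i' y' where *: "i' < d" "i' \<noteq> turn Y k'"
      "restrict (gate Y) (tree_edges d) (spine (turn Y) k' @ [i'])" "x = spine (turn Y) k' @ i' # y'"
      "(\<lambda>w\<in>tree_edges d. descendants d [] (bush Y w)) (spine (turn Y) k' @ [i']) y'"
      using not_spine unfolding iff by blast
    have k': "k' < N" using *(4) x(2) by (auto simp: spine_def)
    have tk: "spine (turn Y) k' = take k' \<iota>" "turn Y k' = \<iota> ! k'" using take[of k'] k' by simp_all
    have eq: "take k \<iota> @ i # y = take k' \<iota> @ i' # y'" using *(4) xw unfolding tk ki(1) by simp
    have "k < length \<iota>" "k' < length \<iota>" using ki(2) k' len by simp_all
    from divergence_unique[OF eq this ki(4)] have "k = k'" "i = i'" "y = y'" using *(2) tk by simp_all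
    then have "spine (turn Y) k' @ [i'] = w" using tk ki by simp
    then show "gate Y w \<and> open_below (bush Y w) [] y"
      using *(3,5) wE \<open>y = y'\<close> by (simp add: descendants_def)
  next
    assume "gate Y w \<and> open_below (bush Y w) [] y"
    then have "spine (turn Y) k = take k \<iota> \<and> i < d \<and> i \<noteq> turn Y k \<and>
        restrict (gate Y) (tree_edges d) (take k \<iota> @ [i]) \<and> x = take k \<iota> @ i # y \<and>
        (\<lambda>w\<in>tree_edges d. descendants d [] (bush Y w)) (take k \<iota> @ [i]) y"
      using take[of k] ki wE xw by (auto simp: descendants_def)
    then show "spine_cluster d (spine_input d Y) x" unfolding iff by metis
  qed
qed

lemma (in growth) measurable_typed_cluster:
  "(\<lambda>X. descendants d [] (edge_open X [] t)) \<in> field \<rightarrow>\<^sub>M config_space (tree_verts d)"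
  by (rule measurable_descendants) measurable

text \<open>
  Both laws are computed on a pattern over a finite set \<open>J\<close> of vertices, by summing over the
  first \<open>N\<close> steps of the ray with \<open>N\<close> beyond the levels of \<open>J\<close>; by
  \<open>prob_word_and_sides\<close> the summands agree.
\<close>

theorem (in supercritical) survivor_cluster_law:
  "distr field (config_space (tree_verts d)) (\<lambda>X. descendants d [] (edge_open X [] True)) =
   distr (spine_space d) (config_space (tree_verts d)) (spine_cluster d)"
proof (rule config_space_measure_eqI)
  let ?C = "config_space (tree_verts d)" and ?F = "spine_field d"
  let ?D = "\<lambda>X. descendants d [] (edge_open X [] True)" and ?S = "\<lambda>Y. spine_cluster d (spine_input d Y)"
  interpret F: prob_space ?F by simp
  have mS: "?S \<in> ?F \<rightarrow>\<^sub>M ?C"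
    using measurable_compose[OF measurable_spine_input measurable_spine_cluster] .
  have dS: "distr (spine_space d) ?C (spine_cluster d) = distr ?F ?C ?S"
    using distr_distr[OF measurable_spine_cluster measurable_spine_input, of d] spine_space_eq_distr[OF d]
    by (simp add: comp_def)
  show "prob_space (distr field ?C ?D)" by (rule prob_space_distr[OF measurable_typed_cluster[of True]])
  show "prob_space (distr (spine_space d) ?C (spine_cluster d))"
    unfolding dS by (rule F.prob_space_distr[OF mS])
  show "sets (distr field ?C ?D) = sets ?C" "sets (distr (spine_space d) ?C (spine_cluster d)) = sets ?C" by auto
  fix J and g :: "vertex \<Rightarrow> bool" assume J: "finite J" "J \<subseteq> tree_verts d"
  obtain N where N: "\<And>x. x \<in> J \<Longrightarrow> length x \<le> N"
    using J(1) by (metis Max_ge finite_imageI image_eqI)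
  define ok where "ok \<iota> = (of_bool (\<forall>x\<in>J. prefix x \<iota> \<longrightarrow> g x) :: real)" for \<iota>
  define total where "total = (\<Sum>\<iota>\<in>words d N. ok \<iota> * ((1 / real d) ^ N * (\<Prod>w\<in>side_children d \<iota>. side_prob_match d J g w)))"
  have cyl: "{T \<in> space ?C. \<forall>e\<in>J. T e = g e} \<in> sets ?C"
  proof -
    have "Measurable.pred ?C (\<lambda>T. \<forall>e\<in>J. T e = g e)" by (rule pred_intros_countable_bounded) measurable
    then show ?thesis by (rule predE)
  qed
  have transfer: "\<P>(T in distr M ?C f. \<forall>e\<in>J. T e = g e) = measure M {X \<in> space M. \<forall>e\<in>J. f X e = g e}"
    if f: "f \<in> M \<rightarrow>\<^sub>M ?C" for M :: "'z measure" and f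
  proof -
    have "f -` {T \<in> space ?C. \<forall>e\<in>J. T e = g e} \<inter> space M = {X \<in> space M. \<forall>e\<in>J. f X e = g e}"
      using measurable_space[OF f] by auto
    then show ?thesis using measure_distr[OF f cyl] by simp
  qed
  have Jw: "x \<in> tree_verts d \<and> length x \<le> length \<iota>" if "\<iota> \<in> words d N" "x \<in> J" for \<iota> x
    using that J N by (auto simp: words_def)
  have "\<P>(T in distr field ?C ?D. \<forall>e\<in>J. T e = g e) = total"
  proof -
    define E where "E X \<longleftrightarrow> (\<forall>e\<in>J. ?D X e = g e)" for X
    have mE: "Measurable.pred field E"
    proof -
      have "Measurable.pred field (\<lambda>X. ?D X e = g e)" for e
        using measurable_compose[OF measurable_typed_cluster[of True] measurable_config_component[of e]] by measurable
      then show ?thesis unfolding E_def by (rule pred_intros_countable_bounded)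
    qed
    have walk_words: "{X. walk X N = \<iota>} = {X. \<forall>k\<in>{..<N}. X (Choice (take k \<iota>)) = \<iota> ! k}"
      if "\<iota> \<in> words d N" for \<iota> using that by (auto simp: walk_eq_iff words_def)
    have one: "prob {X. walk X N = \<iota> \<and> E X} =
        ok \<iota> * ((1 / real d) ^ N * (\<Prod>w\<in>side_children d \<iota>. side_prob_match d J g w))"
      if \<iota>: "\<iota> \<in> words d N" for \<iota>
    proof -
      have len: "length \<iota> = N" using \<iota> by (auto simp: words_def)
      let ?Q = "\<lambda>X. \<forall>w\<in>side_children d \<iota>. side_matches J g w (X (Side (w @ [])) = 1) (open_below (\<lambda>e. X (Side (w @ e)) = 1) [])"
      have "E X \<longleftrightarrow> (\<forall>x\<in>J. prefix x \<iota> \<longrightarrow> g x) \<and> ?Q X" if "walk X N = \<iota>" for X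
      proof -
        have w: "choice X (take k \<iota>) = \<iota> ! k" if "k < length \<iota>" for k
          using \<open>walk X N = \<iota>\<close> that len by (auto simp: walk_eq_iff)
        have "(\<forall>x\<in>J. ?D X x = g x) \<longleftrightarrow> (\<forall>x\<in>J. prefix x \<iota> \<longrightarrow> g x) \<and>
          (\<forall>w\<in>side_children d \<iota>. side_matches J g w (side X w) (open_below (side X) w))"
        proof (rule pattern_iff)
          show "x \<in> tree_verts d \<and> length x \<le> length \<iota>" if "x \<in> J" for x by (rule Jw[OF \<iota> that])
          show "?D X x" if "x \<in> J" "prefix x \<iota>" for x
          proof -
            have "x = take (length x) \<iota>" using that by (auto simp: prefix_def)
            then show ?thesis
              using type_along_walk[OF w, of "length x"] Jw[OF \<iota> that(1)] by (simp add: descendants_def)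
          qed
          show "?D X (w @ y) \<longleftrightarrow> side X w \<and> open_below (side X) w y" if "w \<in> side_children d \<iota>" "w @ y \<in> J" for w y
          proof -
            obtain k i where "w = take k \<iota> @ [i]" "k < length \<iota>" "i \<noteq> \<iota> ! k"
              using \<open>w \<in> side_children d \<iota>\<close> by (auto simp: side_children_def)
            then show ?thesis
              using open_off_walk[OF w, of k i y] Jw[OF \<iota> that(2)] by (simp add: descendants_def)
          qed
        qed
        moreover have "open_below (side X) w = open_below (\<lambda>e. X (Side (w @ e)) = 1) []" for w
          using open_below_shift[of "side X" w "[]"] by (auto simp: side_def)
        ultimately show ?thesis unfolding E_def by (simp add: side_def)
      qed
      then have event: "{X. walk X N = \<iota> \<and> E X} = {X. (\<forall>x\<in>J. prefix x \<iota> \<longrightarrow> g x) \<and>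
          ((\<forall>k\<in>{..<N}. X (Choice (take k \<iota>)) = \<iota> ! k) \<and> ?Q X)}"
        using walk_words[OF \<iota>] by blast
      have "prob {X. (\<forall>k\<in>{..<N}. X (Choice (take k \<iota>)) = \<iota> ! k) \<and> ?Q X} =
          (1 / real d) ^ N * (\<Prod>w\<in>side_children d \<iota>. side_prob_match d J g w)"
        unfolding field_def
      proof (rule prob_word_and_sides[OF d \<iota>])
        show "inj_on (\<lambda>k. Choice (take k \<iota>)) {..<N}"
          using len by (auto simp: inj_on_def dest: arg_cong[where f = length])
        show "range (\<lambda>e. Side (w @ e)) \<inter> range (\<lambda>e. Side (w' @ e)) = {}"
          if "w \<in> side_children d \<iota>" "w' \<in> side_children d \<iota>" "w \<noteq> w'" for w w'
          using that side_children_disjoint by auto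
      qed (auto simp: inj_def)
      then show ?thesis unfolding event ok_def measure_const_conj by simp
    qed
    have "prob {X. E X} = (\<Sum>\<iota>\<in>words d N. prob {X. walk X N = \<iota> \<and> E X})"
      unfolding field_def
    proof (rule prob_partition_AE[OF finite_words])
      show "AE X in product_field label_pmf. walk X N \<in> words d N"
        using AE_choice unfolding field_def
      proof eventually_elim
        case (elim X)
        have "walk X n \<in> tree_verts d \<and> length (walk X n) = n" for n
          using elim by (induction n) auto
        then show ?case by (simp add: words_def)
      qed
      show "Measurable.pred (product_field label_pmf) (\<lambda>X. walk X N = \<iota>)" for \<iota>
        unfolding walk_eq_iff by measurable
      show "Measurable.pred (product_field label_pmf) E" using mE by (simp add: field_def)
    qed
    also have "\<dots> = total" unfolding total_def by (intro sum.cong refl one)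
    finally show ?thesis unfolding transfer[OF measurable_typed_cluster[of True]] E_def by simp
  qed
  moreover have "\<P>(T in distr (spine_space d) ?C (spine_cluster d). \<forall>e\<in>J. T e = g e) = total"
  proof -
    define E where "E Y \<longleftrightarrow> (\<forall>e\<in>J. ?S Y e = g e)" for Y
    have mE: "Measurable.pred ?F E"
    proof -
      have "Measurable.pred ?F (\<lambda>Y. ?S Y e = g e)" for e
        using measurable_compose[OF mS measurable_config_component[of e]] by measurable
      then show ?thesis unfolding E_def by (rule pred_intros_countable_bounded)
    qed
    \<comment> \<open>the gate of a side child acts as the edge above its bush, so that together they are one Bernoulli field\<close>
    define t where "t w e = (if e = [] then Gate w else Bush w e)" for w e :: vertex
    have one: "F.prob {Y. spine (turn Y) N = \<iota> \<and> E Y} =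
        ok \<iota> * ((1 / real d) ^ N * (\<Prod>w\<in>side_children d \<iota>. side_prob_match d J g w))"
      if \<iota>: "\<iota> \<in> words d N" for \<iota>
    proof -
      have len: "length \<iota> = N" using \<iota> by (auto simp: words_def)
      let ?Q = "\<lambda>Y. \<forall>w\<in>side_children d \<iota>. side_matches J g w (Y (t w []) = 1) (open_below (\<lambda>e. Y (t w e) = 1) [])"
      have "E Y \<longleftrightarrow> (\<forall>x\<in>J. prefix x \<iota> \<longrightarrow> g x) \<and> ?Q Y" if sp: "spine (turn Y) N = \<iota>" for Y
      proof -
        have "(\<forall>x\<in>J. ?S Y x = g x) \<longleftrightarrow> (\<forall>x\<in>J. prefix x \<iota> \<longrightarrow> g x) \<and>
          (\<forall>w\<in>side_children d \<iota>. side_matches J g w (gate Y w) (open_below (bush Y w) []))"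
        proof (rule pattern_iff)
          show "x \<in> tree_verts d \<and> length x \<le> length \<iota>" if "x \<in> J" for x by (rule Jw[OF \<iota> that])
          show "?S Y x" if "x \<in> J" "prefix x \<iota>" for x
            using spine_cluster_along(1)[OF sp _ _ that(2)] Jw[OF \<iota> that(1)] len by simp
          show "?S Y (w @ y) \<longleftrightarrow> gate Y w \<and> open_below (bush Y w) [] y" if "w \<in> side_children d \<iota>" "w @ y \<in> J" for w y
            using spine_cluster_along(2)[OF sp _ _ that(1) refl] Jw[OF \<iota> that(2)] len by simp
        qed
        moreover have "open_below (bush Y w) [] = open_below (\<lambda>e. Y (t w e) = 1) []" for w
          by (rule ext, rule open_below_cong) (simp add: t_def bush_def)
        ultimately show ?thesis unfolding E_def by (simp add: t_def gate_def)
      qed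
      moreover have "{Y. spine (turn Y) N = \<iota>} = {Y. \<forall>k\<in>{..<N}. Y (Turn k) = \<iota> ! k}"
        using len by (auto simp: spine_eq_iff)
      ultimately have event: "{Y. spine (turn Y) N = \<iota> \<and> E Y} = {Y. (\<forall>x\<in>J. prefix x \<iota> \<longrightarrow> g x) \<and>
          ((\<forall>k\<in>{..<N}. Y (Turn k) = \<iota> ! k) \<and> ?Q Y)}"
        by blast
      have "F.prob {Y. (\<forall>k\<in>{..<N}. Y (Turn k) = \<iota> ! k) \<and> ?Q Y} =
          (1 / real d) ^ N * (\<Prod>w\<in>side_children d \<iota>. side_prob_match d J g w)"
        by (rule prob_word_and_sides[OF d \<iota>]) (auto simp: inj_def inj_on_def t_def split: if_splits)
      then show ?thesis unfolding event ok_def measure_const_conj by simp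
    qed
    have "F.prob {Y. E Y} = (\<Sum>\<iota>\<in>words d N. F.prob {Y. spine (turn Y) N = \<iota> \<and> E Y})"
    proof (rule prob_partition_AE[OF finite_words])
      have "AE Y in ?F. \<forall>k. turn Y k < d"
        using AE_uniform_label[OF d, of "spine_label_pmf d" "Turn k" for k] by (simp add: AE_all_countable)
      then show "AE Y in ?F. spine (turn Y) N \<in> words d N"
        by eventually_elim (auto simp: words_def spine_def tree_verts_def)
      show "Measurable.pred ?F (\<lambda>Y. spine (turn Y) N = \<iota>)" for \<iota>
        unfolding spine_eq_iff by measurable
      show "Measurable.pred ?F E" by (rule mE)
    qed
    also have "\<dots> = total" unfolding total_def by (intro sum.cong refl one)
    finally show ?thesis unfolding dS transfer[OF mS] E_def by simp
  qed
  ultimately show "\<P>(T in distr field ?C ?D. \<forall>e\<in>J. T e = g e) =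
      \<P>(T in distr (spine_space d) ?C (spine_cluster d). \<forall>e\<in>J. T e = g e)" by simp
qed


section \<open>The cluster below a closed edge\<close>

context growth
begin

lemma place_interior [simp]:
  "Choice w \<in> place v ` interior \<longleftrightarrow> prefix v w"
  "Side w \<in> place v ` interior \<longleftrightarrow> strict_prefix v w"
  "Fresh w \<in> place v ` interior \<longleftrightarrow> strict_prefix v w"
proof -
  have *: "l \<in> place v ` interior \<longleftrightarrow> (\<exists>u. (l = Choice (v @ u)) \<or> (u \<noteq> [] \<and> (l = Side (v @ u) \<or> l = Fresh (v @ u))))" for l
  proof
    assume "l \<in> place v ` interior"
    then obtain k where "k \<in> interior" "l = place v k" by blast
    then show "\<exists>u. (l = Choice (v @ u)) \<or> (u \<noteq> [] \<and> (l = Side (v @ u) \<or> l = Fresh (v @ u)))"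
      by (cases k) (auto simp: interior_def)
  next
    assume "\<exists>u. (l = Choice (v @ u)) \<or> (u \<noteq> [] \<and> (l = Side (v @ u) \<or> l = Fresh (v @ u)))"
    then obtain u where "l = place v (Choice u) \<or> (u \<noteq> [] \<and> (l = place v (Side u) \<or> l = place v (Fresh u)))" by auto
    then show "l \<in> place v ` interior" unfolding interior_def by blast
  qed
  show "Choice w \<in> place v ` interior \<longleftrightarrow> prefix v w"
    "Side w \<in> place v ` interior \<longleftrightarrow> strict_prefix v w"
    "Fresh w \<in> place v ` interior \<longleftrightarrow> strict_prefix v w"
    unfolding * by (auto simp: prefix_def strict_prefix_def)
qed

lemma edge_open_interior:
  "(\<And>l. l \<in> interior \<Longrightarrow> X l = Y l) \<Longrightarrow> e \<noteq> [] \<Longrightarrow> edge_open X [] t e = edge_open Y [] t e"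
  by (rule edge_open_cong) (auto simp: relevant_def interior_def)

text \<open>
  The labels that govern the part of the tree strictly below \<open>v\<close> are the translates of
  \<open>interior\<close>. All that they receive from the rest is the type of \<open>v\<close>.
\<close>

lemma outside_determined:
  assumes XY: "\<And>l. l \<notin> place v ` interior \<Longrightarrow> X l = Y l"
  shows "type_of X v = type_of Y v"
    and "e \<in> tree_edges d \<Longrightarrow> \<not> strict_prefix v e \<Longrightarrow> config X e = config Y e"
proof -
  have "X (Fresh []) = Y (Fresh [])" by (rule XY) simp
  then have root: "fresh X [] = fresh Y []" by (simp add: fresh_def)
  have "vertex_type X [] (fresh Y []) v = vertex_type Y [] (fresh Y []) v"
  proof (rule vertex_type_cong, rule XY)
    fix l assume "l \<in> relevant [] v"
    then consider w where "l = Choice w" "strict_prefix w v" | w where "l = Side w" "prefix w v"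
      | w where "l = Fresh w" "prefix w v"
      by (auto simp: relevant_def)
    then show "l \<notin> place v ` interior"
    proof cases
      case (1 w)
      show ?thesis using 1(2) prefix_order.leD[of v w] unfolding 1(1) place_interior by blast
    next
      case (2 w)
      show ?thesis using 2(2) prefix_order.leD[of w v] unfolding 2(1) place_interior by blast
    next
      case (3 w)
      show ?thesis using 3(2) prefix_order.leD[of w v] unfolding 3(1) place_interior by blast
    qed
  qed
  then show "type_of X v = type_of Y v" using root by simp
  show "config X e = config Y e" if e: "e \<in> tree_edges d" "\<not> strict_prefix v e"
  proof -
    have "edge_open X [] (fresh Y []) e = edge_open Y [] (fresh Y []) e"
    proof (rule edge_open_cong)
      fix l assume "l \<in> relevant [] e"
      then consider w where "l = Choice w" "strict_prefix w e" | w where "l = Side w" "prefix w e"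
        | w where "l = Fresh w" "prefix w e"
        by (auto simp: relevant_def)
      then have "l \<notin> place v ` interior"
      proof cases
        case (1 w)
        show ?thesis using 1(2) e(2) prefix_order.le_less_trans[of v w e] unfolding 1(1) place_interior by blast
      next
        case (2 w)
        show ?thesis using 2(2) e(2) prefix_order.less_le_trans[of v w e] unfolding 2(1) place_interior by blast
      next
        case (3 w)
        show ?thesis using 3(2) e(2) prefix_order.less_le_trans[of v w e] unfolding 3(1) place_interior by blast
      qed
      then show "X l = Y l" by (rule XY)
    qed (use e in auto)
    then show ?thesis using e root by (simp add: config_def)
  qed
qed

lemma descendants_config:
  assumes "v \<in> tree_verts d"
  shows "descendants d v (config X) = descendants d [] (edge_open (shift v X) [] (type_of X v))"
proof -
  have "edge_open X v t = edge_open (shift v X) [] t" for t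
    using edge_open_shift[of X v "[]" t] by auto
  then show ?thesis
    unfolding descendants_def by (intro restrict_ext) (simp add: config_open_below[OF assms])
qed

lemma determined_by_typed_cluster:
  "determined_by interior (\<lambda>X. descendants d [] (edge_open X [] t))"
proof (rule determined_byI)
  fix X Y :: "label \<Rightarrow> nat" assume XY: "\<And>l. l \<in> interior \<Longrightarrow> X l = Y l"
  have "open_below (edge_open X [] t) [] x = open_below (edge_open Y [] t) [] x" for x
    by (rule open_below_cong) (simp add: edge_open_interior[OF XY])
  then show "descendants d [] (edge_open X [] t) = descendants d [] (edge_open Y [] t)"
    by (simp add: descendants_def)
qed

lemma pred_parent_closed_config [measurable]: "Measurable.pred field (\<lambda>X. parent_closed (config X) v)"
proof -
  have "Measurable.pred field (\<lambda>X. config X e)" for e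
    using measurable_compose[OF measurable_config measurable_config_component[of e]] .
  then show ?thesis unfolding parent_closed_def by measurable
qed

text \<open>
  The conditions on the outside and on the type of \<open>v\<close> are determined by the labels outside
  \<open>place v ` interior\<close>, and given the type the part below \<open>v\<close> is determined by the
  labels inside.
\<close>

lemma prob_top_cluster:
  assumes v: "v \<in> tree_verts d"
  defines "out \<equiv> {e \<in> tree_edges d. \<not> strict_prefix v e}"
  assumes G: "G \<in> sets (config_space out)" and B: "B \<in> sets (config_space (tree_verts d))"
  shows "prob {X. (parent_closed (config X) v \<and> type_of X v = b \<and> restrict (config X) out \<in> G) \<and>
      descendants d v (config X) \<in> B} =
    prob {X. parent_closed (config X) v \<and> type_of X v = b \<and> restrict (config X) out \<in> G} *
    measure (distr field (config_space (tree_verts d)) (\<lambda>X. descendants d [] (edge_open X [] b))) B"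
proof -
  define E where "E X \<longleftrightarrow> parent_closed (config X) v \<and> type_of X v = b \<and> restrict (config X) out \<in> G" for X
  define Q where "Q X \<longleftrightarrow> descendants d [] (edge_open X [] b) \<in> B" for X
  have mQ: "Measurable.pred field Q"
    unfolding Q_def by (rule pred_sets2[OF B measurable_typed_cluster])
  have mE: "Measurable.pred field E"
  proof -
    have "(\<lambda>X. restrict (config X) out) \<in> field \<rightarrow>\<^sub>M config_space out"
      by (intro measurable_to_config_space measurable_compose[OF measurable_config measurable_config_component])
    then have [measurable]: "Measurable.pred field (\<lambda>X. restrict (config X) out \<in> G)" by (rule pred_sets2[OF G])
    show ?thesis unfolding E_def by measurable
  qed
  have "{X. (parent_closed (config X) v \<and> type_of X v = b \<and> restrict (config X) out \<in> G) \<and>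
      descendants d v (config X) \<in> B} = {X. E X \<and> Q (shift v X)}"
    unfolding E_def Q_def descendants_config[OF v] by auto
  moreover have "prob {X. E X \<and> Q (shift v X)} = prob {X. E X} * prob {X. Q (shift v X)}"
  proof (rule prob_two_blocks'[where I = "- (place v ` interior)" and J = "place v ` interior"])
    show "determined_by (- (place v ` interior)) E"
    proof (rule determined_byI)
      fix X Y :: "label \<Rightarrow> nat" assume "\<And>l. l \<in> - (place v ` interior) \<Longrightarrow> X l = Y l"
      then have XY: "\<And>l. l \<notin> place v ` interior \<Longrightarrow> X l = Y l" by blast
      have "restrict (config X) out = restrict (config Y) out"
        by (intro restrict_ext) (simp add: out_def outside_determined(2)[OF XY])
      moreover have "parent_closed (config X) v = parent_closed (config Y) v"
        using outside_determined(2)[OF XY, of v] v by (auto simp: parent_closed_def)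
      ultimately show "E X = E Y" unfolding E_def using outside_determined(1)[OF XY] by simp
    qed
    have "determined_by interior Q"
      unfolding Q_def by (rule determined_by_compose[OF determined_by_typed_cluster])
    then show "determined_by (place v ` interior) (\<lambda>X. Q (shift v X))" by (rule determined_by_reindex)
    show "Measurable.pred field (\<lambda>X. Q (shift v X))" by (rule pred_shift[OF mQ])
  qed (use mE in auto)
  moreover have "prob {X. Q (shift v X)} = prob {X. Q X}" by (rule prob_shift[OF mQ])
  moreover have "prob {X. Q X} = measure (distr field (config_space (tree_verts d)) (\<lambda>X. descendants d [] (edge_open X [] b))) B"
    unfolding Q_def using B by (subst measure_distr[OF measurable_typed_cluster]) (auto simp: vimage_def)
  ultimately show ?thesis unfolding E_def by simp
qed

lemma parent_closed_type:
  assumes v: "v \<in> tree_verts d" and pc: "parent_closed (config X) v"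
  shows "type_of X v = fresh X v"
proof (cases v rule: rev_cases)
  case (snoc w i)
  then have "\<not> config X (w @ [i])" using pc by (simp add: parent_closed_def)
  then show ?thesis using v unfolding snoc by (subst (asm) config_snoc) (auto simp: vertex_type_snoc child_type_def)
qed simp

text \<open>
  By \<open>parent_closed_type\<close>, the type of a vertex below a closed edge is its fresh label, and this
  label has no influence on the state of that edge.
\<close>

lemma prob_top_type:
  assumes v: "v \<in> tree_verts d"
  shows "prob {X. parent_closed (config X) v \<and> type_of X v = b} =
    prob {X. parent_closed (config X) v} * (if b then q else 1 - q)"
proof -
  have "{X. parent_closed (config X) v \<and> type_of X v = b} = {X. parent_closed (config X) v \<and> fresh X v = b}"
    using parent_closed_type[OF v] by auto
  moreover have "prob {X. parent_closed (config X) v \<and> fresh X v = b} =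
      prob {X. parent_closed (config X) v} * prob {X. fresh X v = b}"
  proof (rule prob_two_blocks'[where I = "- {Fresh v}" and J = "{Fresh v}"])
    show "determined_by (- {Fresh v}) (\<lambda>X. parent_closed (config X) v)"
    proof (rule determined_byI)
      fix X Y :: "label \<Rightarrow> nat" assume XY: "\<And>l. l \<in> - {Fresh v} \<Longrightarrow> X l = Y l"
      have "config X v = config Y v" if "v \<noteq> []"
      proof -
        have "fresh X [] = fresh Y []" using XY[of "Fresh []"] that by (simp add: fresh_def)
        moreover have "edge_open X [] t v = edge_open Y [] t v" for t
          using that by (intro edge_open_cong XY) auto
        ultimately show ?thesis using v that by (simp add: config_def)
      qed
      then show "parent_closed (config X) v = parent_closed (config Y) v" by (simp add: parent_closed_def)
    qed
  qed (auto simp: determined_by_def fresh_def)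
  ultimately show ?thesis by (simp add: prob_fresh)
qed

lemma prob_parent_closed_pos:
  assumes v: "v \<in> tree_verts d" and "s < 1"
  shows "0 < prob {X. parent_closed (config X) v}"
proof (cases v rule: rev_cases)
  case Nil
  then show ?thesis using prob_space by (simp add: parent_closed_def)
next
  case (snoc w i)
  have "prob {X. side X v = False \<and> choice X w \<noteq> i} = prob {X. side X v = False} * prob {X. \<not> choice X w = i}"
    by (rule prob_two_blocks'[where I = "{Side v}" and J = "{Choice w}"]) (auto simp: determined_by_def side_def)
  also have "prob {X. \<not> choice X w = i} = 1 - prob {X. choice X w = i}"
    unfolding field_def by (rule prob_not) measurable
  also have "\<dots> = 1 - 1 / real d" using v by (simp add: snoc prob_choice)
  also have "prob {X. side X v = False} * (1 - 1 / real d) > 0"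
    using \<open>s < 1\<close> d unfolding prob_side by simp
  finally have "0 < prob {X. side X v = False \<and> choice X w \<noteq> i}" .
  also have "\<dots> \<le> prob {X. parent_closed (config X) v}"
  proof (rule finite_measure_mono)
    show "{X. side X v = False \<and> choice X w \<noteq> i} \<subseteq> {X. parent_closed (config X) v}"
      using v config_snoc[of w i] by (auto simp: snoc parent_closed_def)
  qed auto
  finally show ?thesis .
qed

lemma measure_config_law:
  assumes Q: "Measurable.pred (config_space (tree_edges d)) Q"
  shows "measure config_law {\<omega> \<in> space config_law. Q \<omega>} = prob {X. Q (config X)}"
proof -
  have "config -` {\<omega> \<in> space (config_space (tree_edges d)). Q \<omega>} \<inter> space field = {X. Q (config X)}"
    using measurable_space[OF measurable_config] by auto
  then show ?thesis
    unfolding config_law_def using measure_distr[OF measurable_config predE[OF Q]] by simp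
qed

lemma distr_loose_cluster:
  "distr field (config_space (tree_verts d)) (\<lambda>X. descendants d [] (edge_open X [] False)) = percolation_tree d s"
proof -
  have "percolation_tree d s = distr (distr field (bernoulli_field s) (\<lambda>X v. side X v)) (config_space (tree_verts d)) (descendants d [])"
    unfolding distr_side by (rule percolation_tree_eq_distr)
  also have "\<dots> = distr field (config_space (tree_verts d)) (descendants d [] \<circ> (\<lambda>X v. side X v))"
    by (rule distr_distr[OF _ measurable_side]) measurable
  also have "descendants d [] \<circ> (\<lambda>X v. side X v) = (\<lambda>X. descendants d [] (edge_open X [] False))"
    by (auto simp: descendants_def open_below_edge_open_False)
  finally show ?thesis by simp
qed

text \<open>
  Almost surely nothing survives, so all edges are given by side labels.
\<close>

lemma config_law_no_survivors:
  assumes "q = 0" shows "config_law = bernoulli_percolation d s"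
proof -
  have "AE X in field. \<not> fresh X v" for v
  proof (rule AE_I[where N = "{X. fresh X v}"])
    have "emeasure field {X. fresh X v} = ennreal q"
      using prob_fresh[of v True] by (simp add: emeasure_eq_measure)
    then show "emeasure field {X. fresh X v} = 0" unfolding assms by simp
  qed auto
  then have AE: "AE X in field. \<forall>v. \<not> fresh X v" by (simp add: AE_all_countable)
  have "config_law = distr field (config_space (tree_edges d)) (\<lambda>X. restrict (side X) (tree_edges d))"
    unfolding config_law_def
  proof (rule distr_cong_AE)
    show "AE X in field. config X = restrict (side X) (tree_edges d)"
      using AE
    proof eventually_elim
      case (elim X)
      have "\<not> vertex_type X u False v" for u v
        using elim by (induction v arbitrary: u) (auto simp: child_type_def)
      then show ?case using elim by (auto simp: config_def edge_open_def intro!: restrict_ext)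
    qed
    show "(\<lambda>X. restrict (side X) (tree_edges d)) \<in> field \<rightarrow>\<^sub>M config_space (tree_edges d)"
      by (rule measurable_to_config_space) measurable
  qed auto
  also have "\<dots> = distr (distr field (bernoulli_field s) (\<lambda>X v. side X v)) (config_space (tree_edges d)) (\<lambda>B. restrict B (tree_edges d))"
    by (subst distr_distr[OF _ measurable_side]) (auto simp: comp_def intro!: measurable_to_config_space)
  also have "\<dots> = bernoulli_percolation d s"
    unfolding distr_side by (rule bernoulli_percolation_eq_distr[symmetric])
  finally show ?thesis .
qed

end

text \<open>
  Conditional laws from product formulas: the hypothesis says that \<open>f\<close> has law \<open>L\<close>
  under the conditioned measure, without the quotient.
\<close>

lemma distr_uniform_measure_eqI:
  assumes P: "prob_space P" and A: "A \<in> sets P" "0 < measure P A" and f: "f \<in> P \<rightarrow>\<^sub>M N"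
    and L: "prob_space L" "sets L = sets N"
    and factor: "\<And>B. B \<in> sets N \<Longrightarrow> measure P {\<omega> \<in> A. f \<omega> \<in> B} = measure P A * measure L B"
  shows "distr (uniform_measure P A) N f = L"
proof (rule measure_eqI)
  interpret P: prob_space P by fact
  interpret L: prob_space L by fact
  show "sets (distr (uniform_measure P A) N f) = sets L" using L by simp
  fix B assume "B \<in> sets (distr (uniform_measure P A) N f)"
  then have B: "B \<in> sets N" by simp
  have f': "f \<in> uniform_measure P A \<rightarrow>\<^sub>M N" using f by simp
  have "emeasure (distr (uniform_measure P A) N f) B = emeasure (uniform_measure P A) (f -` B \<inter> space P)"
    using B by (subst emeasure_distr[OF f']) auto
  also have "\<dots> = emeasure P (A \<inter> (f -` B \<inter> space P)) / emeasure P A"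
    using A measurable_sets[OF f B] by simp
  also have "A \<inter> (f -` B \<inter> space P) = {\<omega> \<in> A. f \<omega> \<in> B}"
    using sets.sets_into_space[OF A(1)] by auto
  also have "emeasure P \<dots> / emeasure P A = ennreal (measure P A * measure L B / measure P A)"
    using A(2) by (simp add: P.emeasure_eq_measure factor[OF B] divide_ennreal)
  also have "\<dots> = emeasure L B" using A(2) by (simp add: L.emeasure_eq_measure)
  finally show "emeasure (distr (uniform_measure P A) N f) B = emeasure L B" .
qed

lemma indep_var_uniform_measureI:
  assumes P: "prob_space P" and A: "A \<in> sets P" "0 < measure P A"
    and f: "f \<in> P \<rightarrow>\<^sub>M N" and g: "g \<in> P \<rightarrow>\<^sub>M L"
    and factor: "\<And>B C. B \<in> sets N \<Longrightarrow> C \<in> sets L \<Longrightarrow>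
      measure P {\<omega> \<in> A. f \<omega> \<in> B \<and> g \<omega> \<in> C} * measure P A = measure P {\<omega> \<in> A. f \<omega> \<in> B} * measure P {\<omega> \<in> A. g \<omega> \<in> C}"
  shows "prob_space.indep_var (uniform_measure P A) N f L g"
proof -
  interpret P: prob_space P by fact
  let ?U = "uniform_measure P A"
  interpret U: prob_space ?U
    using A by (intro prob_space_uniform_measure) (auto simp: P.emeasure_eq_measure)
  have f': "f \<in> ?U \<rightarrow>\<^sub>M N" and g': "g \<in> ?U \<rightarrow>\<^sub>M L" using f g by simp_all
  have fg: "(\<lambda>\<omega>. (f \<omega>, g \<omega>)) \<in> ?U \<rightarrow>\<^sub>M N \<Otimes>\<^sub>M L" using f' g' by simp
  interpret F: prob_space "distr ?U N f" by (rule U.prob_space_distr[OF f'])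
  interpret G: prob_space "distr ?U L g" by (rule U.prob_space_distr[OF g'])
  have U_measure: "measure ?U {\<omega> \<in> space P. Q \<omega>} = measure P {\<omega> \<in> A. Q \<omega>} / measure P A"
    if "{\<omega> \<in> space P. Q \<omega>} \<in> sets P" for Q
  proof -
    have "A \<inter> {\<omega> \<in> space P. Q \<omega>} = {\<omega> \<in> A. Q \<omega>}" using sets.sets_into_space[OF A(1)] by auto
    then show ?thesis using A that by (subst measure_uniform_measure) (auto simp: P.emeasure_eq_measure)
  qed
  have "distr ?U N f \<Otimes>\<^sub>M distr ?U L g = distr ?U (N \<Otimes>\<^sub>M L) (\<lambda>\<omega>. (f \<omega>, g \<omega>))"
  proof (rule pair_measure_eqI)
    show "sigma_finite_measure (distr ?U N f)" "sigma_finite_measure (distr ?U L g)" by unfold_locales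
    fix B C assume "B \<in> sets (distr ?U N f)" "C \<in> sets (distr ?U L g)"
    then have B: "B \<in> sets N" and C: "C \<in> sets L" by auto
    have mB: "{\<omega> \<in> space P. f \<omega> \<in> B} \<in> sets P" and mC: "{\<omega> \<in> space P. g \<omega> \<in> C} \<in> sets P"
      using measurable_sets[OF f B] measurable_sets[OF g C] by (auto simp: vimage_def Int_def conj_commute)
    then have mBC: "{\<omega> \<in> space P. f \<omega> \<in> B \<and> g \<omega> \<in> C} \<in> sets P"
    proof -
      have "{\<omega> \<in> space P. f \<omega> \<in> B \<and> g \<omega> \<in> C} = {\<omega> \<in> space P. f \<omega> \<in> B} \<inter> {\<omega> \<in> space P. g \<omega> \<in> C}" by auto
      then show ?thesis using sets.Int[OF mB mC] by simp
    qed
    have 1: "emeasure (distr ?U N f) B = measure ?U {\<omega> \<in> space P. f \<omega> \<in> B}"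
      using B by (subst emeasure_distr[OF f']) (auto simp: U.emeasure_eq_measure vimage_def Int_def conj_commute)
    have 2: "emeasure (distr ?U L g) C = measure ?U {\<omega> \<in> space P. g \<omega> \<in> C}"
      using C by (subst emeasure_distr[OF g']) (auto simp: U.emeasure_eq_measure vimage_def Int_def conj_commute)
    have 3: "emeasure (distr ?U (N \<Otimes>\<^sub>M L) (\<lambda>\<omega>. (f \<omega>, g \<omega>))) (B \<times> C) = measure ?U {\<omega> \<in> space P. f \<omega> \<in> B \<and> g \<omega> \<in> C}"
      using B C by (subst emeasure_distr[OF fg]) (auto simp: U.emeasure_eq_measure vimage_def Int_def conj_commute)
    have "measure ?U {\<omega> \<in> space P. f \<omega> \<in> B} * measure ?U {\<omega> \<in> space P. g \<omega> \<in> C} =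
        measure ?U {\<omega> \<in> space P. f \<omega> \<in> B \<and> g \<omega> \<in> C}"
      unfolding U_measure[OF mB] U_measure[OF mC] U_measure[OF mBC]
      using factor[OF B C] A(2) by (simp add: field_simps)
    then show "emeasure (distr ?U N f) B * emeasure (distr ?U L g) C =
        emeasure (distr ?U (N \<Otimes>\<^sub>M L) (\<lambda>\<omega>. (f \<omega>, g \<omega>))) (B \<times> C)"
      unfolding 1 2 3 by (simp add: ennreal_mult[symmetric])
  qed (auto intro!: sets_pair_measure_cong)
  then show ?thesis unfolding U.indep_var_distribution_eq using f' g' by simp
qed


section \<open>Finite clusters in order of exploration\<close>

lemma finite_cluster_top_iff:
  "v \<in> tree_verts d \<Longrightarrow> finite_cluster_top d \<omega> v \<longleftrightarrow> parent_closed \<omega> v \<and> infinite_below d \<omega> v = False"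
  using infinite_cluster_top[of v d \<omega>] by (auto simp: finite_cluster_top_def)

lemma rooted_cluster_descendants: "v \<in> tree_verts d \<Longrightarrow> rooted_cluster d v = descendants d v"
  by (auto simp: rooted_cluster_eq descendants_def)

text \<open>
  The position of an element in the enumeration is the number of smaller elements. In this form it can be read
  off from the past of the exploration.
\<close>

lemma enumerate_eq_iff:
  fixes S :: "nat set"
  assumes "infinite S"
  shows "enumerate S m = i \<longleftrightarrow> i \<in> S \<and> card {j. j < i \<and> j \<in> S} = m"
proof -
  have card: "card {j. j < enumerate S n \<and> j \<in> S} = n" for n
  proof -
    have "{j. j < enumerate S n \<and> j \<in> S} = enumerate S ` {..<n}"
    proof safe
      fix j assume "j < enumerate S n" "j \<in> S"
      then obtain k where "j = enumerate S k" using enumerate_Ex[OF assms] by metis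
      then show "j \<in> enumerate S ` {..<n}"
        using \<open>j < enumerate S n\<close> enumerate_mono_iff[OF assms] by auto
    qed (use assms enumerate_mono_iff[OF assms] enumerate_in_set[OF assms] in auto)
    then show ?thesis
      using strict_mono_enumerate[OF assms] by (simp add: card_image strict_mono_imp_inj_on)
  qed
  show ?thesis
  proof
    assume "enumerate S m = i"
    then show "i \<in> S \<and> card {j. j < i \<and> j \<in> S} = m"
      using card[of m] enumerate_in_set[OF assms, of m] by auto
  next
    assume i: "i \<in> S \<and> card {j. j < i \<and> j \<in> S} = m"
    then obtain k where "i = enumerate S k" using enumerate_Ex[OF assms] by metis
    then show "enumerate S m = i" using i card[of k] by simp
  qed
qed

lemma measurable_enumerate:
  "(\<And>i. Measurable.pred M (\<lambda>\<omega>. i \<in> S \<omega>)) \<Longrightarrow> (\<lambda>\<omega>. enumerate (S \<omega>) n) \<in> M \<rightarrow>\<^sub>M count_space (UNIV :: nat set)"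
proof (induction n arbitrary: S)
  case 0
  note [measurable] = 0
  show ?case unfolding enumerate_0 by measurable
next
  case (Suc n)
  note [measurable] = Suc.prems
  have "Measurable.pred M (\<lambda>\<omega>. i \<in> S \<omega> - {LEAST k. k \<in> S \<omega>})" for i
  proof -
    have "Measurable.pred M (\<lambda>\<omega>. i \<in> S \<omega> \<and> i \<noteq> (LEAST k. k \<in> S \<omega>))" by measurable
    then show ?thesis by simp
  qed
  from Suc.IH[OF this] show ?case unfolding enumerate_Suc .
qed

text \<open>
  Closing all edges strictly below \<open>v\<close> does not affect paths that start at a vertex
  \<open>u\<close> not below \<open>v\<close>: such a path reaches these edges only through the parent edge of
  \<open>v\<close>, which is closed.
\<close>

lemma open_below_prune:
  assumes c: "parent_closed \<omega> v" and u: "\<not> prefix v u" "u \<in> tree_verts d" "y \<in> tree_verts d"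
  shows "open_below (\<lambda>e\<in>tree_edges d. \<not> strict_prefix v e \<and> \<omega> e) u y = open_below \<omega> u y"
proof (cases "\<exists>z. prefix z y \<and> z \<noteq> [] \<and> strict_prefix v (u @ z)")
  case False
  then show ?thesis
    using u by (intro open_below_cong) (auto dest: tree_verts_prefix)
next
  case True
  then obtain z where z: "prefix z y" "strict_prefix v (u @ z)" by blast
  then have "prefix v (u @ z)" by auto
  then obtain z0 where z0: "v = u @ z0" "prefix z0 z" using u(1) by (auto simp: prefix_append)
  then have ne: "z0 \<noteq> []" using u(1) by auto
  have "prefix z0 y" using z0(2) z(1) by (rule prefix_order.trans)
  moreover have "\<not> \<omega> (u @ z0)" using c z0 ne by (auto simp: parent_closed_def)
  ultimately show ?thesis
    unfolding open_below_def using ne u z0 by (auto dest: tree_verts_prefix intro!: exI[of _ z0])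
qed

context supercritical
begin

abbreviation \<open>configs \<equiv> config_space (tree_edges d)\<close>
abbreviation \<open>shapes \<equiv> config_space (tree_verts d)\<close>

text \<open>
  The law of the cluster below a closed edge, given the type of its top.
\<close>

definition cluster_law :: "bool \<Rightarrow> (vertex \<Rightarrow> bool) measure" where
  "cluster_law b = (if b then distr (spine_space d) shapes (spine_cluster d) else percolation_tree d (1 / real d))"

lemma cluster_law_eq: "cluster_law b = distr field shapes (\<lambda>X. descendants d [] (edge_open X [] b))"
  by (cases b) (simp_all add: cluster_law_def survivor_cluster_law distr_loose_cluster)

lemma prob_space_cluster_law: "prob_space (cluster_law b)"
  unfolding cluster_law_eq by (rule prob_space_distr[OF measurable_typed_cluster])

lemma sets_cluster_law [simp]: "sets (cluster_law b) = sets shapes"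
  by (simp add: cluster_law_eq)

lemma prob_space_config_law: "prob_space config_law"
  unfolding config_law_def by (rule prob_space_distr[OF measurable_config])

lemma sets_config_law [simp, measurable_cong]: "sets config_law = sets configs"
  by (simp add: config_law_def)

lemma pred_configs [measurable]:
  "Measurable.pred configs (\<lambda>\<omega>. parent_closed \<omega> v)"
  "Measurable.pred configs (\<lambda>\<omega>. infinite_below d \<omega> v)"
  "descendants d v \<in> configs \<rightarrow>\<^sub>M shapes"
proof -
  show "Measurable.pred configs (\<lambda>\<omega>. parent_closed \<omega> v)" unfolding parent_closed_def by measurable
  show "Measurable.pred configs (\<lambda>\<omega>. infinite_below d \<omega> v)" by (rule pred_infinite_below) measurable
  show "descendants d v \<in> configs \<rightarrow>\<^sub>M shapes" by (rule measurable_descendants) measurable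
qed

lemma pred_restrict:
  assumes "G \<in> sets (config_space E)"
  shows "Measurable.pred configs (\<lambda>\<omega>. restrict \<omega> E \<in> G)"
  by (rule pred_sets2[OF assms]) (auto intro!: measurable_to_config_space)

abbreviation \<open>is_top \<omega> v b \<equiv> parent_closed \<omega> v \<and> infinite_below d \<omega> v = b\<close>

text \<open>
  In the supercritical phase infinite descent is almost surely the type; this carries events about the type
  over to the law of the configuration.
\<close>

lemma top_prob_eq:
  assumes v: "v \<in> tree_verts d" and Q: "Measurable.pred configs Q"
  shows "\<P>(\<omega> in config_law. (parent_closed \<omega> v \<and> infinite_below d \<omega> v = b) \<and> Q \<omega>) =
    prob {X. (parent_closed (config X) v \<and> type_of X v = b) \<and> Q (config X)}"
proof -
  note [measurable] = Q
  have "\<P>(\<omega> in config_law. is_top \<omega> v b \<and> Q \<omega>) = prob {X. is_top (config X) v b \<and> Q (config X)}"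
    by (rule measure_config_law) measurable
  also have "\<dots> = prob {X. (parent_closed (config X) v \<and> type_of X v = b) \<and> Q (config X)}"
  proof (rule finite_measure_eq_AE)
    show "AE X in field. (X \<in> {X. is_top (config X) v b \<and> Q (config X)}) =
        (X \<in> {X. (parent_closed (config X) v \<and> type_of X v = b) \<and> Q (config X)})"
      using AE_regular by eventually_elim (simp add: regular_infinite_below[OF _ v])
    have [measurable]: "Measurable.pred field (\<lambda>X. Q (config X))"
      by (rule measurable_compose[OF measurable_config Q])
    have [measurable]: "Measurable.pred field (\<lambda>X. infinite_below d (config X) v)"
      by (rule measurable_compose[OF measurable_config pred_configs(2)])
    show "{X. is_top (config X) v b \<and> Q (config X)} \<in> events"
      "{X. (parent_closed (config X) v \<and> type_of X v = b) \<and> Q (config X)} \<in> events"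
      by (intro sets_Collect_field; measurable)+
  qed
  finally show ?thesis .
qed

text \<open>
  The form in which conditional laws and independence are used: the cluster of a top of a given type is
  independent of all edges that are not strictly below it.
\<close>

lemma top_cluster_factor:
  assumes v: "v \<in> tree_verts d"
  defines "out \<equiv> {e \<in> tree_edges d. \<not> strict_prefix v e}"
  assumes G: "G \<in> sets (config_space out)" and B: "B \<in> sets shapes"
  shows "\<P>(\<omega> in config_law. (parent_closed \<omega> v \<and> infinite_below d \<omega> v = b) \<and> restrict \<omega> out \<in> G \<and> rooted_cluster d v \<omega> \<in> B) =
    \<P>(\<omega> in config_law. (parent_closed \<omega> v \<and> infinite_below d \<omega> v = b) \<and> restrict \<omega> out \<in> G) * measure (cluster_law b) B"
proof -
  note [measurable] = pred_restrict[OF G] pred_sets2[OF B pred_configs(3)]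
  have "\<P>(\<omega> in config_law. is_top \<omega> v b \<and> restrict \<omega> out \<in> G \<and> rooted_cluster d v \<omega> \<in> B) =
      prob {X. (parent_closed (config X) v \<and> type_of X v = b) \<and> restrict (config X) out \<in> G \<and> descendants d v (config X) \<in> B}"
    unfolding rooted_cluster_descendants[OF v] by (rule top_prob_eq[OF v]) measurable
  also have "\<dots> = prob {X. (parent_closed (config X) v \<and> type_of X v = b \<and> restrict (config X) out \<in> G) \<and> descendants d v (config X) \<in> B}"
    by (simp add: conj_assoc)
  also have "\<dots> = prob {X. parent_closed (config X) v \<and> type_of X v = b \<and> restrict (config X) out \<in> G} * measure (cluster_law b) B"
    unfolding cluster_law_eq out_def by (rule prob_top_cluster[OF v G[unfolded out_def] B])
  also have "prob {X. parent_closed (config X) v \<and> type_of X v = b \<and> restrict (config X) out \<in> G} =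
      \<P>(\<omega> in config_law. is_top \<omega> v b \<and> restrict \<omega> out \<in> G)"
    by (subst top_prob_eq[OF v]) (simp_all add: conj_assoc pred_restrict[OF G])
  finally show ?thesis .
qed

lemma top_prob:
  assumes v: "v \<in> tree_verts d"
  shows "\<P>(\<omega> in config_law. parent_closed \<omega> v \<and> infinite_below d \<omega> v = b) =
      \<P>(\<omega> in config_law. parent_closed \<omega> v) * (if b then q else 1 - q)"
    and "0 < \<P>(\<omega> in config_law. parent_closed \<omega> v)"
    and "0 < \<P>(\<omega> in config_law. parent_closed \<omega> v \<and> infinite_below d \<omega> v = b)"
proof -
  have pc: "\<P>(\<omega> in config_law. parent_closed \<omega> v) = prob {X. parent_closed (config X) v}"
    by (rule measure_config_law) measurable
  show eq: "\<P>(\<omega> in config_law. parent_closed \<omega> v \<and> infinite_below d \<omega> v = b) =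
      \<P>(\<omega> in config_law. parent_closed \<omega> v) * (if b then q else 1 - q)"
    using top_prob_eq[OF v, of "\<lambda>_. True" b] prob_top_type[OF v, of b] pc by simp
  have "1 / real d < 1" using d by simp
  from prob_parent_closed_pos[OF v this] show pos: "0 < \<P>(\<omega> in config_law. parent_closed \<omega> v)"
    by (simp add: pc)
  show "0 < \<P>(\<omega> in config_law. parent_closed \<omega> v \<and> infinite_below d \<omega> v = b)"
    unfolding eq using pos q_pos q_less by simp
qed

lemma rooted_cluster_measurable: "v \<in> tree_verts d \<Longrightarrow> rooted_cluster d v \<in> configs \<rightarrow>\<^sub>M shapes"
  by (simp add: rooted_cluster_descendants)

lemma sets_top: "{\<omega> \<in> space config_law. parent_closed \<omega> v \<and> infinite_below d \<omega> v = b} \<in> sets config_law"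
proof -
  have "Measurable.pred config_law (\<lambda>\<omega>. parent_closed \<omega> v \<and> infinite_below d \<omega> v = b)" by measurable
  then show ?thesis by (rule predE)
qed

lemma top_cluster_prob:
  assumes v: "v \<in> tree_verts d" and B: "B \<in> sets shapes"
  shows "\<P>(\<omega> in config_law. (parent_closed \<omega> v \<and> infinite_below d \<omega> v = b) \<and> rooted_cluster d v \<omega> \<in> B) =
    \<P>(\<omega> in config_law. parent_closed \<omega> v \<and> infinite_below d \<omega> v = b) * measure (cluster_law b) B"
proof -
  have "restrict \<omega> E \<in> space (config_space E)" for \<omega> :: "vertex \<Rightarrow> bool" and E
    by (simp add: space_config_space)
  then show ?thesis
    using top_cluster_factor[OF v sets.top B, of b] by simp
qed

lemma conditional_cluster_law:
  assumes v: "v \<in> tree_verts d"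
  shows "distr (uniform_measure config_law {\<omega> \<in> space config_law. parent_closed \<omega> v \<and> infinite_below d \<omega> v = b})
    shapes (rooted_cluster d v) = cluster_law b"
proof (rule distr_uniform_measure_eqI[OF prob_space_config_law sets_top top_prob(3)[OF v] _ prob_space_cluster_law sets_cluster_law])
  show "rooted_cluster d v \<in> config_law \<rightarrow>\<^sub>M shapes"
    using rooted_cluster_measurable[OF v] by (simp cong: measurable_cong_sets)
  show "measure config_law {\<omega> \<in> {\<omega> \<in> space config_law. is_top \<omega> v b}. rooted_cluster d v \<omega> \<in> B} =
      measure config_law {\<omega> \<in> space config_law. is_top \<omega> v b} * measure (cluster_law b) B" if "B \<in> sets shapes" for B
    using top_cluster_prob[OF v that, of b] by (simp add: conj_assoc)
qed

lemma top_cluster_indep_outside: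
  assumes v: "v \<in> tree_verts d"
  defines "out \<equiv> {e \<in> tree_edges d. \<not> strict_prefix v e}"
  shows "prob_space.indep_var
    (uniform_measure config_law {\<omega> \<in> space config_law. parent_closed \<omega> v \<and> infinite_below d \<omega> v = b})
    shapes (rooted_cluster d v) (config_space out) (\<lambda>\<omega>. restrict \<omega> out)"
proof (rule indep_var_uniform_measureI[OF prob_space_config_law sets_top top_prob(3)[OF v]])
  show "rooted_cluster d v \<in> config_law \<rightarrow>\<^sub>M shapes"
    using rooted_cluster_measurable[OF v] by (simp cong: measurable_cong_sets)
  have "(\<lambda>\<omega>. restrict \<omega> out) \<in> configs \<rightarrow>\<^sub>M config_space out"
    by (intro measurable_to_config_space) measurable
  then show "(\<lambda>\<omega>. restrict \<omega> out) \<in> config_law \<rightarrow>\<^sub>M config_space out"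
    by (simp cong: measurable_cong_sets)
  fix B C assume B: "B \<in> sets shapes" and C: "C \<in> sets (config_space out)"
  show "measure config_law {\<omega> \<in> {\<omega> \<in> space config_law. is_top \<omega> v b}. rooted_cluster d v \<omega> \<in> B \<and> restrict \<omega> out \<in> C} *
      measure config_law {\<omega> \<in> space config_law. is_top \<omega> v b} =
      measure config_law {\<omega> \<in> {\<omega> \<in> space config_law. is_top \<omega> v b}. rooted_cluster d v \<omega> \<in> B} *
      measure config_law {\<omega> \<in> {\<omega> \<in> space config_law. is_top \<omega> v b}. restrict \<omega> out \<in> C}"
    using top_cluster_factor[OF v C[unfolded out_def] B, of b] top_cluster_prob[OF v B, of b]
    by (simp add: out_def conj_ac)
qed

context
  fixes x :: "nat \<Rightarrow> vertex"
  assumes expl: "exploration_order d x"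
begin

lemma x_verts: "x i \<in> tree_verts d" and x_inj: "inj x" and x_surj: "range x = tree_verts d"
  using expl by (auto simp: exploration_order_def bij_betw_def)

lemma x_earlier: "j < i \<Longrightarrow> \<not> prefix (x i) (x j)"
proof
  assume ji: "j < i" and p: "prefix (x i) (x j)"
  have "x i \<noteq> x j" using x_inj ji by (auto dest: injD)
  then have "strict_prefix (x i) (x j)" using p by auto
  then have "i < j" using expl by (simp add: exploration_order_def)
  then show False using ji by simp
qed

abbreviation tops :: "(vertex \<Rightarrow> bool) \<Rightarrow> nat set" where
  "tops \<omega> \<equiv> {i. finite_cluster_top d \<omega> (x i)}"

lemma AE_tops_infinite: "AE \<omega> in config_law. infinite (tops \<omega>)"
  using AE_tops[of False]
proof eventually_elim
  case (elim \<omega>)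
  have "{v \<in> tree_verts d. parent_closed \<omega> v \<and> infinite_below d \<omega> v = False} \<subseteq> x ` tops \<omega>"
  proof
    fix v assume v: "v \<in> {v \<in> tree_verts d. parent_closed \<omega> v \<and> infinite_below d \<omega> v = False}"
    then obtain i where "v = x i" using x_surj by blast
    then show "v \<in> x ` tops \<omega>" using v finite_cluster_top_iff[OF x_verts[of i], of \<omega>] by blast
  qed
  then show ?case using elim finite_surj by blast
qed

lemma pred_finite_cluster_top [measurable]: "Measurable.pred configs (\<lambda>\<omega>. finite_cluster_top d \<omega> (x i))"
  unfolding finite_cluster_top_iff[OF x_verts] by measurable

lemma measurable_finite_cluster_seq:
  "finite_cluster_seq d x \<in> configs \<rightarrow>\<^sub>M (\<Pi>\<^sub>M k\<in>UNIV. shapes)"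
proof (rule measurable_PiM_single')
  fix k
  have "(\<lambda>\<omega>. rooted_cluster d (x (enumerate (tops \<omega>) k)) \<omega>) \<in> configs \<rightarrow>\<^sub>M shapes"
    by (rule measurable_compose_countable[where f = "\<lambda>n \<omega>. rooted_cluster d (x n) \<omega>"])
      (auto intro!: rooted_cluster_measurable x_verts measurable_enumerate)
  then show "(\<lambda>\<omega>. finite_cluster_seq d x \<omega> k) \<in> configs \<rightarrow>\<^sub>M shapes"
    by (simp add: finite_cluster_seq_def)
qed (auto simp: finite_cluster_seq_def rooted_cluster_descendants[OF x_verts] descendants_def space_config_space)

definition rank :: "(vertex \<Rightarrow> bool) \<Rightarrow> nat \<Rightarrow> nat" where
  "rank \<omega> i = card {j. j < i \<and> j \<in> tops \<omega>}"

text \<open>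
  Exactly \<open>m\<close> finite clusters have been found before the step \<open>i\<close>, and the
  \<open>k\<close>-th of them is in \<open>A k\<close>. The redundant variable \<open>k\<close> makes this a
  countable combination of measurable conditions.
\<close>

definition history :: "(nat \<Rightarrow> (vertex \<Rightarrow> bool) set) \<Rightarrow> nat \<Rightarrow> nat \<Rightarrow> (vertex \<Rightarrow> bool) \<Rightarrow> bool" where
  "history A m i \<omega> \<longleftrightarrow> rank \<omega> i = m \<and>
     (\<forall>j. j < i \<longrightarrow> j \<in> tops \<omega> \<longrightarrow> (\<forall>k. rank \<omega> j = k \<longrightarrow> rooted_cluster d (x j) \<omega> \<in> A k))"

lemma pred_history:
  assumes A: "\<And>k. A k \<in> sets shapes"
  shows "Measurable.pred configs (history A m i)"
proof -
  have [measurable]: "Measurable.pred configs (\<lambda>\<omega>. rooted_cluster d (x j) \<omega> \<in> A k)" for j k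
    by (rule pred_sets2[OF A rooted_cluster_measurable[OF x_verts]])
  have [measurable]: "(\<lambda>\<omega>. rank \<omega> j) \<in> configs \<rightarrow>\<^sub>M count_space UNIV" for j
    unfolding rank_def
  proof (rule measurable_card)
    fix l
    have "Measurable.pred configs (\<lambda>\<omega>. l < j \<and> l \<in> tops \<omega>)" by simp
    from predE[OF this] show "{\<omega> \<in> space configs. l \<in> {l. l < j \<and> l \<in> tops \<omega>}} \<in> sets configs"
      by (simp only: mem_Collect_eq)
  qed
  show ?thesis unfolding history_def mem_Collect_eq by measurable
qed

text \<open>
  The exploration visits a vertex before its descendants, so the history of \<open>x i\<close> concerns
  clusters of vertices not below \<open>x i\<close>. If the parent edge of \<open>x i\<close> is closed, these
  clusters do not enter the part below \<open>x i\<close>.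
\<close>

lemma history_prune:
  assumes c: "parent_closed \<omega> (x i)" and \<omega>: "\<omega> \<in> space configs"
  shows "history A m i (\<lambda>e\<in>tree_edges d. \<not> strict_prefix (x i) e \<and> \<omega> e) = history A m i \<omega>"
proof -
  let ?\<omega>' = "\<lambda>e\<in>tree_edges d. \<not> strict_prefix (x i) e \<and> \<omega> e"
  have ob: "open_below ?\<omega>' (x j) y = open_below \<omega> (x j) y" if "j < i" "y \<in> tree_verts d" for j y
    by (rule open_below_prune[OF c x_earlier[OF that(1)] x_verts that(2)])
  have pc: "parent_closed ?\<omega>' (x j) = parent_closed \<omega> (x j)" if "j < i" for j
    using x_earlier[OF that] x_verts[of j] by (auto simp: parent_closed_def)
  have inf: "infinite_below d ?\<omega>' (x j) = infinite_below d \<omega> (x j)" if "j < i" for j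
  proof -
    have "{y \<in> tree_verts d. open_below ?\<omega>' (x j) y} = {y \<in> tree_verts d. open_below \<omega> (x j) y}"
      using ob[OF that] by blast
    then show ?thesis unfolding infinite_below_def by simp
  qed
  have top: "finite_cluster_top d ?\<omega>' (x j) = finite_cluster_top d \<omega> (x j)" if "j < i" for j
    unfolding finite_cluster_top_iff[OF x_verts] pc[OF that] inf[OF that] ..
  have rank: "rank ?\<omega>' j = rank \<omega> j" if "j \<le> i" for j
    unfolding rank_def using top that by (intro arg_cong[where f = card] Collect_cong) auto
  have rc: "rooted_cluster d (x j) ?\<omega>' = rooted_cluster d (x j) \<omega>" if "j < i" for j
    unfolding rooted_cluster_descendants[OF x_verts] descendants_def
    by (rule restrict_ext) (rule ob[OF that])
  show ?thesis
    unfolding history_def using top rank rc by (auto simp: less_imp_le)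
qed

text \<open>
  By \<open>history_prune\<close>, at a top \<open>x i\<close> the history is an event of the edges that are
  not strictly below \<open>x i\<close>, and \<open>top_cluster_factor\<close> applies.
\<close>

lemma history_cluster_prob:
  assumes A: "\<And>k. A k \<in> sets shapes" and B: "B \<in> sets shapes"
  shows "\<P>(\<omega> in config_law. finite_cluster_top d \<omega> (x i) \<and> history A m i \<omega> \<and> rooted_cluster d (x i) \<omega> \<in> B) =
    \<P>(\<omega> in config_law. finite_cluster_top d \<omega> (x i) \<and> history A m i \<omega>) * measure (percolation_tree d (1 / real d)) B"
proof -
  define out where "out = {e \<in> tree_edges d. \<not> strict_prefix (x i) e}"
  \<comment> \<open>the edges strictly below \<open>x i\<close> are filled in as closed, which does not change the history\<close>
  define ext where "ext h = (\<lambda>e\<in>tree_edges d. e \<in> out \<and> h e)" for h :: "vertex \<Rightarrow> bool"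
  define G where "G = {h \<in> space (config_space out). history A m i (ext h)}"
  have G: "G \<in> sets (config_space out)"
  proof -
    have "ext \<in> config_space out \<rightarrow>\<^sub>M configs"
      unfolding ext_def by (rule measurable_to_config_space) measurable
    from measurable_compose[OF this pred_history[where A = A, OF A]] show ?thesis
      unfolding G_def by (rule predE)
  qed
  have iff: "(finite_cluster_top d \<omega> (x i) \<and> history A m i \<omega>) \<longleftrightarrow> (is_top \<omega> (x i) False \<and> restrict \<omega> out \<in> G)"
    if "\<omega> \<in> space config_law" for \<omega>
  proof -
    have \<omega>: "\<omega> \<in> space configs" using that by (simp add: config_law_def)
    have "ext (restrict \<omega> out) = (\<lambda>e\<in>tree_edges d. \<not> strict_prefix (x i) e \<and> \<omega> e)"
      unfolding ext_def by (rule restrict_ext) (auto simp: out_def)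
    moreover have "restrict \<omega> out \<in> space (config_space out)" by (simp add: space_config_space)
    ultimately show ?thesis
      unfolding finite_cluster_top_iff[OF x_verts] G_def using history_prune[OF _ \<omega>] by auto
  qed
  have "\<P>(\<omega> in config_law. finite_cluster_top d \<omega> (x i) \<and> history A m i \<omega> \<and> rooted_cluster d (x i) \<omega> \<in> B) =
      \<P>(\<omega> in config_law. is_top \<omega> (x i) False \<and> restrict \<omega> out \<in> G \<and> rooted_cluster d (x i) \<omega> \<in> B)"
    using iff by (intro arg_cong[where f = "measure _"] Collect_cong) blast
  also have "\<dots> = \<P>(\<omega> in config_law. is_top \<omega> (x i) False \<and> restrict \<omega> out \<in> G) * measure (cluster_law False) B"
    unfolding out_def by (rule top_cluster_factor[OF x_verts G[unfolded out_def] B])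
  also have "\<P>(\<omega> in config_law. is_top \<omega> (x i) False \<and> restrict \<omega> out \<in> G) =
      \<P>(\<omega> in config_law. finite_cluster_top d \<omega> (x i) \<and> history A m i \<omega>)"
    using iff by (intro arg_cong[where f = "measure _"] Collect_cong) blast
  finally show ?thesis by (simp add: cluster_law_def)
qed

text \<open>
  The step \<open>i\<close> is the one at which the \<open>m\<close>-th finite cluster (counted from
  \<open>0\<close>) is found.
\<close>

lemma history_iff:
  assumes inf: "infinite (tops \<omega>)"
  shows "(\<forall>k<m. finite_cluster_seq d x \<omega> k \<in> A k) \<longleftrightarrow> (\<exists>i. i \<in> tops \<omega> \<and> history A m i \<omega>)"
proof -
  note en = enumerate_eq_iff[OF inf, folded rank_def]
  have "history A m i \<omega> \<longleftrightarrow> (\<forall>k<m. finite_cluster_seq d x \<omega> k \<in> A k)" if i: "i = enumerate (tops \<omega>) m" for i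
  proof
    assume H: "history A m i \<omega>"
    show "\<forall>k<m. finite_cluster_seq d x \<omega> k \<in> A k"
    proof safe
      fix k assume "k < m"
      let ?j = "enumerate (tops \<omega>) k"
      have "?j < i" using enumerate_mono[OF \<open>k < m\<close> inf] i by simp
      moreover have "?j \<in> tops \<omega>" "rank \<omega> ?j = k" using en[of k ?j] by blast+
      ultimately show "finite_cluster_seq d x \<omega> k \<in> A k"
        using H unfolding history_def finite_cluster_seq_def by blast
    qed
  next
    assume R: "\<forall>k<m. finite_cluster_seq d x \<omega> k \<in> A k"
    show "history A m i \<omega>"
      unfolding history_def
    proof (intro conjI allI impI)
      show "rank \<omega> i = m" using en[of m i] i by blast
      fix j k assume j: "j < i" "j \<in> tops \<omega>" "rank \<omega> j = k"
      then have e: "enumerate (tops \<omega>) k = j" using en[of k j] by blast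
      have "enumerate (tops \<omega>) k < enumerate (tops \<omega>) m" unfolding e using j(1) i by simp
      then have "k < m" using enumerate_mono_iff[OF inf] by blast
      then show "rooted_cluster d (x j) \<omega> \<in> A k" using R e by (auto simp: finite_cluster_seq_def)
    qed
  qed
  moreover have "i = enumerate (tops \<omega>) m" if "i \<in> tops \<omega>" "history A m i \<omega>" for i
    using that en[of m i] by (auto simp: history_def)
  moreover have "enumerate (tops \<omega>) m \<in> tops \<omega>" by (rule enumerate_in_set[OF inf])
  ultimately show ?thesis by metis
qed

text \<open>
  Induction on the number of clusters. Splitting by the step \<open>i\<close> at which the next finite cluster
  is found, each summand gains the same factor by \<open>history_cluster_prob\<close>.
\<close>

lemma finite_cluster_seq_prob:
  assumes A: "\<And>k. A k \<in> sets shapes"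
  shows "\<P>(\<omega> in config_law. \<forall>k<m. finite_cluster_seq d x \<omega> k \<in> A k) =
    (\<Prod>k<m. measure (percolation_tree d (1 / real d)) (A k))"
proof (induction m)
  case 0
  then show ?case using prob_space.prob_space[OF prob_space_config_law] by simp
next
  case (Suc m)
  interpret L: prob_space config_law by (rule prob_space_config_law)
  let ?\<pi> = "measure (percolation_tree d (1 / real d))"
  have mtop [measurable]: "Measurable.pred config_law (\<lambda>\<omega>. finite_cluster_top d \<omega> (x i))" for i
    by measurable
  have mh [measurable]: "Measurable.pred config_law (history A m i)" for i
    using pred_history[where A = A, OF A] by (simp cong: measurable_cong_sets)
  have mr [measurable]: "Measurable.pred config_law (\<lambda>\<omega>. rooted_cluster d (x i) \<omega> \<in> A k)" for i k
    using pred_sets2[OF A rooted_cluster_measurable[OF x_verts]] by (simp cong: measurable_cong_sets)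
  have seq_m: "Measurable.pred config_law (\<lambda>\<omega>. \<forall>k<n. finite_cluster_seq d x \<omega> k \<in> A k)" for n
  proof -
    have "Measurable.pred configs (\<lambda>\<omega>. finite_cluster_seq d x \<omega> k \<in> A k)" for k
      by (rule pred_sets2[OF A measurable_compose[OF measurable_finite_cluster_seq measurable_component_singleton]]) simp
    then have [measurable]: "Measurable.pred config_law (\<lambda>\<omega>. finite_cluster_seq d x \<omega> k \<in> A k)" for k
      by (simp cong: measurable_cong_sets)
    show ?thesis by measurable
  qed
  define E where "E i = {\<omega> \<in> space config_law. finite_cluster_top d \<omega> (x i) \<and> history A m i \<omega>}" for i
  define E' where "E' i = {\<omega> \<in> space config_law. finite_cluster_top d \<omega> (x i) \<and> history A m i \<omega> \<and> rooted_cluster d (x i) \<omega> \<in> A m}" for i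
  have unique: "i = j" if "\<omega> \<in> E i" "\<omega> \<in> E j" for \<omega> i j
  proof (rule ccontr)
    assume "i \<noteq> j"
    moreover have False if "\<omega> \<in> E i" "\<omega> \<in> E j" "i < j" for i j
    proof -
      have "{l. l < i \<and> l \<in> tops \<omega>} \<subset> {l. l < j \<and> l \<in> tops \<omega>}"
        using that by (auto simp: E_def)
      then have "rank \<omega> i < rank \<omega> j" unfolding rank_def by (intro psubset_card_mono) auto
      then show False using that by (simp add: E_def history_def)
    qed
    ultimately show False using that by (meson linorder_neqE_nat)
  qed
  have sE: "range E \<subseteq> sets config_law" and sE': "range E' \<subseteq> sets config_law"
  proof -
    have "Measurable.pred config_law (\<lambda>\<omega>. finite_cluster_top d \<omega> (x i) \<and> history A m i \<omega>)" for i by measurable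
    from predE[OF this] show "range E \<subseteq> sets config_law" unfolding E_def by blast
    have "Measurable.pred config_law (\<lambda>\<omega>. finite_cluster_top d \<omega> (x i) \<and> history A m i \<omega> \<and> rooted_cluster d (x i) \<omega> \<in> A m)" for i
      by measurable
    from predE[OF this] show "range E' \<subseteq> sets config_law" unfolding E'_def by blast
  qed
  have dE: "disjoint_family E" unfolding disjoint_family_on_def using unique by blast
  have "E' i \<subseteq> E i" for i by (auto simp: E_def E'_def)
  then have dE': "disjoint_family E'" unfolding disjoint_family_on_def using unique by blast
  have now: "\<P>(\<omega> in config_law. \<forall>k<m. finite_cluster_seq d x \<omega> k \<in> A k) = measure config_law (\<Union>i. E i)"
  proof (rule L.finite_measure_eq_AE)
    show "AE \<omega> in config_law. (\<omega> \<in> {\<omega> \<in> space config_law. \<forall>k<m. finite_cluster_seq d x \<omega> k \<in> A k}) = (\<omega> \<in> (\<Union>i. E i))"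
      using AE_tops_infinite
    proof eventually_elim
      case (elim \<omega>)
      then show ?case unfolding E_def using history_iff[OF elim, of m A] by blast
    qed
    show "{\<omega> \<in> space config_law. \<forall>k<m. finite_cluster_seq d x \<omega> k \<in> A k} \<in> sets config_law"
      by (rule predE[OF seq_m])
  qed (use sE in blast)
  have "\<P>(\<omega> in config_law. \<forall>k<Suc m. finite_cluster_seq d x \<omega> k \<in> A k) = measure config_law (\<Union>i. E' i)"
  proof (rule L.finite_measure_eq_AE)
    show "AE \<omega> in config_law. (\<omega> \<in> {\<omega> \<in> space config_law. \<forall>k<Suc m. finite_cluster_seq d x \<omega> k \<in> A k}) = (\<omega> \<in> (\<Union>i. E' i))"
      using AE_tops_infinite
    proof eventually_elim
      case (elim \<omega>)
      have last: "finite_cluster_seq d x \<omega> m = rooted_cluster d (x i) \<omega>" if "i \<in> tops \<omega>" "history A m i \<omega>" for i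
      proof -
        have "enumerate (tops \<omega>) m = i"
          using that enumerate_eq_iff[OF elim, of m i] by (auto simp: history_def rank_def)
        then show ?thesis by (simp add: finite_cluster_seq_def)
      qed
      have "(\<forall>k<Suc m. finite_cluster_seq d x \<omega> k \<in> A k) \<longleftrightarrow>
          finite_cluster_seq d x \<omega> m \<in> A m \<and> (\<exists>i. i \<in> tops \<omega> \<and> history A m i \<omega>)"
        unfolding history_iff[OF elim, symmetric] less_Suc_eq by auto
      also have "\<dots> \<longleftrightarrow> (\<exists>i. i \<in> tops \<omega> \<and> history A m i \<omega> \<and> rooted_cluster d (x i) \<omega> \<in> A m)"
        using last by auto
      finally show ?case unfolding E'_def by auto
    qed
    show "{\<omega> \<in> space config_law. \<forall>k<Suc m. finite_cluster_seq d x \<omega> k \<in> A k} \<in> sets config_law"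
      by (rule predE[OF seq_m])
  qed (use sE' in blast)
  also have "\<dots> = measure config_law (\<Union>i. E i) * ?\<pi> (A m)"
  proof (rule sums_unique2)
    show "(\<lambda>i. measure config_law (E' i)) sums measure config_law (\<Union>i. E' i)"
      by (rule L.finite_measure_UNION[OF sE' dE'])
    have "(\<lambda>i. measure config_law (E i) * ?\<pi> (A m)) sums (measure config_law (\<Union>i. E i) * ?\<pi> (A m))"
      by (intro sums_mult2 L.finite_measure_UNION[OF sE dE])
    then show "(\<lambda>i. measure config_law (E' i)) sums (measure config_law (\<Union>i. E i) * ?\<pi> (A m))"
      unfolding E_def E'_def using history_cluster_prob[where A = A, OF A A] by simp
  qed
  finally show ?case unfolding now[symmetric] Suc by simp
qed

theorem finite_cluster_seq_law:
  "distr config_law (\<Pi>\<^sub>M k\<in>UNIV. shapes) (finite_cluster_seq d x) =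
    (\<Pi>\<^sub>M k\<in>UNIV. percolation_tree d (1 / real d))"
proof (rule sym, rule measure_eqI_PiM_infinite)
  let ?\<pi> = "percolation_tree d (1 / real d)"
  let ?R = "PiM (UNIV :: nat set) (\<lambda>_. ?\<pi>)"
  interpret L: prob_space config_law by (rule prob_space_config_law)
  interpret pi: prob_space ?\<pi> by simp
  interpret R: prob_space ?R by (intro prob_space_PiM) simp
  have ms: "finite_cluster_seq d x \<in> config_law \<rightarrow>\<^sub>M (\<Pi>\<^sub>M k\<in>UNIV. shapes)"
    using measurable_finite_cluster_seq by (simp cong: measurable_cong_sets)
  show "sets ?R = sets ?R" ..
  have sR: "sets ?R = sets (\<Pi>\<^sub>M k\<in>(UNIV :: nat set). shapes)"
    by (rule sets_PiM_cong) (auto simp: sets_percolation_tree)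
  show "sets (distr config_law (\<Pi>\<^sub>M k\<in>UNIV. shapes) (finite_cluster_seq d x)) = sets ?R"
    by (simp add: sR)
  show "finite_measure ?R" by unfold_locales
  fix A and J :: "nat set" assume J: "finite J" "J \<subseteq> UNIV" "\<And>i. i \<in> J \<Longrightarrow> A i \<in> sets ?\<pi>"
  let ?S = "prod_emb UNIV (\<lambda>_. ?\<pi>) J (Pi\<^sub>E J A)"
  obtain N where N: "\<And>k. k \<in> J \<Longrightarrow> k < N" using J(1) by (meson finite_nat_bounded lessThan_iff subsetD)
  define A' where "A' k = (if k \<in> J then A k else space ?\<pi>)" for k
  have A': "A' k \<in> sets shapes" for k
    using J(3)[of k] sets.top[of ?\<pi>] by (auto simp: A'_def sets_percolation_tree)
  have S: "?S \<in> sets (\<Pi>\<^sub>M k\<in>UNIV. shapes)"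
    unfolding sR[symmetric] using J by (intro sets_PiM_I) auto
  have sp: "space ?\<pi> = space shapes" by (rule sets_eq_imp_space_eq) (rule sets_percolation_tree)
  have "emeasure (distr config_law (\<Pi>\<^sub>M k\<in>UNIV. shapes) (finite_cluster_seq d x)) ?S =
      emeasure config_law (finite_cluster_seq d x -` ?S \<inter> space config_law)"
    by (rule emeasure_distr[OF ms S])
  also have "finite_cluster_seq d x -` ?S \<inter> space config_law =
      {\<omega> \<in> space config_law. \<forall>k<N. finite_cluster_seq d x \<omega> k \<in> A' k}"
  proof (intro set_eqI)
    fix \<omega>
    have "finite_cluster_seq d x \<omega> k \<in> space ?\<pi>" if "\<omega> \<in> space config_law" for k
      using measurable_space[OF ms that] by (auto simp: space_PiM sp)
    then show "\<omega> \<in> finite_cluster_seq d x -` ?S \<inter> space config_law \<longleftrightarrow>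
        \<omega> \<in> {\<omega> \<in> space config_law. \<forall>k<N. finite_cluster_seq d x \<omega> k \<in> A' k}"
      using N by (auto simp: prod_emb_def PiE_iff A'_def)
  qed
  also have "emeasure config_law \<dots> = ennreal (\<Prod>k<N. measure ?\<pi> (A' k))"
    unfolding L.emeasure_eq_measure finite_cluster_seq_prob[where A = A', OF A'] ..
  also have "(\<Prod>k<N. measure ?\<pi> (A' k)) = (\<Prod>k\<in>J. measure ?\<pi> (A k))"
    using N pi.prob_space by (intro prod.mono_neutral_cong_right) (auto simp: A'_def)
  also have "ennreal \<dots> = emeasure ?R ?S"
    using J by (subst emeasure_PiM_emb) (auto simp: pi.emeasure_eq_measure prod_ennreal)
  finally show "emeasure ?R ?S = emeasure (distr config_law (\<Pi>\<^sub>M k\<in>UNIV. shapes) (finite_cluster_seq d x)) ?S" by simp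
qed

end

end


section \<open>The phase transition\<close>

theorem theorem1p2:
  fixes d :: nat and p :: real
  assumes "2 \<le> d" and "0 \<le> p" and "p < 1"
  shows
    "(\<exists>!P. arboreal_gas_weak_limit d p P) \<and>
     (\<forall>P. arboreal_gas_weak_limit d p P \<longrightarrow>
       \<comment> \<open>(1)\<close>
       (p \<le> 1 / real d \<longrightarrow> P = bernoulli_percolation d p) \<and>
       \<comment> \<open>(2)\<close>
       (1 / real d < p \<longrightarrow>
         (AE \<omega> in P. infinite {C \<in> graph_components (open_subgraph (tree d) \<omega>). infinite C}) \<and>
         (AE \<omega> in P. \<forall>C \<in> graph_components (open_subgraph (tree d) \<omega>).
            infinite C \<longrightarrow> one_ended (open_subgraph (tree d) \<omega>) C) \<and>
         \<comment> \<open>(a)\<close>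
         (\<forall>v \<in> tree_verts d.
            \<P>(\<omega> in P. infinite (cluster d \<omega> v) \<bar> parent_closed \<omega> v) =
              (real d * p - 1) / (p * (real d - 1)) \<and>
            distr
              (uniform_measure P
                 {\<omega> \<in> space P. parent_closed \<omega> v \<and> infinite (cluster d \<omega> v)})
              (config_space (tree_verts d)) (rooted_cluster d v) =
            distr (spine_space d) (config_space (tree_verts d)) (spine_cluster d)) \<and>
         \<comment> \<open>(b)\<close>
         distr (spine_space d) (\<Pi>\<^sub>M k\<in>UNIV. count_space UNIV)
           (\<lambda>(\<xi>, \<eta>, \<tau>). \<lambda>k. card (open_side_edges d \<xi> \<eta> k)) =
         (\<Pi>\<^sub>M k\<in>(UNIV :: nat set). measure_pmf (binomial_pmf (d - 1) (1 / real d))) \<and>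
         branching_process d (binomial_pmf d (1 / real d)) (percolation_tree d (1 / real d)) \<and>
         measure_pmf.expectation (binomial_pmf d (1 / real d)) real = 1 \<and>
         (AE T in percolation_tree d (1 / real d). finite {x \<in> tree_verts d. T x}) \<and>
         \<comment> \<open>(c)\<close>
         (\<forall>v \<in> tree_verts d.
            (let P' = uniform_measure P {\<omega> \<in> space P. finite_cluster_top d \<omega> v};
                 outside = {e \<in> tree_edges d. \<not> strict_prefix v e}
             in distr P' (config_space (tree_verts d)) (rooted_cluster d v) =
                  percolation_tree d (1 / real d) \<and>
                prob_space.indep_var P'
                  (config_space (tree_verts d)) (rooted_cluster d v)
                  (config_space outside) (\<lambda>\<omega>. restrict \<omega> outside))) \<and>
         (\<forall>x. exploration_order d x \<longrightarrow>
            (AE \<omega> in P. infinite {i. finite_cluster_top d \<omega> (x i)}) \<and>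
            distr P (\<Pi>\<^sub>M k\<in>UNIV. config_space (tree_verts d)) (finite_cluster_seq d x) =
              (\<Pi>\<^sub>M k\<in>UNIV. percolation_tree d (1 / real d)))))"
proof -
  define q where "q = survival_prob d p"
  define s where "s = side_prob d p"
  define L where "L = growth.config_law d q s"
  have lim: "arboreal_gas_weak_limit d p L"
    using config_law_weak_limit[OF assms] by (simp add: L_def q_def s_def)
  have all_eq: "P = L" if "arboreal_gas_weak_limit d p P" for P
    by (rule weak_limit_unique[OF that lim])
  interpret G: growth d q s unfolding q_def s_def by (rule growth_params(1)[OF assms])
  have sub: "L = bernoulli_percolation d p" if "p \<le> 1 / real d"
  proof -
    have "q = 0" "s = p"
      using survival_prob_fixed_point(4)[OF assms that] growth_params(3)[OF assms that] by (simp_all add: q_def s_def)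
    then show ?thesis using G.config_law_no_survivors by (simp add: L_def)
  qed
  have unique: "\<exists>!P. arboreal_gas_weak_limit d p P" using lim all_eq by blast
  show ?thesis
  proof (cases "1 / real d < p")
    case False
    show ?thesis
      by (rule conjI[OF unique], intro allI impI, drule all_eq, hypsubst, rule conjI; rule impI;
          (rule sub, assumption | erule notE[OF False]))
  next
    case True
    have s_eq: "s = 1 / real d" using growth_params(4)[OF assms True] by (simp add: s_def)
    interpret supercritical d q
      using G.growth_axioms survival_prob_fixed_point(2)[OF assms] survival_prob_fixed_point(6)[OF assms True]
      unfolding s_eq by (auto simp: supercritical_def supercritical_axioms_def q_def)
    have L: "L = config_law" by (simp only: L_def s_eq)
    have q_eq: "q = (real d * p - 1) / (p * (real d - 1))"
      using True by (simp add: q_def survival_prob_def)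
    have inf_top: "{\<omega> \<in> space L. parent_closed \<omega> v \<and> infinite (cluster d \<omega> v)} =
        {\<omega> \<in> space config_law. parent_closed \<omega> v \<and> infinite_below d \<omega> v = True}" if "v \<in> tree_verts d" for v
      unfolding L by (intro Collect_cong conj_cong refl) (simp only: infinite_cluster_top[OF that] eq_True)
    have fin_top: "{\<omega> \<in> space L. finite_cluster_top d \<omega> v} =
        {\<omega> \<in> space config_law. parent_closed \<omega> v \<and> infinite_below d \<omega> v = False}" if "v \<in> tree_verts d" for v
      unfolding L finite_cluster_top_iff[OF that] ..
    have comps: "AE \<omega> in L. infinite {C \<in> graph_components (open_subgraph (tree d) \<omega>). infinite C}"
      using AE_tops[of True] unfolding L
      by eventually_elim (rule infinitely_many_infinite_components, simp)
    have one_end: "AE \<omega> in L. \<forall>C \<in> graph_components (open_subgraph (tree d) \<omega>).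
        infinite C \<longrightarrow> one_ended (open_subgraph (tree d) \<omega>) C"
      using AE_unique_heir unfolding L
      by eventually_elim (auto intro: heir_configuration.infinite_components_one_ended heir_configuration.intro)
    have a1: "\<P>(\<omega> in L. infinite (cluster d \<omega> v) \<bar> parent_closed \<omega> v) = (real d * p - 1) / (p * (real d - 1))"
      if v: "v \<in> tree_verts d" for v
    proof -
      have "{\<omega> \<in> space L. infinite (cluster d \<omega> v) \<and> parent_closed \<omega> v} =
          {\<omega> \<in> space config_law. parent_closed \<omega> v \<and> infinite_below d \<omega> v = True}"
        using inf_top[OF v] by auto
      then show ?thesis
        unfolding cond_prob_def q_eq[symmetric] using top_prob(1)[OF v, of True] top_prob(2)[OF v] by (simp add: L)
    qed
    have a2: "distr (uniform_measure L {\<omega> \<in> space L. parent_closed \<omega> v \<and> infinite (cluster d \<omega> v)})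
          (config_space (tree_verts d)) (rooted_cluster d v) =
        distr (spine_space d) (config_space (tree_verts d)) (spine_cluster d)" if v: "v \<in> tree_verts d" for v
      unfolding inf_top[OF v] unfolding L conditional_cluster_law[OF v] by (simp add: cluster_law_def)
    have c1: "let P' = uniform_measure L {\<omega> \<in> space L. finite_cluster_top d \<omega> v};
           outside = {e \<in> tree_edges d. \<not> strict_prefix v e}
       in distr P' (config_space (tree_verts d)) (rooted_cluster d v) = percolation_tree d (1 / real d) \<and>
          prob_space.indep_var P' (config_space (tree_verts d)) (rooted_cluster d v)
            (config_space outside) (\<lambda>\<omega>. restrict \<omega> outside)" if v: "v \<in> tree_verts d" for v
      unfolding Let_def fin_top[OF v] unfolding L conditional_cluster_law[OF v]
      using top_cluster_indep_outside[OF v, where b = False] by (simp add: cluster_law_def)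
    have c2: "(AE \<omega> in L. infinite {i. finite_cluster_top d \<omega> (x i)}) \<and>
        distr L (\<Pi>\<^sub>M k\<in>UNIV. config_space (tree_verts d)) (finite_cluster_seq d x) =
          (\<Pi>\<^sub>M k\<in>UNIV. percolation_tree d (1 / real d))" if "exploration_order d x" for x
      unfolding L using AE_tops_infinite[OF that] finite_cluster_seq_law[OF that] by simp
    have r: "0 \<le> 1 / real d" "1 / real d \<le> 1" using d by auto
    have mean: "measure_pmf.expectation (binomial_pmf d (1 / real d)) real = 1"
      using expectation_binomial_pmf[OF r, of d] d by simp
    show ?thesis
      by (rule conjI[OF unique], intro allI impI, drule all_eq, hypsubst, intro conjI ballI allI impI;
          (rule comps one_end side_counts_law[OF d] percolation_tree_branching_process[OF r] mean
             AE_percolation_tree_finite[OF d]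
           | (rule sub a1 a2 c1 c2[THEN conjunct1] c2[THEN conjunct2], assumption)))
  qed
qed

end
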